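(* Let $n\ge1$, $s\in[\tfrac12,1)$, $a=1-2s$, and let $$\widetilde{\mathcal H}_s=x_{n+1}^a\partial_t+\operatorname{div}(x_{n+1}^a\nabla)$$ be the backward in time extension operator. There are a sufficiently small $\delta\in(0,1)$ and a large universal constant $M$ such that the following holds. Let $V$, $x_0$, $R$, $\tilde t$ and $V_R$ be as in the context, let $\alpha\ge MR^2$, put $\lambda=\alpha/\delta^2$, and let $w\in C_0^\infty\left(\overline{\mathbb B_4^+}\times[0,\tfrac1{e\lambda})\right)$ satisfy $\partial^a_{x_{n+1}}w\equiv R^{2s}V_Rw$ on $\{x_{n+1}=0\}$. Then for every $0<c\le\frac1{5\lambda}$, $$\begin{aligned} &\alpha^2\int_{\mathbb R^{n+1}_+\times[c,\infty)}x_{n+1}^a\sigma_s^{-2\alpha}(t)\,w^2\,G+\alpha\int_{\mathbb R^{n+1}_+\times[c,\infty)}x_{n+1}^a\sigma_s^{1-2\alpha}(t)\,|\nabla w|^2\,G\\ &\le M\int_{\mathbb R^{n+1}_+\times[c,\infty)}\sigma_s^{1-2\alpha}(t)\,x_{n+1}^{-a}\,|\widetilde{\mathcal H}_sw|^2\,G\\ &\quad+\sigma_s^{-2\alpha}(c)\Big\{-\frac cM\int_{t=c}x_{n+1}^a|\nabla w(X,c)|^2G(X,c)\,dX+M\alpha\int_{t=c}x_{n+1}^a|w(X,c)|^2G(X,c)\,dX\Big\}. \end{aligned}$$ Here $G(X,t)=t^{-\frac{n+1+a}2}e^{-\frac{|X|^2}{4t}}$ and $\sigma_s$ is the function (depending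 on $\lambda$) defined in the context.
   Context: $X=(x,x_{n+1})\in\mathbb R^{n+1}_+=\mathbb R^n\times(0,\infty)$; $\mathbb B_r^+=\{X:|X|<r,\ x_{n+1}>0\}$; $\nabla,\operatorname{div}$ are taken in $X$; $\partial^a_{x_{n+1}}w(x,0,t)=\lim_{x_{n+1}\to0^+}x_{n+1}^a\partial_{x_{n+1}}w(x,x_{n+1},t)$. Space-time integrals are with respect to $dX\,dt$. $C_0^\infty(\overline{\mathbb B_4^+}\times[0,\frac1{e\lambda}))$ denotes smooth functions, up to $\{x_{n+1}=0\}$ and $t=0$, with compact support in $\{X : |X|<4,\ x_{n+1}\ge 0\}\times[0,\frac1{e\lambda})$. Potential: $V$ satisfies $\|V\|_{C^2(\mathbb R^n\times[0,T))}\le1$, $T>4$ (norm in $(x,t)$). $V_R(x,t)=V(Rx+x_0,R^2t+\tilde t)$, where $x_0\in\mathbb R^n$ with $|x_0|\ge M$, $R=2|x_0|/\rho$ with $\rho\in(0,1)$, and $\tilde t\in[0,1/4)$; so $R$ is large. Weight: $\theta_s(t)=t^s\left(\log\frac1t\right)^{1+s}$, and $\sigma_s$ is the solution on $0\le\lambda t\le1$ of $$\frac{d}{dt}\log\left(\frac{\sigma_s}{t\sigma_s'}\right)=\frac{\theta_s(\lambda t)}t,\qquad\sigma_s(0)=0,\quad\sigma_s'(0)=1.$$ (It is known that for a universal $N$, $te^{-N}\le\sigma_s(t)\le t$ and $e^{-N}\le\sigma_s'(t)\le1$ there.) "Universal" constants depend only on $n$ and $s$. *)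

theory Defs
  imports "HOL-Analysis.Analysis"
begin

subsection \<open>Differentiability up to the boundary\<close>

(* Derivatives are taken within S, so that S may contain boundary points.  They are uniquely
   determined for the sets used here, which are convex with non-empty interior; at interior
   points of S they are the ordinary derivatives. *)

definition pderiv_within :: "'a::euclidean_space set \<Rightarrow> 'a \<Rightarrow> ('a \<Rightarrow> real) \<Rightarrow> 'a \<Rightarrow> real" where
  "pderiv_within S b f = (\<lambda>p. frechet_derivative f (at p within S) b)"

fun Ck_on :: "nat \<Rightarrow> 'a::euclidean_space set \<Rightarrow> ('a \<Rightarrow> real) \<Rightarrow> bool" where
  "Ck_on 0 S f \<longleftrightarrow> continuous_on S f"
| "Ck_on (Suc k) S f \<longleftrightarrow>
     f differentiable_on S \<and> (\<forall>b\<in>Basis. Ck_on k S (pderiv_within S b f))"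

definition smooth_upto :: "'a::euclidean_space set \<Rightarrow> ('a \<Rightarrow> real) \<Rightarrow> bool" where
  "smooth_upto S f \<longleftrightarrow> (\<forall>k. Ck_on k S f)"

(* The largest supremum norm of a partial derivative of order at most k.  It is bounded by the
   other customary C^k norms (sums over multi-indices, norms of the derivative tensors), so
   a bound on it is the weakest of the corresponding hypotheses. *)

definition Ck_norm :: "nat \<Rightarrow> 'a::euclidean_space set \<Rightarrow> ('a \<Rightarrow> real) \<Rightarrow> ennreal" where
  "Ck_norm k S f =
     (SUP bs\<in>{bs. set bs \<subseteq> Basis \<and> length bs \<le> k}.
        SUP p\<in>S. ennreal \<bar>foldr (pderiv_within S) bs f p\<bar>)"

subsection \<open>The extension operator in the upper half-space\<close>

(* A point X = (x, x_{n+1}) has type (real^'n) \<times> real, a space-time point is a pair (X, t). *)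

type_synonym 'n pt = "(real^'n) \<times> real"

definition half_space :: "('n::finite) pt set" where
  "half_space = {X. 0 < snd X}"

definition grad :: "('a::euclidean_space \<Rightarrow> real) \<Rightarrow> 'a \<Rightarrow> 'a" where
  "grad f p = (THE D. GDERIV f p :> D)"

definition divergence :: "('a::euclidean_space \<Rightarrow> 'a) \<Rightarrow> 'a \<Rightarrow> real" where
  "divergence F p = (\<Sum>b\<in>Basis. frechet_derivative F (at p) b \<bullet> b)"

definition grad_X :: "(('n::finite) pt \<times> real \<Rightarrow> real) \<Rightarrow> 'n pt \<Rightarrow> real \<Rightarrow> 'n pt" where
  "grad_X w X t = grad (\<lambda>Y. w (Y, t)) X"

definition ext_op :: "real \<Rightarrow> (('n::finite) pt \<times> real \<Rightarrow> real) \<Rightarrow> 'n pt \<Rightarrow> real \<Rightarrow> real" where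
  "ext_op a w X t =
     snd X powr a * deriv (\<lambda>\<tau>. w (X, \<tau>)) t
     + divergence (\<lambda>Y. snd Y powr a *\<^sub>R grad_X w Y t) X"

definition has_weighted_normal_deriv ::
  "real \<Rightarrow> (('n::finite) pt \<times> real \<Rightarrow> real) \<Rightarrow> real^'n \<Rightarrow> real \<Rightarrow> real \<Rightarrow> bool" where
  "has_weighted_normal_deriv a w x t l \<longleftrightarrow>
     ((\<lambda>y. y powr a * deriv (\<lambda>z. w ((x, z), t)) y) \<longlongrightarrow> l) (at_right 0)"

(* Functions smooth up to x_{n+1} = 0 and t = 0, with compact support in
   {|X| < r, x_{n+1} \<ge> 0} \<times> [0, \<tau>).  They are regarded as extended by 0 to the closed set
   {x_{n+1} \<ge> 0, t \<ge> 0}; their values elsewhere play no role. *)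

definition test_fun :: "real \<Rightarrow> real \<Rightarrow> (('n::finite) pt \<times> real \<Rightarrow> real) \<Rightarrow> bool" where
  "test_fun r \<tau> w \<longleftrightarrow>
     (let D = {X. 0 \<le> snd X} \<times> {0..}; K = closure {p \<in> D. w p \<noteq> 0}
      in smooth_upto D w \<and> compact K \<and> K \<subseteq> {X. norm X < r \<and> 0 \<le> snd X} \<times> {0..<\<tau>})"

definition G_kernel :: "real \<Rightarrow> ('n::finite) pt \<Rightarrow> real \<Rightarrow> real" where
  "G_kernel a X t =
     t powr (- ((real CARD('n) + 1 + a) / 2)) * exp (- ((norm X)\<^sup>2 / (4 * t)))"

subsection \<open>The weight\<close>

definition theta :: "real \<Rightarrow> real \<Rightarrow> real" where
  "theta s t = t powr s * ln (1 / t) powr (1 + s)"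

(* \<sigma> is a C^1 function on [0, 1/lam] solving
     d/dt log (\<sigma> / (t \<sigma>')) = theta s (lam t) / t,   \<sigma>(0) = 0,  \<sigma>'(0) = 1.
   The equation is singular at t = 0 and is required on (0, 1/lam]; positivity of the
   argument makes the logarithm meaningful.  Nothing is assumed on \<sigma> outside [0, 1/lam]. *)

definition is_sigma :: "real \<Rightarrow> real \<Rightarrow> (real \<Rightarrow> real) \<Rightarrow> bool" where
  "is_sigma s lam \<sigma> \<longleftrightarrow>
     (\<exists>\<sigma>'. (\<forall>t\<in>{0..1/lam}. (\<sigma> has_real_derivative \<sigma>' t) (at t within {0..1/lam})) \<and>
           continuous_on {0..1/lam} \<sigma>' \<and> \<sigma> 0 = 0 \<and> \<sigma>' 0 = 1 \<and>
           (\<forall>t\<in>{0<..1/lam}. 0 < \<sigma> t / (t * \<sigma>' t) \<and>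
              ((\<lambda>\<tau>. ln (\<sigma> \<tau> / (\<tau> * \<sigma>' \<tau>))) has_real_derivative theta s (lam * t) / t)
                (at t within {0<..1/lam})))"

end

theory Submission
  imports Defs
begin

text \<open>
  Write y for the last coordinate of X.  Two operators are adapted to the measures y^a G(X,t) dX: the
  drift Laplacian A w = y^(-a) div (y^a \<nabla>w) - X\<cdot>\<nabla>w/(2t), which is symmetric, and the derivative
  Z w = \<partial>_t w + X\<cdot>\<nabla>w/(2t) along the parabolic dilations, which satisfies
  d/dt \<integral> f y^a G dX = \<integral> (Z f) y^a G dX and Z |\<nabla>w|^2 = 2 \<nabla>w\<cdot>\<nabla>(Z w) - |\<nabla>w|^2/t.
  The backward extension operator is y^a (Z + A).

  Put P = \<sigma>^(-2\<alpha>), k = \<sigma>/(t \<sigma>'), \<psi> = t k and \<theta>(t) = \<theta>_s(\<lambda>t).  The equation of \<sigma> says exactly that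
  k' = k \<theta>/t.  Split L = Z + A as (Z - \<alpha>/\<psi>) + (A + \<alpha>/\<psi>) and expand P \<psi> (L w)^2.  By the two properties
  of Z and the symmetry of A, the mixed term integrates to terms at t = c and at y = 0 plus the integral of
  P k \<theta> |\<nabla>w|^2: with this weight all contributions to w^2 cancel and the coefficient of |\<nabla>w|^2 is
  nonnegative (\<open>carleman_identity\<close>).  Testing (A + \<alpha>/\<psi>) w against P k \<theta> w controls \<alpha> P (\<theta>/t) w^2 by the same
  quantities (\<open>mass_identity\<close>), and \<open>weighted_absorption\<close> combines the two.  On the support of w one has
  \<theta> \<ge> \<lambda>t \<ge> \<alpha>t, so the two controlled integrals dominate the left-hand side of the theorem
  (\<open>unweighted_conclusion\<close>), and the constants come from 1 \<le> k \<le> C and \<sigma> \<le> t \<le> C \<sigma>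
  (\<open>sigma_properties\<close>).

  It remains to deal with the flux y^a \<partial>_y w at y = 0.  If s > 1/2 then a < 0; since w is smooth up to
  y = 0, a finite limit of y^a \<partial>_y w is possible only if \<partial>_y w = 0 there, and then the limit is 0
  (\<open>normal_zero\<close>, \<open>flux_zero\<close>).  If s = 1/2, the flux is b w with b = R V_R.  The dangerous boundary term
  contains b w Z w = b Z(w^2)/2; a further integration by parts along y = 0 moves Z to b
  (\<open>boundary_energy\<close>).  By the bounds on V and its first derivatives there remain boundary integrals of w^2 with
  a factor of size R^2.  A trace inequality with a free parameter \<eta>, derived from the divergence theorem
  and a Hardy inequality (\<open>trace_inequality\<close>), absorbs them: with \<eta> proportional to \<theta>/R^2 this needs
  R^4 t to be small against \<alpha> \<theta>^2, which holds because \<theta>^2 \<ge> \<lambda>t for s = 1/2 and R^2 \<le> \<alpha>/M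
  (\<open>bulk_trace\<close>).
\<close>

section \<open>Integration by parts in the half-space\<close>

lemma linear_expand_Basis:
  fixes f :: "'a::euclidean_space \<Rightarrow> 'b::real_vector"
  assumes "linear f" shows "f h = (\<Sum>b\<in>Basis. (h \<bullet> b) *\<^sub>R f b)"
proof -
  have "f (\<Sum>b\<in>Basis. (h \<bullet> b) *\<^sub>R b) = (\<Sum>b\<in>Basis. (h \<bullet> b) *\<^sub>R f b)"
    using assms by (simp add: linear_sum linear_scale)
  then show ?thesis by (simp add: euclidean_representation)
qed

lemma linear_expand_fst:
  fixes f :: "'a::euclidean_space \<times> real \<Rightarrow> real"
  assumes "linear f" shows "f (v, 0) = (\<Sum>b\<in>Basis. (v \<bullet> b) * f (b, 0))"
proof -
  have "linear (\<lambda>h. f (h, 0))"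
    by (rule linear_compose[OF _ assms, of "\<lambda>h. (h, 0)", unfolded o_def]) (auto intro!: linearI)
  from linear_expand_Basis[OF this, of v] show ?thesis by simp
qed

lemma integral_translate:
  fixes h :: "'a::euclidean_space \<Rightarrow> real"
  assumes [measurable]: "h \<in> borel_measurable borel"
  shows "(LINT x|lborel. h (x + v)) = (LINT x|lborel. h x)"
proof -
  have "(LINT x|lborel. h x) = (LINT x|distr lborel borel ((+) v). h x)"
    by (simp add: lborel_distr_plus)
  also have "\<dots> = (LINT x|lborel. h (v + x))"
    by (subst integral_distr) auto
  finally show ?thesis by (simp add: add.commute)
qed

lemma integrable_translate:
  fixes h :: "'a::euclidean_space \<Rightarrow> real"
  assumes "integrable lborel h"
  shows "integrable lborel (\<lambda>x. h (x + v))"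
proof -
  have "integrable (distr lborel borel ((+) v)) h" using assms by (simp add: lborel_distr_plus)
  then have "integrable lborel (\<lambda>x. h (v + x))"
    by (subst (asm) integrable_distr_eq) (use assms in auto)
  then show ?thesis by (simp add: add.commute)
qed

text \<open>
  The increments h(x + e) - h(x) integrate to zero by translation invariance, and by Fubini their integral
  is the average over r in [0,1] of the integrals of h'(x + r e), which do not depend on r.  The argument
  needs no pointwise bound for h', which matters because the weight y^a is unbounded for a < 0.
\<close>

lemma integral_directional_derivative:
  fixes h h' :: "'a::euclidean_space \<Rightarrow> real"
  assumes h: "integrable lborel h" and h': "integrable lborel h'"
    and der: "\<And>x r. ((\<lambda>r. h (x + r *\<^sub>R e)) has_real_derivative h' (x + r *\<^sub>R e)) (at r)"
    and cont: "\<And>x. continuous_on UNIV (\<lambda>r. h' (x + r *\<^sub>R e))"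
  shows "(LINT x|lborel. h' x) = 0"
proof -
  note [measurable] = borel_measurable_integrable[OF h'] borel_measurable_integrable[OF h]
  let ?f = "\<lambda>(r::real, x::'a). indicator {0..1} r * h' (x + r *\<^sub>R e)"
  have eq: "(LINT x|lborel. norm (?f (r, x))) = indicator {0..1} r * (LINT x|lborel. \<bar>h' x\<bar>)" for r
    using integral_translate[of "\<lambda>x. \<bar>h' x\<bar>" "r *\<^sub>R e"] by (auto simp: abs_mult indicator_def)
  have fi: "integrable (lborel \<Otimes>\<^sub>M lborel) ?f"
  proof (rule lborel_pair.Fubini_integrable)
    show "integrable lborel (\<lambda>r. LINT x|lborel. norm (?f (r, x)))"
      unfolding eq by (intro integrable_mult_left) (simp add: integrable_real_indicator)
    show "AE r in lborel. integrable lborel (\<lambda>x. ?f (r, x))"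
      using integrable_translate[OF h'] by (auto intro: integrable_mult_right)
  qed measurable
  \<comment> \<open>The fundamental theorem of calculus on each line parallel to e.\<close>
  have line: "(LINT r|lborel. ?f (r, x)) = h (x + e) - h x" for x
  proof -
    have "(LINT r|lborel. indicator {0..1} r *\<^sub>R h' (x + r *\<^sub>R e)) = h (x + 1 *\<^sub>R e) - h (x + 0 *\<^sub>R e)"
      by (rule integral_FTC_atLeastAtMost)
        (use der cont in \<open>auto simp: has_real_derivative_iff_has_vector_derivative[symmetric] intro: continuous_on_subset DERIV_subset\<close>)
    then show ?thesis by simp
  qed
  have "(LINT x|lborel. h' x) = (LINT r|lborel. indicator {0..1} (r::real) * (LINT x|lborel. h' x))"
    by simp
  also have "\<dots> = (LINT r|lborel. LINT x|lborel. ?f (r, x))"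
    using integral_translate[of h'] by simp
  also have "\<dots> = (LINT x|lborel. LINT r|lborel. ?f (r, x))"
    using lborel_pair.Fubini_integral[of "\<lambda>r x. ?f (r,x)"] fi by simp
  also have "\<dots> = (LINT x|lborel. h (x + e) - h x)" unfolding line ..
  also have "\<dots> = 0"
    using integrable_translate[OF h] h by (subst Bochner_Integration.integral_diff) (auto simp: integral_translate)
  finally show ?thesis .
qed

lemma integral_half_line_derivative:
  fixes F F' :: "real \<Rightarrow> real"
  assumes der: "\<And>y. 0 < y \<Longrightarrow> (F has_real_derivative F' y) (at y)"
    and cont: "continuous_on {0<..} F'"
    and int: "set_integrable lborel {0<..} F'"
    and lim: "(F \<longlongrightarrow> l) (at_right 0)"
    and supp: "\<And>y. r \<le> y \<Longrightarrow> F y = 0"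
  shows "(LINT y:{0<..}|lborel. F' y) = - l"
proof -
  have "(LBINT y=ereal 0..\<infinity>. F' y) = 0 - l"
  proof (rule interval_integral_FTC_integrable)
    show "isCont F' x" if "ereal 0 < ereal x" "ereal x < \<infinity>" for x
      using cont that by (auto simp: continuous_on_eq_continuous_at)
    show "set_integrable lborel (einterval (ereal 0) \<infinity>) F'"
      using int by (simp add: einterval_def greaterThan_def)
    show "((F \<circ> real_of_ereal) \<longlongrightarrow> l) (at_right (ereal 0))"
      using lim by (simp add: ereal_tendsto_simps)
    have "eventually (\<lambda>y. F y = 0) at_top" using supp eventually_at_top_linorder by blast
    then have "(F \<longlongrightarrow> 0) at_top" by (rule tendsto_eventually)
    then show "((F \<circ> real_of_ereal) \<longlongrightarrow> 0) (at_left \<infinity>)"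
      by (simp add: ereal_tendsto_simps)
  qed (use der in \<open>auto simp: has_real_derivative_iff_has_vector_derivative[symmetric]\<close>)
  moreover have "einterval (ereal 0) \<infinity> = {0<..}" by (auto simp: einterval_def)
  ultimately show ?thesis by (simp add: interval_lebesgue_integral_def zero_ereal_def)
qed

lemma integrable_tensor:
  fixes f :: "'a::euclidean_space \<Rightarrow> real" and g :: "'b::euclidean_space \<Rightarrow> real"
  assumes f: "integrable lborel f" and g: "integrable lborel g"
  shows "integrable lborel (\<lambda>z. f (fst z) * g (snd z))"
proof -
  note [measurable] = borel_measurable_integrable[OF f] borel_measurable_integrable[OF g]
  have "integrable (lborel \<Otimes>\<^sub>M lborel) (\<lambda>z. f (fst z) * g (snd z))"
  proof (rule lborel_pair.Fubini_integrable)
    show "integrable lborel (\<lambda>x. LINT y|lborel. norm (f (fst (x, y)) * g (snd (x, y))))"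
      using integrable_abs[OF f] by (simp add: abs_mult)
    show "AE x in lborel. integrable lborel (\<lambda>y. f (fst (x, y)) * g (snd (x, y)))"
      using g by simp
  qed measurable
  then show ?thesis by (simp add: lborel_prod)
qed

lemma open_half_space: "open half_space"
  unfolding half_space_def by (intro open_Collect_less continuous_intros)

lemma half_space_measurable [measurable]: "half_space \<in> sets borel"
  by (rule borel_open[OF open_half_space])

lemma integrable_powr_near_0:
  assumes "-1 < (a::real)" "0 \<le> r"
  shows "integrable lborel (\<lambda>y. indicator {0<..r} y * y powr a)"
proof -
  have "(\<lambda>y. y powr a) absolutely_integrable_on {0<..r}"
    using integrable_on_powr_from_0'[OF assms] by (intro nonnegative_absolutely_integrable_1) auto
  then have "integrable lebesgue (\<lambda>y. indicator {0<..r} y * y powr a)"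
    by (simp add: set_integrable_def)
  then show ?thesis by (subst (asm) integrable_completion) auto
qed

lemma integrable_powr_ball:
  assumes "-1 < (a::real)" "0 \<le> r"
  shows "integrable lborel (\<lambda>X::'n::finite pt. indicator (cball 0 r) (fst X) * (indicator {0<..r} (snd X) * snd X powr a))"
  by (rule integrable_tensor[OF _ integrable_powr_near_0[OF assms]])
     (rule integrable_real_indicator, simp, rule emeasure_lborel_cball_finite)

text \<open>
  The weight y^a is integrable near y = 0 because a > -1.
\<close>

lemma set_integrable_powr_half_space:
  fixes f :: "'n::finite pt \<Rightarrow> real"
  assumes a: "-1 < a" and cont: "continuous_on half_space f"
    and bound: "\<And>X. X \<in> half_space \<Longrightarrow> \<bar>f X\<bar> \<le> C"
    and supp: "\<And>X. X \<in> half_space \<Longrightarrow> r \<le> norm X \<Longrightarrow> f X = 0"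
  shows "set_integrable lborel half_space (\<lambda>X. snd X powr a * f X)"
proof (rule set_integrable_bound)
  let ?r = "max r 0"
  let ?g = "\<lambda>X::'n pt. C * (indicator (cball 0 ?r) (fst X) * (indicator {0<..?r} (snd X) * snd X powr a))"
  show "set_integrable lborel half_space ?g"
    unfolding set_integrable_def
    by (intro integrable_mult_indicator integrable_mult_right integrable_powr_ball) (use a in auto)
  have "continuous_on half_space (\<lambda>X. snd X powr a * f X)"
    using cont by (intro continuous_intros) (auto simp: half_space_def)
  then show "set_borel_measurable lborel half_space (\<lambda>X. snd X powr a * f X)"
    unfolding set_borel_measurable_def
    by (simp del: real_scaleR_def add: borel_measurable_continuous_on_indicator)
  have "\<bar>snd X powr a * f X\<bar> \<le> \<bar>?g X\<bar>" if X: "X \<in> half_space" for X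
  proof (cases "r \<le> norm X")
    case False
    then have "norm (fst X) \<le> ?r" "\<bar>snd X\<bar> \<le> ?r" using norm_fst_le[of "fst X" "snd X"] norm_snd_le[of "snd X" "fst X"] by auto
    moreover have "0 < snd X" using X by (simp add: half_space_def)
    ultimately show ?thesis using bound[OF X] by (auto simp: abs_mult mult.commute intro!: mult_left_mono)
  qed (use supp[OF X] in simp)
  then show "AE X in lborel. X \<in> half_space \<longrightarrow> norm (snd X powr a * f X) \<le> norm (?g X)" by simp
qed

lemma set_integrable_powr_space_time:
  fixes f :: "'n::finite pt \<times> real \<Rightarrow> real"
  assumes a: "-1 < a" and cont: "continuous_on (half_space \<times> {c..d}) f"
    and bound: "\<And>p. p \<in> half_space \<times> {c..d} \<Longrightarrow> \<bar>f p\<bar> \<le> C"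
    and supp: "\<And>X t. X \<in> half_space \<Longrightarrow> t \<in> {c..d} \<Longrightarrow> r \<le> norm X \<Longrightarrow> f (X, t) = 0"
  shows "set_integrable lborel (half_space \<times> {c..d}) (\<lambda>p. snd (fst p) powr a * f p)"
proof (rule set_integrable_bound)
  let ?r = "max r 0"
  let ?h = "\<lambda>X::'n pt. indicator (cball 0 ?r) (fst X) * (indicator {0<..?r} (snd X) * snd X powr a)"
  let ?g = "\<lambda>p. C * (?h (fst p) * indicator {c..d} (snd p))"
  have m [measurable]: "half_space \<times> {c..d} \<in> sets (borel :: ('n pt \<times> real) measure)"
    by (intro borel_Times) auto
  show "set_integrable lborel (half_space \<times> {c..d}) ?g"
    unfolding set_integrable_def
    by (intro integrable_mult_indicator integrable_mult_right integrable_tensor[OF integrable_powr_ball[OF a]]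
      integrable_real_indicator) (auto simp: emeasure_lborel_Icc_eq)
  have "continuous_on (half_space \<times> {c..d}) (\<lambda>p. snd (fst p) powr a * f p)"
    using cont by (intro continuous_intros) (auto simp: half_space_def)
  then show "set_borel_measurable lborel (half_space \<times> {c..d}) (\<lambda>p. snd (fst p) powr a * f p)"
    unfolding set_borel_measurable_def
    by (simp del: real_scaleR_def add: borel_measurable_continuous_on_indicator)
  have "\<bar>snd (fst p) powr a * f p\<bar> \<le> \<bar>?g p\<bar>" if p: "p \<in> half_space \<times> {c..d}" for p
  proof (cases "r \<le> norm (fst p)")
    case False
    then have "norm (fst (fst p)) \<le> ?r" "\<bar>snd (fst p)\<bar> \<le> ?r"
      using norm_fst_le[of "fst (fst p)" "snd (fst p)"] norm_snd_le[of "snd (fst p)" "fst (fst p)"] by auto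
    moreover have "0 < snd (fst p)" using p by (auto simp: half_space_def)
    ultimately show ?thesis using bound[OF p] p by (auto simp: abs_mult mult.commute intro!: mult_left_mono)
  qed (use supp[of "fst p" "snd p"] p in auto)
  then show "AE p in lborel. p \<in> half_space \<times> {c..d} \<longrightarrow> norm (snd (fst p) powr a * f p) \<le> norm (?g p)" by simp
qed

text \<open>
  On almost every vertical line the derivative is integrable, and there the fundamental theorem of calculus
  on (0,\<infinity>) applies.
\<close>

lemma integral_normal_derivative:
  fixes F F' :: "'n::finite pt \<Rightarrow> real"
  assumes der: "\<And>x y. 0 < y \<Longrightarrow> ((\<lambda>y. F (x, y)) has_real_derivative F' (x, y)) (at y)"
    and contF: "continuous_on half_space F" and cont: "continuous_on half_space F'"
    and int: "set_integrable lborel half_space F'"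
    and lim: "\<And>x. ((\<lambda>y. F (x, y)) \<longlongrightarrow> l x) (at_right 0)"
    and supp: "\<And>X. X \<in> half_space \<Longrightarrow> r \<le> norm X \<Longrightarrow> F X = 0"
  shows "(LINT X:half_space|lborel. F' X) = - (LINT x|lborel. l x)"
    and "l \<in> borel_measurable borel"
proof -
  let ?f = "\<lambda>X. indicator half_space X * F' X"
  have i: "integrable (lborel \<Otimes>\<^sub>M lborel) ?f"
    using int by (simp add: set_integrable_def lborel_prod)
  have ind: "indicator half_space (x::real^'n, y) = (indicator {0<..} y :: real)" for x y
    by (simp add: half_space_def indicator_def)
  have AE: "AE x in lborel. integrable lborel (\<lambda>y. ?f (x, y))"
    by (rule lborel_pair.AE_integrable_fst'[OF i])
  have eq: "(LINT y|lborel. ?f (x, y)) = - l x" if x: "integrable lborel (\<lambda>y. ?f (x, y))" for x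
  proof -
    have "(LINT y:{0<..}|lborel. F' (x, y)) = - l x"
    proof (rule integral_half_line_derivative[where r = "max r 1"])
      show "continuous_on {0<..} (\<lambda>y. F' (x, y))"
        by (rule continuous_on_compose2[OF cont]) (auto simp: half_space_def intro!: continuous_intros)
      show "set_integrable lborel {0<..} (\<lambda>y. F' (x, y))"
        using x by (simp add: set_integrable_def ind)
      show "F (x, y) = 0" if "max r 1 \<le> y" for y
        using supp[of "(x, y)"] norm_snd_le[of y x] that by (auto simp: half_space_def)
    qed (use der lim in auto)
    then show ?thesis by (simp add: set_lebesgue_integral_def ind)
  qed
  show lm: "l \<in> borel_measurable borel"
  proof (rule borel_measurable_LIMSEQ_real)
    show "(\<lambda>n. F (x, inverse (real (Suc n)))) \<longlonglongrightarrow> l x" for x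
    proof (rule filterlim_compose[OF lim])
      show "filterlim (\<lambda>n. inverse (real (Suc n))) (at_right 0) sequentially"
        by (rule tendsto_imp_filterlim_at_right[OF LIMSEQ_inverse_real_of_nat]) simp
    qed
    show "(\<lambda>x. F (x, inverse (real (Suc n)))) \<in> borel_measurable borel" for n
      by (intro borel_measurable_continuous_onI continuous_on_compose2[OF contF] continuous_intros)
         (auto simp: half_space_def)
  qed
  have "(LINT X:half_space|lborel. F' X) = (LINT x|lborel. LINT y|lborel. ?f (x, y))"
    using lborel_pair.integral_fst'[OF i] by (simp add: set_lebesgue_integral_def lborel_prod)
  also have "\<dots> = (LINT x|lborel. - l x)"
    by (rule integral_cong_AE) (use AE eq lm lborel_pair.integrable_fst'[OF i] in \<open>auto elim!: eventually_mono\<close>)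
  finally show "(LINT X:half_space|lborel. F' X) = - (LINT x|lborel. l x)" by simp
qed

lemma set_integrable_sum:
  fixes f :: "'i \<Rightarrow> 'a \<Rightarrow> real"
  assumes "\<And>i. i \<in> I \<Longrightarrow> set_integrable M A (f i)"
  shows "set_integrable M A (\<lambda>x. \<Sum>i\<in>I. f i x)"
    and "(LINT x:A|M. \<Sum>i\<in>I. f i x) = (\<Sum>i\<in>I. LINT x:A|M. f i x)"
  using assms by (auto simp: set_integrable_def set_lebesgue_integral_def sum_distrib_left)

lemma integral_tangential_derivative:
  fixes h h' :: "'n::finite pt \<Rightarrow> real"
  assumes e: "snd e = 0"
    and der: "\<And>X. X \<in> half_space \<Longrightarrow> ((\<lambda>r. h (X + r *\<^sub>R e)) has_real_derivative h' X) (at 0)"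
    and cont: "continuous_on half_space h'"
    and h: "set_integrable lborel half_space h"
    and h': "set_integrable lborel half_space h'"
  shows "(LINT X:half_space|lborel. h' X) = 0"
  unfolding set_lebesgue_integral_def
proof (rule integral_directional_derivative[where h = "\<lambda>X. indicator half_space X *\<^sub>R h X" and e = e])
  have half: "X + r *\<^sub>R e \<in> half_space \<longleftrightarrow> X \<in> half_space" for X r
    using e by (simp add: half_space_def)
  show "((\<lambda>r. indicator half_space (X + r *\<^sub>R e) *\<^sub>R h (X + r *\<^sub>R e)) has_real_derivative
      indicator half_space (X + r *\<^sub>R e) *\<^sub>R h' (X + r *\<^sub>R e)) (at r)" for X r
  proof (cases "X \<in> half_space")
    case True
    then have "((\<lambda>u. h (X + r *\<^sub>R e + u *\<^sub>R e)) has_real_derivative h' (X + r *\<^sub>R e)) (at 0)"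
      by (intro der) (simp add: half)
    then have "((\<lambda>u. h (X + (r + u) *\<^sub>R e)) has_real_derivative h' (X + r *\<^sub>R e)) (at 0)"
      by (simp add: algebra_simps)
    then show ?thesis using True by (simp add: half DERIV_shift[of _ _ 0 r, simplified] add.commute)
  qed (simp add: half)
  show "continuous_on UNIV (\<lambda>r. indicator half_space (X + r *\<^sub>R e) *\<^sub>R h' (X + r *\<^sub>R e))" for X
  proof (cases "X \<in> half_space")
    case True then show ?thesis
      by (auto simp: half intro!: continuous_on_compose2[OF cont] continuous_intros)
  qed (simp add: half)
qed (use h h' in \<open>auto simp: set_integrable_def\<close>)

text \<open>
  The flux is only required to have a limit at y = 0: the vector fields below carry the factor y^a and
  need not extend continuously to the boundary.
\<close>

theorem divergence_half_space:
  fixes F F' :: "'n::finite pt \<Rightarrow> _"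
  assumes der: "\<And>X. X \<in> half_space \<Longrightarrow> (F has_derivative F' X) (at X)"
    and cont: "\<And>b. b \<in> Basis \<Longrightarrow> continuous_on half_space (\<lambda>X. F' X b \<bullet> b)"
    and int': "\<And>b. b \<in> Basis \<Longrightarrow> set_integrable lborel half_space (\<lambda>X. F' X b \<bullet> b)"
    and int: "\<And>b. b \<in> Basis \<Longrightarrow> set_integrable lborel half_space (\<lambda>X. F X \<bullet> b)"
    and lim: "\<And>x. ((\<lambda>y. snd (F (x, y))) \<longlongrightarrow> l x) (at_right 0)"
    and supp: "\<And>X. X \<in> half_space \<Longrightarrow> r \<le> norm X \<Longrightarrow> F X = 0"
  shows "set_integrable lborel half_space (\<lambda>X. \<Sum>b\<in>Basis. F' X b \<bullet> b)"
    and "(LINT X:half_space|lborel. \<Sum>b\<in>Basis. F' X b \<bullet> b) = - (LINT x|lborel. l x)"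
    and "l \<in> borel_measurable borel"
proof -
  have line: "((\<lambda>u. F (X + u *\<^sub>R b) \<bullet> b) has_real_derivative F' X b \<bullet> b) (at 0)" if "X \<in> half_space" for X b
  proof -
    have "((\<lambda>u. F (X + u *\<^sub>R b)) has_derivative (\<lambda>u. F' X (u *\<^sub>R b))) (at 0)"
      using der[OF that] by (intro has_derivative_compose[of "\<lambda>u. X + u *\<^sub>R b" _ 0 UNIV F "F' X"]) (auto intro!: derivative_eq_intros)
    from has_derivative_inner_left[OF this, of b] show ?thesis
      using has_derivative_linear[OF der[OF that]]
      by (simp add: has_field_derivative_def linear_cmul mult_commute_abs)
  qed
  have y: "(0, 1) \<in> (Basis :: 'n pt set)" by (simp add: Basis_prod_def)
  have n1: "((\<lambda>y. snd (F (x, y))) has_real_derivative F' (x, y) (0, 1) \<bullet> (0, 1)) (at y)" if "0 < y" for x y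
  proof -
    have "((\<lambda>u. snd (F (x, y + u))) has_real_derivative F' (x, y) (0, 1) \<bullet> (0, 1)) (at 0)"
      using line[of "(x, y)" "(0,1)"] that by (simp add: half_space_def inner_prod_def)
    then show ?thesis using DERIV_shift[of "\<lambda>y. snd (F (x, y))" _ 0 y] by (simp add: add.commute)
  qed
  have n2: "continuous_on half_space (\<lambda>X. snd (F X))"
    using der by (intro continuous_intros) (meson continuous_at_imp_continuous_on has_derivative_continuous)
  have N: "(LINT X:half_space|lborel. F' X (0,1) \<bullet> (0,1)) = - (LINT x|lborel. l x) \<and> l \<in> borel_measurable borel"
    by (intro conjI integral_normal_derivative[where F = "\<lambda>X. snd (F X)" and r = r, OF n1 n2 cont[OF y] int'[OF y] lim])
       (use supp in auto)
  then show "l \<in> borel_measurable borel" by simp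
  have T: "(LINT X:half_space|lborel. F' X b \<bullet> b) = 0" if b: "b \<in> Basis - {(0, 1)}" for b
  proof (rule integral_tangential_derivative[where h = "\<lambda>X. F X \<bullet> b" and e = b])
    show "snd b = 0" using b by (auto simp: Basis_prod_def)
  qed (use b line cont int int' in auto)
  show "set_integrable lborel half_space (\<lambda>X. \<Sum>b\<in>Basis. F' X b \<bullet> b)"
    by (rule set_integrable_sum(1)[OF int'])
  have "(LINT X:half_space|lborel. \<Sum>b\<in>Basis. F' X b \<bullet> b) = (\<Sum>b\<in>Basis. LINT X:half_space|lborel. F' X b \<bullet> b)"
    by (rule set_integrable_sum(2)[OF int'])
  also have "\<dots> = (LINT X:half_space|lborel. F' X (0,1) \<bullet> (0,1))"
    using T by (subst sum.remove[OF _ y]) auto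
  finally show "(LINT X:half_space|lborel. \<Sum>b\<in>Basis. F' X b \<bullet> b) = - (LINT x|lborel. l x)" using N by simp
qed

lemma integral_time_derivative:
  fixes F F' :: "'a::euclidean_space \<times> real \<Rightarrow> real"
  assumes cd: "c \<le> d" and A: "A \<in> sets borel"
    and der: "\<And>x t. x \<in> A \<Longrightarrow> t \<in> {c..d} \<Longrightarrow> ((\<lambda>t. F (x, t)) has_real_derivative F' (x, t)) (at t)"
    and cont: "continuous_on (A \<times> {c..d}) F'"
    and int: "set_integrable lborel (A \<times> {c..d}) F'"
    and zero: "\<And>x. x \<in> A \<Longrightarrow> F (x, d) = 0"
  shows "(LINT p:A \<times> {c..d}|lborel. F' p) = - (LINT x:A|lborel. F (x, c))"
proof -
  let ?f = "\<lambda>p. indicator (A \<times> {c..d}) p * F' p"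
  have i: "integrable (lborel \<Otimes>\<^sub>M lborel) ?f"
    using int by (simp add: set_integrable_def lborel_prod)
  have eq: "(LINT t|lborel. ?f (x, t)) = indicator A x * - F (x, c)" for x
  proof (cases "x \<in> A")
    case True
    have "(LINT t|lborel. indicator {c..d} t *\<^sub>R F' (x, t)) = F (x, d) - F (x, c)"
    proof (rule integral_FTC_atLeastAtMost[OF cd])
      show "continuous_on {c..d} (\<lambda>t. F' (x, t))"
        by (rule continuous_on_compose2[OF cont]) (use True in \<open>auto intro!: continuous_intros\<close>)
    qed (use der True in \<open>auto simp: has_real_derivative_iff_has_vector_derivative[symmetric] intro: DERIV_subset\<close>)
    moreover have "indicator (A \<times> {c..d}) (x, t) = (indicator {c..d} t :: real)" for t
      using True by (auto simp: indicator_def)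
    ultimately show ?thesis using True zero by simp
  next
    case False
    then have "?f (x, t) = 0" for t by simp
    then show ?thesis using False by simp
  qed
  have "(LINT p:A \<times> {c..d}|lborel. F' p) = (LINT x|lborel. LINT t|lborel. ?f (x, t))"
    using lborel_pair.integral_fst'[OF i] by (simp add: set_lebesgue_integral_def lborel_prod)
  also have "\<dots> = - (LINT x:A|lborel. F (x, c))"
    unfolding eq by (simp add: set_lebesgue_integral_def)
  finally show ?thesis .
qed

lemma integral_slices:
  fixes f :: "'a::euclidean_space \<times> real \<Rightarrow> real"
  assumes int: "set_integrable lborel (A \<times> {c..d}) f"
  shows "(LINT p:A \<times> {c..d}|lborel. f p) = (LINT t:{c..d}|lborel. LINT x:A|lborel. f (x, t))"
    and "set_integrable lborel {c..d} (\<lambda>t. LINT x:A|lborel. f (x, t))"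
proof -
  let ?f = "\<lambda>x t. indicator (A \<times> {c..d}) (x, t) * f (x, t)"
  have i: "integrable (lborel \<Otimes>\<^sub>M lborel) (case_prod ?f)"
    using int unfolding set_integrable_def lborel_prod by (simp add: case_prod_unfold)
  have eq: "(LINT x|lborel. ?f x t) = indicator {c..d} t * (LINT x:A|lborel. f (x, t))" for t
  proof -
    have "(\<lambda>x. ?f x t) = (\<lambda>x. indicator {c..d} t * (indicator A x * f (x, t)))" by (auto simp: indicator_def)
    then show ?thesis by (simp add: set_lebesgue_integral_def)
  qed
  have "(LINT p:A \<times> {c..d}|lborel. f p) = (LINT t|lborel. LINT x|lborel. ?f x t)"
    using lborel_pair.integral_snd[OF i] unfolding set_lebesgue_integral_def lborel_prod
    by (simp add: case_prod_unfold)
  then show "(LINT p:A \<times> {c..d}|lborel. f p) = (LINT t:{c..d}|lborel. LINT x:A|lborel. f (x, t))"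
    unfolding eq by (simp add: set_lebesgue_integral_def)
  show "set_integrable lborel {c..d} (\<lambda>t. LINT x:A|lborel. f (x, t))"
    using lborel_pair.integrable_snd[OF i] unfolding eq by (simp add: set_integrable_def)
qed

section \<open>Weighted integrals over a time slab\<close>

text \<open>
  The parameter \<open>dim\<close> only fixes the space dimension.  A slab is closed in time and open in
  y, since the weighted integrands are controlled only for y > 0.
\<close>

locale slab =
  fixes dim :: "'n::finite itself" and a c d :: real
  assumes a: "-1 < a" and c: "0 < c" and cd: "c \<le> d"
begin

definition S :: "('n pt \<times> real) set" where "S = half_space \<times> {c..d}"

text \<open>
  The coefficients: they multiply functions that vanish for |X| \<ge> 4, so that no bound is needed there.
\<close>

definition tame :: "('n pt \<times> real \<Rightarrow> 'b::real_normed_vector) \<Rightarrow> bool" where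
  "tame f \<longleftrightarrow> continuous_on S f \<and> (\<exists>C. \<forall>p\<in>S. norm (fst p) \<le> 4 \<longrightarrow> norm (f p) \<le> C)"

text \<open>
  Integrands: these form an ideal over the tame functions, so that integrability of a long product
  follows from the support of a single factor.
\<close>

definition adm :: "('n pt \<times> real \<Rightarrow> 'b::real_normed_vector) \<Rightarrow> bool" where
  "adm f \<longleftrightarrow> tame f \<and> (\<forall>p\<in>S. 4 \<le> norm (fst p) \<longrightarrow> f p = 0)"

definition IX :: "('n pt \<times> real \<Rightarrow> real) \<Rightarrow> real \<Rightarrow> real" where
  "IX f t = (LINT X:half_space|lborel. snd X powr a * f (X, t) * G_kernel a X t)"

definition IS :: "('n pt \<times> real \<Rightarrow> real) \<Rightarrow> real" where
  "IS f = (LINT p:S|lborel. snd (fst p) powr a * f p * G_kernel a (fst p) (snd p))"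

lemma S_D: "p \<in> S \<Longrightarrow> 0 < snd (fst p) \<and> 0 < snd p \<and> snd p \<in> {c..d}"
  using c by (auto simp: S_def half_space_def)

lemma tameD: "tame f \<Longrightarrow> continuous_on S f" by (simp add: tame_def)

lemma tameI:
  assumes "continuous_on S f" "\<And>p. p \<in> S \<Longrightarrow> norm (fst p) \<le> 4 \<Longrightarrow> norm (f p) \<le> C"
  shows "tame f"
  using assms unfolding tame_def by blast

lemma tame_const [intro, simp]: "tame (\<lambda>p. k)"
  by (rule tameI[of _ "norm k"]) auto

lemma tame_fst [intro, simp]: "tame (\<lambda>p. fst p)"
  by (rule tameI[of _ 4]) (auto intro!: continuous_intros)

lemma tame_y [intro, simp]: "tame (\<lambda>p. snd (fst p))"
proof (rule tameI[of _ 4])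
  show "norm (snd (fst p)) \<le> 4" if "norm (fst p) \<le> 4" for p :: "'n pt \<times> real"
    using norm_snd_le[of "snd (fst p)" "fst (fst p)"] that by simp
qed (auto intro!: continuous_intros)

lemma tame_time:
  fixes h :: "real \<Rightarrow> 'b::real_normed_vector"
  assumes "continuous_on {c..d} h"
  shows "tame (\<lambda>p. h (snd p))"
proof -
  have "bounded (h ` {c..d})" using assms by (intro compact_imp_bounded compact_continuous_image) auto
  then obtain C where "\<forall>t\<in>{c..d}. norm (h t) \<le> C" by (auto simp: bounded_iff)
  then show ?thesis
    by (intro tameI[of _ C]) (auto simp: S_def intro!: continuous_on_compose2[OF assms] continuous_intros)
qed

lemma tame_add [intro]:
  assumes f: "tame f" and g: "tame g"
  shows "tame (\<lambda>p. f p + g p)"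
proof -
  obtain C1 C2 where C: "\<And>p. p \<in> S \<Longrightarrow> norm (fst p) \<le> 4 \<Longrightarrow> norm (f p) \<le> C1"
    "\<And>p. p \<in> S \<Longrightarrow> norm (fst p) \<le> 4 \<Longrightarrow> norm (g p) \<le> C2"
    using f g unfolding tame_def by metis
  show ?thesis
    using tameD[OF f] tameD[OF g] norm_triangle_mono[OF C]
    by (intro tameI[of _ "C1 + C2"] continuous_on_add) auto
qed

lemma tame_minus [intro]: "tame f \<Longrightarrow> tame (\<lambda>p. - f p)"
  unfolding tame_def by (auto intro!: continuous_on_minus)

lemma tame_diff [intro]: "tame f \<Longrightarrow> tame g \<Longrightarrow> tame (\<lambda>p. f p - g p)"
  using tame_add[of f "\<lambda>p. - g p"] tame_minus[of g] by simp

lemma tame_bilinear: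
  assumes B: "bounded_bilinear B" and f: "tame f" and g: "tame g"
  shows "tame (\<lambda>p. B (f p) (g p))"
proof -
  obtain K where K: "0 < K" "\<And>x y. norm (B x y) \<le> norm x * norm y * K"
    using bounded_bilinear.pos_bounded[OF B] by blast
  obtain C1 C2 where C: "\<And>p. p \<in> S \<Longrightarrow> norm (fst p) \<le> 4 \<Longrightarrow> norm (f p) \<le> C1"
    "\<And>p. p \<in> S \<Longrightarrow> norm (fst p) \<le> 4 \<Longrightarrow> norm (g p) \<le> C2"
    using f g unfolding tame_def by metis
  have "norm (B (f p) (g p)) \<le> (\<bar>C1\<bar> * \<bar>C2\<bar>) * K" if "p \<in> S" "norm (fst p) \<le> 4" for p
    using C[OF that] K(1)
    by (intro order_trans[OF K(2)] mult_right_mono mult_mono) auto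
  then show ?thesis
    using tameD[OF f] tameD[OF g] by (intro tameI) (auto intro: bounded_bilinear.continuous_on[OF B])
qed

lemmas tame_mult [intro] = tame_bilinear[OF bounded_bilinear_mult]
lemmas tame_scaleR [intro] = tame_bilinear[OF bounded_bilinear_scaleR]
lemmas tame_inner [intro] = tame_bilinear[OF bounded_bilinear_inner]

lemma tame_square [intro]: "tame f \<Longrightarrow> tame (\<lambda>p. (f p :: real)\<^sup>2)"
  unfolding power2_eq_square by (rule tame_mult)

lemma tame_sum [intro]: "(\<And>i. i \<in> I \<Longrightarrow> tame (f i)) \<Longrightarrow> tame (\<lambda>p. \<Sum>i\<in>I. f i p)"
  by (induction I rule: infinite_finite_induct) auto

lemma tame_Pair [intro]: "tame f \<Longrightarrow> tame g \<Longrightarrow> tame (\<lambda>p. (f p, g p))"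
proof -
  assume f: "tame f" and g: "tame g"
  obtain C1 C2 where C: "\<And>p. p \<in> S \<Longrightarrow> norm (fst p) \<le> 4 \<Longrightarrow> norm (f p) \<le> C1"
    "\<And>p. p \<in> S \<Longrightarrow> norm (fst p) \<le> 4 \<Longrightarrow> norm (g p) \<le> C2"
    using f g unfolding tame_def by metis
  have "norm (f p, g p) \<le> C1 + C2" if "p \<in> S" "norm (fst p) \<le> 4" for p
    using C[OF that] norm_Pair_le[of "f p" "g p"] by linarith
  then show ?thesis using tameD[OF f] tameD[OF g] by (intro tameI) (auto intro: continuous_intros)
qed

lemma tame_div_time:
  assumes f: "tame f" and h: "continuous_on {c..d} h" "\<And>t. t \<in> {c..d} \<Longrightarrow> h t \<noteq> (0::real)"
  shows "tame (\<lambda>p. f p / h (snd p))"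
proof -
  have "continuous_on {c..d} (\<lambda>t. 1 / h t)" using h by (auto intro!: continuous_intros)
  from tame_mult[OF f tame_time[OF this]] show ?thesis by simp
qed

lemma tame_div_2t [intro]: "tame f \<Longrightarrow> tame (\<lambda>p. (f p::real) / (2 * snd p))"
  by (rule tame_div_time[where h = "\<lambda>t. 2 * t"]) (use c in \<open>auto intro!: continuous_intros\<close>)

lemma tame_div_2t2 [intro]: "tame f \<Longrightarrow> tame (\<lambda>p. (f p::real) / (2 * (snd p)\<^sup>2))"
  by (rule tame_div_time[where h = "\<lambda>t. 2 * t\<^sup>2"]) (use c in \<open>auto intro!: continuous_intros\<close>)

lemma tame_cong:
  assumes "\<And>p. p \<in> S \<Longrightarrow> f p = g p"
  shows "tame f = tame g"
proof -
  have "continuous_on S f = continuous_on S g" by (rule continuous_on_cong) (use assms in auto)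
  moreover have "(\<forall>p\<in>S. norm (fst p) \<le> 4 \<longrightarrow> norm (f p) \<le> C) = (\<forall>p\<in>S. norm (fst p) \<le> 4 \<longrightarrow> norm (g p) \<le> C)" for C
    using assms by auto
  ultimately show ?thesis unfolding tame_def by simp
qed

lemma tame_linear:
  fixes f' :: "_ \<Rightarrow> 'e::euclidean_space \<Rightarrow> 'b::real_normed_vector"
  assumes lin: "\<And>p. p \<in> S \<Longrightarrow> linear (f' p)"
    and f': "\<And>b. b \<in> Basis \<Longrightarrow> tame (\<lambda>p. f' p b)" and h: "tame h"
  shows "tame (\<lambda>p. f' p (h p))"
proof -
  have 1: "tame (\<lambda>p. \<Sum>b\<in>Basis. (h p \<bullet> b) *\<^sub>R f' p b)"
    using f' h by (intro tame_sum tame_scaleR tame_inner tame_const) auto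
  have eq: "(\<Sum>b\<in>Basis. (h p \<bullet> b) *\<^sub>R f' p b) = f' p (h p)" if "p \<in> S" for p
    by (rule linear_expand_Basis[OF lin[OF that], symmetric])
  show ?thesis
    using 1 tame_cong[of "\<lambda>p. \<Sum>b\<in>Basis. (h p \<bullet> b) *\<^sub>R f' p b" "\<lambda>p. f' p (h p)"] eq by simp
qed

lemma adm_cong: "(\<And>p. p \<in> S \<Longrightarrow> f p = g p) \<Longrightarrow> adm f = adm g"
  using tame_cong[of f g] unfolding adm_def by auto

lemma admD: "adm f \<Longrightarrow> tame f" by (simp add: adm_def)

lemma adm_linear:
  fixes f' :: "_ \<Rightarrow> 'e::euclidean_space \<Rightarrow> 'b::real_normed_vector"
  assumes lin: "\<And>p. p \<in> S \<Longrightarrow> linear (f' p)"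
    and f': "\<And>b. b \<in> Basis \<Longrightarrow> adm (\<lambda>p. f' p b)" and h: "tame h"
  shows "adm (\<lambda>p. f' p (h p))"
  unfolding adm_def
proof (intro conjI ballI impI)
  show "tame (\<lambda>p. f' p (h p))" by (rule tame_linear[OF lin admD[OF f'] h])
  fix p assume p: "p \<in> S" "4 \<le> norm (fst p)"
  show "f' p (h p) = 0"
    unfolding linear_expand_Basis[OF lin[OF p(1)], of "h p"] using f' p by (auto simp: adm_def intro!: sum.neutral)
qed

lemma adm_add [intro]: "adm f \<Longrightarrow> adm g \<Longrightarrow> adm (\<lambda>p. f p + g p)"
  unfolding adm_def by auto
lemma adm_diff [intro]: "adm f \<Longrightarrow> adm g \<Longrightarrow> adm (\<lambda>p. f p - g p)"
  unfolding adm_def by auto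
lemma adm_mult1: "adm f \<Longrightarrow> tame g \<Longrightarrow> adm (\<lambda>p. f p * g p :: real)"
  unfolding adm_def by (auto intro: tame_mult)
lemma adm_mult2: "tame f \<Longrightarrow> adm g \<Longrightarrow> adm (\<lambda>p. f p * g p :: real)"
  unfolding adm_def by (auto intro: tame_mult)
lemma adm_square: "adm f \<Longrightarrow> adm (\<lambda>p. (f p :: real)\<^sup>2)"
  unfolding adm_def by (auto intro: tame_square)
lemma adm_sum: "(\<And>i. i \<in> I \<Longrightarrow> adm (f i)) \<Longrightarrow> adm (\<lambda>p. \<Sum>i\<in>I. f i p)"
  unfolding adm_def by (auto intro!: tame_sum)
lemma adm_zero [simp]: "adm (\<lambda>p. 0)" by (simp add: adm_def)

lemma G_kernel_bound:
  assumes "c \<le> t" shows "0 < G_kernel a X t" "G_kernel a (X::'n pt) t \<le> c powr (- ((real CARD('n) + 1 + a) / 2))"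
proof -
  have "t powr (- ((real CARD('n) + 1 + a) / 2)) \<le> c powr (- ((real CARD('n) + 1 + a) / 2))"
    using assms c a by (intro powr_mono2') auto
  moreover have "exp (- ((norm X)\<^sup>2 / (4 * t))) \<le> 1" using assms c by simp
  ultimately have "t powr (- ((real CARD('n) + 1 + a) / 2)) * exp (- ((norm X)\<^sup>2 / (4 * t)))
      \<le> c powr (- ((real CARD('n) + 1 + a) / 2)) * 1"
    by (intro mult_mono) auto
  then show "G_kernel a (X::'n pt) t \<le> c powr (- ((real CARD('n) + 1 + a) / 2))" by (simp add: G_kernel_def)
  show "0 < G_kernel a X t" using assms c by (simp add: G_kernel_def)
qed

lemma tame_G: "tame (\<lambda>p. G_kernel a (fst p) (snd p))"
proof (rule tameI)
  show "continuous_on S (\<lambda>p. G_kernel a (fst p) (snd p))"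
    unfolding G_kernel_def
    by (intro continuous_intros ballI) (use S_D in force)+
  show "norm (G_kernel a (fst p) (snd p)) \<le> c powr (- ((real CARD('n) + 1 + a) / 2))" if "p \<in> S" for p
    using G_kernel_bound[of "snd p" "fst p"] S_D[OF that] by simp
qed

lemma adm_bounded:
  assumes "adm f" obtains C where "\<And>p. p \<in> S \<Longrightarrow> norm (f p) \<le> C"
proof -
  obtain C where C: "\<And>p. p \<in> S \<Longrightarrow> norm (fst p) \<le> 4 \<Longrightarrow> norm (f p) \<le> C"
    using assms unfolding adm_def tame_def by auto
  have "norm (f p) \<le> max C 0" if "p \<in> S" for p
    using C[OF that] assms that unfolding adm_def by (cases "norm (fst p) \<le> 4") (auto simp: le_max_iff_disj)
  then show ?thesis using that by blast
qed

lemma adm_set_integrable: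
  fixes f :: "'n pt \<times> real \<Rightarrow> real"
  assumes "adm f"
  shows "set_integrable lborel S (\<lambda>p. snd (fst p) powr a * f p * G_kernel a (fst p) (snd p))"
proof -
  have f: "adm (\<lambda>p. f p * G_kernel a (fst p) (snd p))" using adm_mult1[OF assms tame_G] .
  obtain C where "\<And>p. p \<in> S \<Longrightarrow> norm (f p * G_kernel a (fst p) (snd p)) \<le> C" by (rule adm_bounded[OF f]) blast
  then have "set_integrable lborel S (\<lambda>p. snd (fst p) powr a * (f p * G_kernel a (fst p) (snd p)))"
    using f unfolding S_def adm_def tame_def
    by (intro set_integrable_powr_space_time[OF a, where r = 4 and C = C]) (auto simp: S_def)
  then show ?thesis by (simp add: mult.assoc)
qed

lemma adm_slice_integrable:
  fixes f :: "'n pt \<times> real \<Rightarrow> real"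
  assumes "adm f" "t \<in> {c..d}"
  shows "set_integrable lborel half_space (\<lambda>X. snd X powr a * f (X, t) * G_kernel a X t)"
proof -
  have f: "adm (\<lambda>p. f p * G_kernel a (fst p) (snd p))" using adm_mult1[OF assms(1) tame_G] .
  obtain C where C: "\<And>p. p \<in> S \<Longrightarrow> norm (f p * G_kernel a (fst p) (snd p)) \<le> C" by (rule adm_bounded[OF f]) blast
  have cf: "continuous_on S (\<lambda>p. f p * G_kernel a (fst p) (snd p))" using f unfolding adm_def tame_def by auto
  have "continuous_on half_space (\<lambda>X. f (X, t) * G_kernel a X t)"
    by (rule continuous_on_compose2[OF cf, where f = "\<lambda>X. (X, t)", simplified])
       (use assms(2) in \<open>auto simp: S_def intro!: continuous_intros\<close>)
  then have "set_integrable lborel half_space (\<lambda>X. snd X powr a * (f (X, t) * G_kernel a X t))"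
  proof (rule set_integrable_powr_half_space[OF a, where r = 4 and C = C])
    show "\<bar>f (X, t) * G_kernel a X t\<bar> \<le> C" if "X \<in> half_space" for X
      using C[of "(X, t)"] that assms(2) by (simp add: S_def)
    show "f (X, t) * G_kernel a X t = 0" if "X \<in> half_space" "4 \<le> norm X" for X
      using assms that by (auto simp: adm_def S_def)
  qed
  then show ?thesis by (simp add: mult.assoc)
qed

lemma IS_slices:
  assumes "adm f"
  shows "IS f = (LINT t:{c..d}|lborel. IX f t)" and "set_integrable lborel {c..d} (IX f)"
  using integral_slices[OF adm_set_integrable[OF assms, unfolded S_def]]
  unfolding IS_def IX_def S_def by auto

lemma IS_add: "adm f \<Longrightarrow> adm g \<Longrightarrow> IS (\<lambda>p. f p + g p) = IS f + IS g"
  using set_integral_add(2)[OF adm_set_integrable adm_set_integrable, of f g]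
  unfolding IS_def by (simp add: algebra_simps)

lemma IS_cmult: "IS (\<lambda>p. k * f p) = k * IS f"
proof -
  have "(\<lambda>p. snd (fst p) powr a * (k * f p) * G_kernel a (fst p) (snd p)) =
     (\<lambda>p. k * (snd (fst p) powr a * f p * G_kernel a (fst p) (snd p)))" by (auto simp: algebra_simps)
  then show ?thesis unfolding IS_def by simp
qed

lemma IS_cong: "(\<And>p. p \<in> S \<Longrightarrow> f p = g p) \<Longrightarrow> IS f = IS g"
  unfolding IS_def set_lebesgue_integral_def by (auto intro!: Bochner_Integration.integral_cong simp: indicator_def)

lemma IS_mono:
  assumes "adm f" "adm g" "\<And>p. p \<in> S \<Longrightarrow> f p \<le> g p"
  shows "IS f \<le> IS g"
  unfolding IS_def
proof (rule set_integral_mono[OF adm_set_integrable adm_set_integrable])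
  fix p :: "'n pt \<times> real" assume "p \<in> S"
  with assms(3)[OF this] S_D[OF this] G_kernel_bound(1)[of "snd p" "fst p"]
  show "snd (fst p) powr a * f p * G_kernel a (fst p) (snd p) \<le> snd (fst p) powr a * g p * G_kernel a (fst p) (snd p)"
    by (intro mult_right_mono mult_left_mono) auto
qed (use assms in auto)

lemma IX_add: "adm f \<Longrightarrow> adm g \<Longrightarrow> t \<in> {c..d} \<Longrightarrow> IX (\<lambda>p. f p + g p) t = IX f t + IX g t"
  using set_integral_add(2)[OF adm_slice_integrable adm_slice_integrable, of f t g t]
  unfolding IX_def by (simp add: algebra_simps)

lemma IX_cmult_time: "IX (\<lambda>p. k (snd p) * f p) t = k t * IX f t"
proof -
  have "(\<lambda>X. snd X powr a * (k t * f (X, t)) * G_kernel a X t) =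
     (\<lambda>X. k t * (snd X powr a * f (X, t) * G_kernel a X t))" by (auto simp: algebra_simps)
  then show ?thesis unfolding IX_def by simp
qed

lemma IX_mono:
  assumes "adm f" "adm g" "t \<in> {c..d}" "\<And>X. X \<in> half_space \<Longrightarrow> f (X, t) \<le> g (X, t)"
  shows "IX f t \<le> IX g t"
  unfolding IX_def
proof (rule set_integral_mono[OF adm_slice_integrable adm_slice_integrable])
  fix X :: "'n pt" assume "X \<in> half_space"
  with assms(4)[OF this] assms(3) G_kernel_bound(1)[of t X]
  show "snd X powr a * f (X, t) * G_kernel a X t \<le> snd X powr a * g (X, t) * G_kernel a X t"
    by (intro mult_right_mono mult_left_mono) auto
qed (use assms in auto)

lemma IX_cong: "(\<And>X. X \<in> half_space \<Longrightarrow> f (X, t) = g (X, t)) \<Longrightarrow> IX f t = IX g t"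
  unfolding IX_def set_lebesgue_integral_def by (auto intro!: Bochner_Integration.integral_cong simp: indicator_def)

lemma G_deriv_space:
  assumes "0 < t"
  shows "((\<lambda>X. G_kernel a X t) has_derivative (\<lambda>h. - G_kernel a X t * (X \<bullet> h) / (2 * t))) (at (X::'n pt))"
  unfolding G_kernel_def power2_norm_eq_inner
  by (rule derivative_eq_intros refl)+ (use assms in \<open>auto simp: field_simps inner_commute\<close>)

lemma G_deriv_time:
  fixes X :: "'n pt"
  assumes t: "0 < t"
  shows "((\<lambda>t. G_kernel a X t) has_real_derivative
     G_kernel a X t * ((norm X)\<^sup>2 / (4 * t\<^sup>2) - (real CARD('n) + 1 + a) / (2 * t))) (at t)"
proof -
  have gen: "((\<lambda>t. t powr (- q) * exp (- (N / (4 * t)))) has_real_derivative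
     t powr (- q) * exp (- (N / (4 * t))) * (N / (4 * t\<^sup>2) - q / t)) (at t)" for q N :: real
  proof -
    have 1: "((\<lambda>t. t powr (- q)) has_real_derivative t powr (- q) * (- q / t)) (at t)"
      using t by (auto intro!: derivative_eq_intros simp: powr_diff)
    have 2: "((\<lambda>t. exp (- (N / (4 * t)))) has_real_derivative exp (- (N / (4 * t))) * (N / (4 * t\<^sup>2))) (at t)"
      using t by (auto intro!: derivative_eq_intros simp: power2_eq_square field_simps)
    show ?thesis using DERIV_mult[OF 1 2] by (simp add: algebra_simps)
  qed
  show ?thesis
    using gen[of "(real CARD('n) + 1 + a) / 2" "(norm X)\<^sup>2"] by (simp add: G_kernel_def)
qed

end

context slab begin

lemma adm_inner1: "adm f \<Longrightarrow> tame g \<Longrightarrow> adm (\<lambda>p. f p \<bullet> g p)"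
  unfolding adm_def by (auto intro: tame_inner)
lemma adm_inner2: "tame f \<Longrightarrow> adm g \<Longrightarrow> adm (\<lambda>p. f p \<bullet> g p)"
  unfolding adm_def by (auto intro: tame_inner)
lemma adm_scaleR1: "adm f \<Longrightarrow> tame g \<Longrightarrow> adm (\<lambda>p. f p *\<^sub>R g p)"
  unfolding adm_def by (auto intro: tame_scaleR)
lemma adm_div_2t: "adm f \<Longrightarrow> adm (\<lambda>p. (f p::real) / (2 * snd p))"
  unfolding adm_def by (auto intro: tame_div_2t)

lemma adm_slice_continuous:
  fixes f :: "'n pt \<times> real \<Rightarrow> real"
  assumes "adm f" "t \<in> {c..d}"
  shows "continuous_on half_space (\<lambda>X. snd X powr a * f (X, t) * G_kernel a X t)"
proof -
  have f: "continuous_on S (\<lambda>p. f p * G_kernel a (fst p) (snd p))"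
    using tame_mult[OF admD[OF assms(1)] tame_G] by (rule tameD)
  have "continuous_on half_space (\<lambda>X. f (X, t) * G_kernel a X t)"
    by (rule continuous_on_compose2[OF f, where f = "\<lambda>X. (X, t)", simplified])
       (use assms(2) in \<open>auto simp: S_def intro!: continuous_intros\<close>)
  moreover have "continuous_on half_space (\<lambda>X. snd X powr a)"
    by (intro continuous_intros) (auto simp: half_space_def)
  ultimately have "continuous_on half_space (\<lambda>X. snd X powr a * (f (X, t) * G_kernel a X t))"
    by (rule continuous_on_mult[rotated])
  then show ?thesis by (simp add: mult.assoc)
qed

lemma adm_weighted_continuous:
  fixes f :: "'n pt \<times> real \<Rightarrow> real"
  assumes "adm f"
  shows "continuous_on S (\<lambda>p. snd (fst p) powr a * f p * G_kernel a (fst p) (snd p))"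
proof -
  have "continuous_on S (\<lambda>p. snd (fst p) powr a)"
  proof (intro continuous_on_powr continuous_on_const ballI)
    show "snd (fst p) \<noteq> 0" if "p \<in> S" for p using S_D[OF that] by simp
  qed (intro continuous_intros)
  from continuous_on_mult[OF continuous_on_mult[OF this tameD[OF admD[OF assms]]] tameD[OF tame_G]]
  show ?thesis .
qed

lemma Basis_snd_inner: "b \<in> Basis \<Longrightarrow> snd b * (v \<bullet> b) = snd b * snd v" for b v :: "'n pt"
  by (auto simp: Basis_prod_def inner_prod_def)

text \<open>
  The divergence theorem for y^a G F, written relative to the measure y^a G dX.  Every spatial integration by
  parts below is an instance of it: F = f X/(2t) for the drift, F = v \<nabla>w for Green's formula, and
  F = (0, w^2), F = (0, y w^2) for the trace and Hardy inequalities.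
\<close>

lemma weighted_divergence:
  fixes F :: "'n pt \<times> real \<Rightarrow> 'n pt"
  assumes t: "t \<in> {c..d}"
    and der: "\<And>p. p \<in> S \<Longrightarrow> (F has_derivative F' p) (at p)"
    and F: "adm F" and F': "\<And>b. b \<in> Basis \<Longrightarrow> adm (\<lambda>p. F' p (b, 0))"
    and Fy: "adm (\<lambda>p. a * snd (F p) / snd (fst p))"
    and lim: "\<And>x. ((\<lambda>y. y powr a * snd (F ((x, y), t))) \<longlongrightarrow> l x) (at_right 0)"
  shows "IX (\<lambda>p. (\<Sum>b\<in>Basis. F' p (b, 0) \<bullet> b) + a * snd (F p) / snd (fst p) - (fst p \<bullet> F p) / (2 * snd p)) t
      = - (LINT x|lborel. l x * G_kernel a (x, 0) t)"
proof -
  have t0: "0 < t" using t c by auto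
  define K where "K X = snd X powr a * G_kernel a X t" for X :: "'n pt"
  define K' where "K' X h = K X * (a * snd h / snd X - (X \<bullet> h) / (2 * t))" for X h :: "'n pt"
  define f where "f b p = F' p (b, 0) \<bullet> b + snd b * (a * snd (F p) / snd (fst p)) - ((fst p \<bullet> b) * (F p \<bullet> b)) / (2 * snd p)"
    for b :: "'n pt" and p
  have K: "(K has_derivative K' X) (at X)" if "X \<in> half_space" for X
  proof -
    have y: "0 < snd X" using that by (simp add: half_space_def)
    have 1: "((\<lambda>X. snd X powr a) has_derivative (\<lambda>h. a * (snd X powr a / snd X) * snd h)) (at X)"
      using y by (auto intro!: derivative_eq_intros simp: powr_diff field_simps)
    show ?thesis
      unfolding K_def[abs_def] K'_def
      by (rule has_derivative_eq_rhs[OF has_derivative_mult[OF 1 G_deriv_space[OF t0]]])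
         (use y t0 in \<open>auto simp: field_simps\<close>)
  qed
  have f: "adm (f b)" if b: "b \<in> Basis" for b
    unfolding f_def[abs_def]
    by (intro adm_add adm_diff adm_inner1[OF F'[OF b]] adm_mult2[OF _ Fy] adm_div_2t adm_mult2[OF _ adm_inner1[OF F]]
      tame_const tame_inner tame_fst)
  have FX: "((\<lambda>X. K X *\<^sub>R F (X, t)) has_derivative (\<lambda>h. K X *\<^sub>R F' (X, t) (h, 0) + K' X h *\<^sub>R F (X, t))) (at X)"
    if X: "X \<in> half_space" for X
  proof -
    have "(X, t) \<in> S" using X t by (simp add: S_def)
    then have "((\<lambda>X. F (X, t)) has_derivative (\<lambda>h. F' (X, t) (h, 0))) (at X)"
      by (intro has_derivative_compose[OF _ der, of "\<lambda>X. (X, t)", simplified])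
         (auto intro!: derivative_eq_intros)
    from has_derivative_scaleR[OF K[OF X] this] show ?thesis by simp
  qed
  have eq: "(K X *\<^sub>R F' (X, t) (b, 0) + K' X b *\<^sub>R F (X, t)) \<bullet> b = snd X powr a * f b (X, t) * G_kernel a X t"
    if b: "b \<in> Basis" for X b
  proof -
    have "(K X *\<^sub>R F' (X, t) (b, 0) + K' X b *\<^sub>R F (X, t)) \<bullet> b
       = K X * (F' (X, t) (b, 0) \<bullet> b + (a / snd X) * (snd b * (F (X, t) \<bullet> b)) - (X \<bullet> b) * (F (X, t) \<bullet> b) / (2 * t))"
      by (simp add: K'_def algebra_simps inner_add_left diff_divide_distrib)
    also have "\<dots> = K X * f b (X, t)"
      unfolding Basis_snd_inner[OF b] by (simp add: f_def)
    finally show ?thesis by (simp add: K_def mult_ac)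
  qed
  have sumf: "(\<Sum>b\<in>Basis. f b p) = (\<Sum>b\<in>Basis. F' p (b, 0) \<bullet> b) + a * snd (F p) / snd (fst p) - (fst p \<bullet> F p) / (2 * snd p)" for p
  proof -
    have y: "(0, 1) \<in> (Basis :: 'n pt set)" by (simp add: Basis_prod_def)
    have "snd b = 0" if "b \<in> Basis - {(0, 1)}" for b :: "'n pt" using that by (auto simp: Basis_prod_def)
    then have "(\<Sum>b\<in>(Basis :: 'n pt set). snd b) = 1" by (subst sum.remove[OF finite_Basis y]) simp
    then show ?thesis
      unfolding f_def sum_subtractf sum.distrib euclidean_inner[of "fst p" "F p"] sum_divide_distrib[symmetric] sum_distrib_right[symmetric]
      by simp
  qed
  have D: "(LINT X:half_space|lborel. \<Sum>b\<in>Basis. (K X *\<^sub>R F' (X, t) (b, 0) + K' X b *\<^sub>R F (X, t)) \<bullet> b)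
     = - (LINT x|lborel. l x * G_kernel a (x, 0) t)"
  proof (rule divergence_half_space(2)[where F = "\<lambda>X. K X *\<^sub>R F (X, t)" and r = 4, OF FX])
    show "continuous_on half_space (\<lambda>X. (K X *\<^sub>R F' (X, t) (b, 0) + K' X b *\<^sub>R F (X, t)) \<bullet> b)" if "b \<in> Basis" for b
      unfolding eq[OF that] by (rule adm_slice_continuous[OF f[OF that] t])
    show "set_integrable lborel half_space (\<lambda>X. (K X *\<^sub>R F' (X, t) (b, 0) + K' X b *\<^sub>R F (X, t)) \<bullet> b)" if "b \<in> Basis" for b
      unfolding eq[OF that] by (rule adm_slice_integrable[OF f[OF that] t])
    show "set_integrable lborel half_space (\<lambda>X. (K X *\<^sub>R F (X, t)) \<bullet> b)" if "b \<in> Basis" for b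
      using adm_slice_integrable[OF adm_inner1[OF F tame_const[of b]] t] by (simp add: K_def mult_ac)
    show "((\<lambda>y. snd (K (x, y) *\<^sub>R F ((x, y), t))) \<longlongrightarrow> l x * G_kernel a (x, 0) t) (at_right 0)" for x
    proof -
      have "((\<lambda>y. G_kernel a (x, y) t) \<longlongrightarrow> G_kernel a (x, 0) t) (at_right 0)"
        unfolding G_kernel_def by (intro tendsto_intros) (use t0 in auto)
      from tendsto_mult[OF lim[of x] this] show ?thesis by (simp add: K_def mult_ac)
    qed
    show "K X *\<^sub>R F (X, t) = 0" if "X \<in> half_space" "4 \<le> norm X" for X
      using F t that by (auto simp: adm_def S_def)
  qed
  have "IX (\<lambda>p. \<Sum>b\<in>Basis. f b p) t = (LINT X:half_space|lborel. \<Sum>b\<in>Basis. snd X powr a * f b (X, t) * G_kernel a X t)"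
    unfolding IX_def by (simp add: sum_distrib_left sum_distrib_right)
  also have "\<dots> = (LINT X:half_space|lborel. \<Sum>b\<in>Basis. (K X *\<^sub>R F' (X, t) (b, 0) + K' X b *\<^sub>R F (X, t)) \<bullet> b)"
    using eq by simp
  finally show ?thesis unfolding sumf D .
qed

text \<open>
  The time derivative of y^a G f and the divergence of y^a G f X/(2t) add up to y^a G (Z f): the
  derivatives that fall on y^a G cancel, since y^a G dX is invariant under the parabolic dilations.  The
  divergence has no flux at y = 0, where the normal component of y^a X is y^(1+a).
\<close>

lemma integral_Z:
  fixes f :: "'n pt \<times> real \<Rightarrow> real"
  assumes der: "\<And>p. p \<in> S \<Longrightarrow> (f has_derivative f' p) (at p)"
    and f: "adm f" and f': "\<And>b. b \<in> Basis \<Longrightarrow> adm (\<lambda>p. f' p b)"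
    and zero: "\<And>X. X \<in> half_space \<Longrightarrow> f (X, d) = 0"
  shows "IS (\<lambda>p. f' p ((1 / (2 * snd p)) *\<^sub>R fst p, 1)) = - IX f c" (is ?A)
    and "adm (\<lambda>p. f' p ((1 / (2 * snd p)) *\<^sub>R fst p, 1))" (is ?B)
proof -
  \<comment> \<open>m is \<partial>_t G / G; it enters the time part and the divergence part with opposite signs.\<close>
  define m where "m p = (norm (fst p))\<^sup>2 / (4 * (snd p)\<^sup>2) - (real CARD('n) + 1 + a) / (2 * snd p)" for p :: "'n pt \<times> real"
  have lin: "linear (f' p)" if "p \<in> S" for p using has_derivative_linear[OF der[OF that]] .
  have cinv: "tame (\<lambda>p. 1 / (2 * snd p))"
    by (rule tame_div_2t) simp
  have m: "tame m"
  proof -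
    have "tame (\<lambda>p. (1/2) * ((fst p \<bullet> fst p) / (2 * (snd p)\<^sup>2)) - (real CARD('n) + 1 + a) / (2 * snd p))"
      by (intro tame_diff tame_mult tame_div_2t2 tame_div_2t tame_inner tame_const tame_fst)
    then show ?thesis by (simp add: m_def[abs_def] power2_norm_eq_inner)
  qed
  have t01: "(0, 1) \<in> (Basis :: ('n pt \<times> real) set)" by (simp add: Basis_prod_def)
  have bX: "(b, 0) \<in> (Basis :: ('n pt \<times> real) set)" if "b \<in> Basis" for b
    using that unfolding Basis_prod_def[where 'a = "'n pt" and 'b = real] by (rule UnI1[OF imageI])
  have lincomb: "adm (\<lambda>p. f' p (h p))" if "tame h" for h
    by (rule adm_linear[OF lin f' that])
  show ?B by (intro lincomb tame_Pair tame_scaleR tame_fst tame_const cinv)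
  define F where "F p = (f p / (2 * snd p)) *\<^sub>R fst p" for p
  define F' where "F' p h = (f p / (2 * snd p)) *\<^sub>R fst h + (f' p h / (2 * snd p) - f p * snd h / (2 * (snd p)\<^sup>2)) *\<^sub>R fst p" for p h
  have A1: "adm (\<lambda>p. f' p (0,1) + f p * m p)"
    by (intro adm_add f'[OF t01] adm_mult1[OF f m])
  have A2: "adm (\<lambda>p. f' p ((1 / (2 * snd p)) *\<^sub>R fst p, 0) - f p * m p)"
    by (intro adm_diff adm_mult1[OF f m] lincomb tame_Pair tame_scaleR cinv tame_fst tame_const)
  have split: "f' p ((1 / (2 * snd p)) *\<^sub>R fst p, 1) = (f' p (0,1) + f p * m p) + (f' p ((1 / (2 * snd p)) *\<^sub>R fst p, 0) - f p * m p)"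
    if "p \<in> S" for p
    using linear_add[OF lin[OF that], of "(0,1)" "((1 / (2 * snd p)) *\<^sub>R fst p, 0)"] by simp
  have I1: "IS (\<lambda>p. f' p (0,1) + f p * m p) = - IX f c"
  proof -
    define E where "E p = snd (fst p) powr a * f p * G_kernel a (fst p) (snd p)" for p
    define E' where "E' p = snd (fst p) powr a * (f' p (0,1) + f p * m p) * G_kernel a (fst p) (snd p)" for p
    have E: "((\<lambda>t. E (X, t)) has_real_derivative E' (X, t)) (at t)"
      if X: "X \<in> half_space" and t: "t \<in> {c..d}" for X t
    proof -
      have p: "(X, t) \<in> S" using X t by (simp add: S_def)
      have "((\<lambda>t. f (X, t)) has_derivative (\<lambda>h. f' (X, t) (0, h))) (at t)"
        using has_derivative_compose[OF has_derivative_Pair[OF has_derivative_const has_derivative_ident],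
          of f "f' (X, t)" X t UNIV] der[OF p] by simp
      moreover have "(\<lambda>h. f' (X, t) (0, h)) = (*) (f' (X, t) (0, 1))"
      proof
        show "f' (X, t) (0, h) = f' (X, t) (0, 1) * h" for h
          using linear_scale[OF lin[OF p], of h "(0,1)"] by simp
      qed
      ultimately have 1: "((\<lambda>t. f (X, t)) has_real_derivative f' (X, t) (0, 1)) (at t)"
        by (simp add: has_field_derivative_def)
      have 2: "((\<lambda>t. G_kernel a X t) has_real_derivative G_kernel a X t * m (X, t)) (at t)"
        unfolding m_def using G_deriv_time[of t X] t c by simp
      show ?thesis
        using DERIV_cmult[OF DERIV_mult[OF 1 2], of "snd X powr a"] by (simp add: E_def E'_def algebra_simps)
    qed
    have "(LINT p:half_space \<times> {c..d}|lborel. E' p) = - (LINT X:half_space|lborel. E (X, c))"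
    proof (rule integral_time_derivative[OF cd half_space_measurable E])
      show "continuous_on (half_space \<times> {c..d}) E'"
        using adm_weighted_continuous[OF A1] by (simp add: S_def E'_def[abs_def])
      show "set_integrable lborel (half_space \<times> {c..d}) E'"
        using adm_set_integrable[OF A1] by (simp add: S_def E'_def[abs_def])
      show "E (X, d) = 0" if "X \<in> half_space" for X using zero that by (simp add: E_def)
    qed
    then show ?thesis by (simp add: IS_def IX_def S_def E_def E'_def)
  qed
  have I2: "IX (\<lambda>p. f' p ((1 / (2 * snd p)) *\<^sub>R fst p, 0) - f p * m p) t = 0" if t: "t \<in> {c..d}" for t
  proof -
    have "IX (\<lambda>p. (\<Sum>b\<in>Basis. F' p (b, 0) \<bullet> b) + a * snd (F p) / snd (fst p) - (fst p \<bullet> F p) / (2 * snd p)) t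
       = - (LINT x|lborel. 0 * G_kernel a (x::real^'n, 0) t)"
    proof (rule weighted_divergence[OF t])
      show "(F has_derivative F' p) (at p)" if p: "p \<in> S" for p
      proof -
        have t0: "2 * snd p \<noteq> 0" using S_D[OF p] by simp
        have "((\<lambda>p. 2 * snd p) has_derivative (\<lambda>h. 2 * snd h)) (at p)"
          by (intro has_derivative_mult_right has_derivative_snd has_derivative_ident)
        from has_derivative_divide'[OF der[OF p] this t0]
        have "((\<lambda>p. f p / (2 * snd p)) has_derivative (\<lambda>h. f' p h / (2 * snd p) - f p * snd h / (2 * (snd p)\<^sup>2))) (at p)"
          by (rule has_derivative_eq_rhs) (use t0 in \<open>simp add: fun_eq_iff field_simps power2_eq_square\<close>)
        from has_derivative_scaleR[OF this has_derivative_fst[OF has_derivative_ident]]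
        show ?thesis by (simp add: F_def[abs_def] F'_def[abs_def])
      qed
      show "adm F" unfolding F_def[abs_def] by (intro adm_scaleR1 adm_div_2t f tame_fst)
      show "adm (\<lambda>p. F' p (b, 0))" if "b \<in> Basis" for b
      proof -
        have "adm (\<lambda>p. (f p / (2 * snd p)) *\<^sub>R b + (f' p (b, 0) / (2 * snd p)) *\<^sub>R fst p)"
          by (intro adm_add adm_scaleR1 adm_div_2t f f' bX that tame_fst tame_const)
        then show ?thesis by (simp add: F'_def)
      qed
      show "adm (\<lambda>p. a * snd (F p) / snd (fst p))"
      proof -
        have "adm (\<lambda>p. a * (f p / (2 * snd p)))" by (intro adm_mult2 tame_const adm_div_2t f)
        then show ?thesis
          by (subst adm_cong[where g = "\<lambda>p. a * (f p / (2 * snd p))"]) (auto simp: F_def dest: S_D)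
      qed
      show "((\<lambda>y. y powr a * snd (F ((x, y), t))) \<longlongrightarrow> 0) (at_right 0)" for x
      proof -
        obtain C where C: "\<And>p. p \<in> S \<Longrightarrow> norm (f p / (2 * snd p)) \<le> C" by (rule adm_bounded[OF adm_div_2t[OF f]]) blast
        have "((\<lambda>y. C * y powr (1 + a)) \<longlongrightarrow> C * 0 powr (1 + a)) (at_right 0)"
          by (rule tendsto_mult[OF tendsto_const tendsto_powr'[OF tendsto_ident_at tendsto_const]])
             (use a in \<open>auto simp: eventually_at_filter\<close>)
        then have l: "((\<lambda>y. C * y powr (1 + a)) \<longlongrightarrow> 0) (at_right 0)" using a by simp
        show ?thesis
        proof (rule Lim_null_comparison[OF _ l])
          show "\<forall>\<^sub>F y in at_right 0. norm (y powr a * snd (F ((x, y), t))) \<le> C * y powr (1 + a)"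
            unfolding eventually_at_filter
          proof (intro always_eventually allI impI)
            fix y :: real assume "y \<in> {0<..}"
            then have y: "0 < y" and "((x, y), t) \<in> S" using t by (auto simp: S_def half_space_def)
            from C[OF this(2)] have "\<bar>f ((x, y), t) / (2 * t)\<bar> \<le> C" by simp
            then have "\<bar>f ((x, y), t) / (2 * t)\<bar> * (y * y powr a) \<le> C * (y * y powr a)"
              using y by (intro mult_right_mono) auto
            moreover have "y powr (1 + a) = y * y powr a" using y by (simp add: powr_add)
            ultimately show "norm (y powr a * snd (F ((x, y), t))) \<le> C * y powr (1 + a)"
              using y by (simp add: F_def abs_mult mult_ac)
          qed
        qed
      qed
    qed
    then have Z: "IX (\<lambda>p. (\<Sum>b\<in>Basis. F' p (b, 0) \<bullet> b) + a * snd (F p) / snd (fst p) - (fst p \<bullet> F p) / (2 * snd p)) t = 0"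
      by simp
    show ?thesis
    proof (rule trans[OF IX_cong Z])
      fix X :: "'n pt" assume X: "X \<in> half_space"
      let ?p = "(X, t)"
      have p: "?p \<in> S" and t0: "0 < t" and y: "0 < snd X" using X t c by (auto simp: S_def half_space_def)
      have "f' ?p (X, 0) = (\<Sum>b\<in>Basis. (X \<bullet> b) * f' ?p (b, 0))"
        by (rule linear_expand_fst[OF lin[OF p]])
      moreover have "f' ?p ((1 / (2 * t)) *\<^sub>R X, 0) = f' ?p (X, 0) / (2 * t)"
        using linear_scale[OF lin[OF p], of "1 / (2 * t)" "(X, 0)"] by simp
      moreover have "(\<Sum>b\<in>Basis. F' ?p (b, 0) \<bullet> b) = (real CARD('n) + 1) * (f ?p / (2 * t)) + (\<Sum>b\<in>Basis. (X \<bullet> b) * f' ?p (b, 0)) / (2 * t)"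
      proof -
        have "(\<Sum>b\<in>Basis. F' ?p (b, 0) \<bullet> b) = (\<Sum>b\<in>(Basis::'n pt set). f ?p / (2 * t) + (X \<bullet> b) * f' ?p (b, 0) / (2 * t))"
          by (rule sum.cong) (auto simp: F'_def inner_add_left algebra_simps)
        then show ?thesis by (simp add: sum.distrib sum_divide_distrib)
      qed
      moreover have "a * snd (F ?p) / snd X = a * (f ?p / (2 * t))" using y by (simp add: F_def)
      moreover have "(X \<bullet> F ?p) / (2 * t) = f ?p * (norm X)\<^sup>2 / (4 * t\<^sup>2)"
        using t0 by (simp add: F_def dot_square_norm power2_eq_square field_simps)
      ultimately show "f' ?p ((1 / (2 * snd ?p)) *\<^sub>R fst ?p, 0) - f ?p * m ?p =
        (\<Sum>b\<in>Basis. F' ?p (b, 0) \<bullet> b) + a * snd (F ?p) / snd (fst ?p) - (fst ?p \<bullet> F ?p) / (2 * snd ?p)"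
        by (simp add: m_def algebra_simps add_divide_distrib diff_divide_distrib)
    qed
  qed
  have "IS (\<lambda>p. f' p ((1 / (2 * snd p)) *\<^sub>R fst p, 1)) = IS (\<lambda>p. (f' p (0,1) + f p * m p) + (f' p ((1 / (2 * snd p)) *\<^sub>R fst p, 0) - f p * m p))"
    by (rule IS_cong[OF split])
  also have "\<dots> = - IX f c + IS (\<lambda>p. f' p ((1 / (2 * snd p)) *\<^sub>R fst p, 0) - f p * m p)"
    by (subst IS_add[OF A1 A2]) (simp add: I1)
  also have "IS (\<lambda>p. f' p ((1 / (2 * snd p)) *\<^sub>R fst p, 0) - f p * m p) = (LINT t:{c..d}|lborel. 0)"
    unfolding IS_slices(1)[OF A2] by (rule set_lebesgue_integral_cong) (use I2 in auto)
  finally show ?A by simp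
qed

end

section \<open>The weight\<close>

text \<open>
  The logarithm is absorbed by a small negative power, ln (1/u) \<le> 8 u^(-1/8); a power u^(1/4) remains,
  which makes \<theta>(u)/u integrable at 0.
\<close>

lemma theta_bounds:
  assumes s: "1/2 \<le> s" "s < 1" and u: "0 < u" "u \<le> 1"
  shows "0 \<le> theta s u" and "theta s u \<le> 64 * u powr (1/4)"
proof -
  define L where "L = ln (1 / u)"
  have L0: "0 \<le> L" using u by (simp add: L_def)
  show "0 \<le> theta s u" by (simp add: theta_def)
  have "L \<le> (1/u) powr (1/8) / (1/8)" unfolding L_def using u by (intro ln_powr_bound) auto
  then have "L powr (1 + s) \<le> (8 * (1/u) powr (1/8)) powr (1 + s)" using L0 s by (intro powr_mono2) auto
  also have "\<dots> = 8 powr (1 + s) * (1/u) powr ((1 + s) / 8)" by (simp add: powr_mult powr_powr)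
  also have "\<dots> \<le> 8 powr 2 * (1/u) powr (1/4)" using u s by (intro mult_mono powr_mono) auto
  finally have L: "L powr (1 + s) \<le> 64 * (1/u) powr (1/4)" by simp
  have "theta s u \<le> u powr (1/2) * (64 * (1/u) powr (1/4))"
    unfolding theta_def L_def[symmetric]
    by (intro mult_mono powr_mono' L) (use u s in auto)
  also have "\<dots> = 64 * u powr (1/4)"
    using u by (simp add: powr_divide powr_diff[symmetric] field_simps flip: powr_add)
  finally show "theta s u \<le> 64 * u powr (1/4)" .
qed

text \<open>
  For u \<le> 1/e the logarithm is at least 1.
\<close>

lemma theta_lower:
  assumes s: "0 < s" "s \<le> 1" and u: "0 < u" "u \<le> 1 / exp 1"
  shows "u powr s \<le> theta s u" and "u \<le> theta s u"
proof -
  have "exp 1 \<le> 1 / u" using u by (simp add: field_simps)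
  then have "1 \<le> ln (1 / u)" using u by (subst ln_ge_iff) auto
  then have "1 \<le> ln (1 / u) powr (1 + s)" using s by (intro ge_one_powr_ge_zero) auto
  then show 1: "u powr s \<le> theta s u" using mult_left_mono[of 1 "ln (1 / u) powr (1 + s)" "u powr s"] by (simp add: theta_def)
  have "1 / exp 1 \<le> (1::real)" by simp
  then have "u \<le> 1" using u by linarith
  then have "u powr 1 \<le> u powr s" using u s by (intro powr_mono') auto
  then show "u \<le> theta s u" using 1 u by simp
qed

lemma theta_continuous:
  "0 < lam \<Longrightarrow> continuous_on {0<..1/lam} (\<lambda>t. theta s (lam * t))" if "0 < s"
  unfolding theta_def
  by (intro continuous_intros continuous_on_powr') (use that in \<open>auto simp: field_simps\<close>)

lemma limit_le_of_nonneg_derivative: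
  fixes F :: "real \<Rightarrow> real"
  assumes der: "\<And>x. 0 < x \<Longrightarrow> x < b \<Longrightarrow> (F has_real_derivative F' x) (at x)"
    and nn: "\<And>x. 0 < x \<Longrightarrow> x < b \<Longrightarrow> 0 \<le> F' x"
    and lim: "(F \<longlongrightarrow> L) (at_right 0)" and t: "0 < t" "t < b"
  shows "L \<le> F t"
proof (rule tendsto_upperbound[OF lim])
  have "F x \<le> F t" if "0 < x" "x < t" for x
  proof (rule DERIV_nonneg_imp_nondecreasing[of x t F])
    show "\<exists>y'. (F has_real_derivative y') (at y) \<and> 0 \<le> y'" if "x \<le> y" "y \<le> t" for y
      using der[of y] nn[of y] that \<open>0 < x\<close> t by (intro exI[of _ "F' y"]) simp
  qed (use that in simp)
  then show "\<forall>\<^sub>F x in at_right 0. F x \<le> F t"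
    using t by (auto simp: eventually_at_right_field)
qed simp

text \<open>
  Here k is \<sigma>/(t \<sigma>').  The differential equation gives (ln k)' = \<theta>(\<lambda>t)/t, and
  (ln (\<sigma>/t))' = (1/k - 1)/t.  Both ln k and ln (\<sigma>/t) tend to 0 at t = 0, so the bounds follow by
  integrating \<theta>(\<lambda>t)/t \<le> 64 (\<lambda>t)^(1/4)/t.
\<close>

lemma sigma_properties:
  assumes s: "1/2 \<le> s" "s < 1" and lam: "0 < lam" and sig: "is_sigma s lam \<sigma>"
  obtains k where
    "\<And>t. 0 < t \<Longrightarrow> t < 1/lam \<Longrightarrow> 0 < \<sigma> t \<and> \<sigma> t \<le> t \<and> t \<le> exp 1024 * \<sigma> t"
    "\<And>t. 0 < t \<Longrightarrow> t < 1/lam \<Longrightarrow> 1 \<le> k t \<and> k t \<le> exp 256"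
    "\<And>t. 0 < t \<Longrightarrow> t < 1/lam \<Longrightarrow> (\<sigma> has_real_derivative \<sigma> t / (t * k t)) (at t)"
    "\<And>t. 0 < t \<Longrightarrow> t < 1/lam \<Longrightarrow> (k has_real_derivative k t * theta s (lam * t) / t) (at t)"
proof -
  obtain \<sigma>' where \<sigma>': "(\<forall>t\<in>{0..1/lam}. (\<sigma> has_real_derivative \<sigma>' t) (at t within {0..1/lam})) \<and>
      continuous_on {0..1/lam} \<sigma>' \<and> \<sigma> 0 = 0 \<and> \<sigma>' 0 = 1 \<and>
      (\<forall>t\<in>{0<..1/lam}. 0 < \<sigma> t / (t * \<sigma>' t) \<and>
        ((\<lambda>\<tau>. ln (\<sigma> \<tau> / (\<tau> * \<sigma>' \<tau>))) has_real_derivative theta s (lam * t) / t) (at t within {0<..1/lam}))"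
    using sig unfolding is_sigma_def by (elim exE)
  note d0 = bspec[OF conjunct1[OF \<sigma>']]
  from \<sigma>' have c0: "continuous_on {0..1/lam} \<sigma>'" and z: "\<sigma> 0 = 0" "\<sigma>' 0 = 1"
    and pl: "\<forall>t\<in>{0<..1/lam}. 0 < \<sigma> t / (t * \<sigma>' t) \<and>
        ((\<lambda>\<tau>. ln (\<sigma> \<tau> / (\<tau> * \<sigma>' \<tau>))) has_real_derivative theta s (lam * t) / t) (at t within {0<..1/lam})"
    by blast+
  note pos = conjunct1[OF bspec[OF pl]] and ln0 = conjunct2[OF bspec[OF pl]]
  define k where "k t = \<sigma> t / (t * \<sigma>' t)" for t
  define l where "l t = ln (k t)" for t
  have ul: "0 < 1/lam" using lam by simp
  have d: "(\<sigma> has_real_derivative \<sigma>' t) (at t)" if "0 < t" "t < 1/lam" for t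
    using d0[of t] that at_within_Icc_at[of 0 t "1/lam"] by simp
  have ld: "(l has_real_derivative theta s (lam * t) / t) (at t)" if "0 < t" "t < 1/lam" for t
  proof -
    have "at t within {0<..1/lam} = at t"
      by (rule at_within_open_subset[of _ "{0<..<1/lam}"]) (use that in auto)
    then show ?thesis using ln0[of t] that by (simp add: l_def[abs_def] k_def)
  qed
  have kpos: "0 < k t" if "0 < t" "t \<le> 1/lam" for t using pos[of t] that by (simp add: k_def)
  have s'0: "\<sigma>' t \<noteq> 0" if "0 \<le> t" "t \<le> 1/lam" for t
    using pos[of t] that z by (cases "t = 0") auto
  \<comment> \<open>\<sigma>' has no zero and equals 1 at 0, so it stays positive by the intermediate value theorem.\<close>
  have s'pos: "0 < \<sigma>' t" if t: "0 \<le> t" "t \<le> 1/lam" for t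
  proof (rule ccontr)
    assume "\<not> 0 < \<sigma>' t"
    moreover have "continuous_on {0..t} \<sigma>'" using c0 t by (auto intro: continuous_on_subset)
    ultimately have "\<exists>x\<ge>0. x \<le> t \<and> \<sigma>' x = 0" using t z by (intro IVT2') auto
    then show False using s'0 t by force
  qed
  have spos: "0 < \<sigma> t" if "0 < t" "t \<le> 1/lam" for t
  proof -
    have "0 < t * \<sigma>' t" using s'pos[of t] that by simp
    then show ?thesis using kpos[OF that] by (simp add: k_def zero_less_divide_iff)
  qed
  have lim1: "((\<lambda>t. \<sigma> t / t) \<longlongrightarrow> 1) (at_right 0)"
  proof -
    have "((\<lambda>t. (\<sigma> t - \<sigma> 0) / (t - 0)) \<longlongrightarrow> 1) (at 0 within {0..1/lam})"
      using d0[of 0] ul z by (simp add: has_field_derivative_iff)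
    then have "((\<lambda>t. \<sigma> t / t) \<longlongrightarrow> 1) (at 0 within {0..1/lam})" using z by simp
    then show ?thesis using at_within_Icc_at_right[OF ul] by simp
  qed
  have lim2: "(\<sigma>' \<longlongrightarrow> 1) (at_right 0)"
    using c0 ul z at_within_Icc_at_right[OF ul] unfolding continuous_on_def by force
  have limk: "(k \<longlongrightarrow> 1) (at_right 0)"
    using tendsto_divide[OF lim1 lim2] by (simp add: k_def[abs_def] divide_divide_eq_left')
  have liml: "(l \<longlongrightarrow> 0) (at_right 0)"
    unfolding l_def[abs_def] using tendsto_ln[OF limk] by simp
  \<comment> \<open>(\<lambda>t)^(1/4) is the comparison function: its derivative dominates \<theta>(\<lambda>t)/t up to a factor.\<close>
  define e where "e t = (lam * t) powr (1/4)" for t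
  have ed: "(e has_real_derivative e t / (4 * t)) (at t)" if "0 < t" for t
  proof -
    have "(lam * t) powr (- (3/4)) = (lam * t) powr (1/4) / (lam * t)"
      using powr_diff[of "lam * t" "1/4" 1] that lam by simp
    then show ?thesis
      unfolding e_def[abs_def] using that lam by (auto intro!: derivative_eq_intros)
  qed
  have lime: "(e \<longlongrightarrow> 0) (at_right 0)"
  proof -
    have "(e \<longlongrightarrow> (lam * 0) powr (1/4)) (at_right 0)" unfolding e_def[abs_def]
      by (rule tendsto_powr'[OF tendsto_mult[OF tendsto_const tendsto_ident_at] tendsto_const])
         (use lam in \<open>auto simp: eventually_at_filter\<close>)
    then show ?thesis by simp
  qed
  have e1: "e t \<le> 1" if "0 < t" "t < 1/lam" for t
    using that lam unfolding e_def by (intro powr_le1) (auto simp: field_simps)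
  have th: "0 \<le> theta s (lam * t)" "theta s (lam * t) \<le> 64 * e t" if "0 < t" "t < 1/lam" for t
    using theta_bounds[OF s, of "lam * t"] that lam by (auto simp: e_def field_simps)
  have l0: "0 \<le> l t" if t: "0 < t" "t < 1/lam" for t
    by (rule limit_le_of_nonneg_derivative[OF ld _ liml t]) (use th in auto)
  have l1: "l t \<le> 256 * e t" if t: "0 < t" "t < 1/lam" for t
  proof -
    have "0 \<le> 256 * e t - l t"
    proof (rule limit_le_of_nonneg_derivative[OF _ _ _ t, where F' = "\<lambda>t. 256 * (e t / (4 * t)) - theta s (lam * t) / t"])
      show "((\<lambda>t. 256 * e t - l t) has_real_derivative 256 * (e t / (4 * t)) - theta s (lam * t) / t) (at t)"
        if "0 < t" "t < 1/lam" for t by (intro DERIV_diff DERIV_cmult ed ld that)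
      show "0 \<le> 256 * (e t / (4 * t)) - theta s (lam * t) / t" if "0 < t" "t < 1/lam" for t
        using th(2)[OF that] that by (simp add: field_simps)
      show "((\<lambda>t. 256 * e t - l t) \<longlongrightarrow> 0) (at_right 0)"
        using tendsto_diff[OF tendsto_mult[OF tendsto_const[of 256] lime] liml] by simp
    qed
    then show ?thesis by simp
  qed
  have kl: "k t = exp (l t)" if "0 < t" "t < 1/lam" for t using kpos[of t] that by (simp add: l_def)
  have k1: "1 \<le> k t" if "0 < t" "t < 1/lam" for t using kl[OF that] l0[OF that] by simp
  have k2: "k t \<le> exp 256" if "0 < t" "t < 1/lam" for t using kl[OF that] l1[OF that] e1[OF that] by simp
  have s'k: "\<sigma>' t = \<sigma> t / (t * k t)" if "0 < t" "t < 1/lam" for t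
    using spos[of t] s'pos[of t] that by (simp add: k_def field_simps)
  have kd: "(k has_real_derivative k t * theta s (lam * t) / t) (at t)" if t: "0 < t" "t < 1/lam" for t
  proof -
    have "((\<lambda>t. exp (l t)) has_real_derivative exp (l t) * (theta s (lam * t) / t)) (at t)"
      by (rule DERIV_fun_exp[OF ld[OF t]])
    then have 1: "((\<lambda>t. exp (l t)) has_real_derivative k t * theta s (lam * t) / t) (at t)" using kl[OF t] by simp
    show ?thesis
      by (rule has_field_derivative_transform_within_open[OF 1, of "{0<..<1/lam}"]) (use t kl in auto)
  qed
  define r where "r t = ln (\<sigma> t / t)" for t
  have rd: "(r has_real_derivative (1 / k t - 1) / t) (at t)" if t: "0 < t" "t < 1/lam" for t
  proof -
    have p: "0 < \<sigma> t / t" "0 < k t" "0 < \<sigma> t" using spos[of t] kpos[of t] t by auto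
    have "((\<lambda>t. \<sigma> t / t) has_real_derivative (\<sigma>' t * t - \<sigma> t * 1) / (t * t)) (at t)"
      using t by (intro DERIV_divide d) auto
    from DERIV_chain2[OF DERIV_ln_divide[OF p(1)] this]
    have "(r has_real_derivative 1 / (\<sigma> t / t) * ((\<sigma>' t * t - \<sigma> t * 1) / (t * t))) (at t)"
      by (simp add: r_def[abs_def])
    moreover have "1 / (\<sigma> t / t) * ((\<sigma>' t * t - \<sigma> t * 1) / (t * t)) = (1 / k t - 1) / t"
      unfolding s'k[OF t] using p t by (simp add: field_simps)
    ultimately show ?thesis by simp
  qed
  have limr: "(r \<longlongrightarrow> 0) (at_right 0)" unfolding r_def[abs_def] using tendsto_ln[OF lim1] by simp
  have r0: "r t \<le> 0" if t: "0 < t" "t < 1/lam" for t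
  proof -
    have "0 \<le> - r t"
    proof (rule limit_le_of_nonneg_derivative[OF DERIV_minus[OF rd] _ _ t])
      show "0 \<le> - ((1 / k t - 1) / t)" if "0 < t" "t < 1/lam" for t using k1[OF that] that by (simp add: field_simps)
      show "((\<lambda>t. - r t) \<longlongrightarrow> 0) (at_right 0)" using tendsto_minus[OF limr] by simp
    qed
    then show ?thesis by simp
  qed
  have r1: "- 1024 \<le> r t" if t: "0 < t" "t < 1/lam" for t
  proof -
    have "0 \<le> 1024 * e t + r t"
    proof (rule limit_le_of_nonneg_derivative[OF _ _ _ t, where F' = "\<lambda>t. 1024 * (e t / (4 * t)) + (1 / k t - 1) / t"])
      show "((\<lambda>t. 1024 * e t + r t) has_real_derivative 1024 * (e t / (4 * t)) + (1 / k t - 1) / t) (at t)"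
        if "0 < t" "t < 1/lam" for t by (intro DERIV_add DERIV_cmult ed rd that)
      show "0 \<le> 1024 * (e t / (4 * t)) + (1 / k t - 1) / t" if t: "0 < t" "t < 1/lam" for t
      proof -
        have "1 / k t = exp (- l t)" using kl[OF t] by (simp add: exp_minus inverse_eq_divide)
        then have "1 / k t \<ge> 1 - l t" using exp_ge_add_one_self[of "- l t"] by simp
        then have "0 \<le> 256 * e t + (1 / k t - 1)" using l1[OF t] by simp
        then have "0 \<le> (256 * e t + (1 / k t - 1)) / t" using t by simp
        also have "\<dots> = 1024 * (e t / (4 * t)) + (1 / k t - 1) / t" by (simp add: add_divide_distrib)
        finally show ?thesis .
      qed
      show "((\<lambda>t. 1024 * e t + r t) \<longlongrightarrow> 0) (at_right 0)"
        using tendsto_add[OF tendsto_mult[OF tendsto_const[of 1024] lime] limr] by simp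
    qed
    then show ?thesis using e1[OF t] by simp
  qed
  have sb: "0 < \<sigma> t \<and> \<sigma> t \<le> t \<and> t \<le> exp 1024 * \<sigma> t" if t: "0 < t" "t < 1/lam" for t
  proof -
    have p: "0 < \<sigma> t" using spos[of t] t by simp
    then have q: "\<sigma> t / t = exp (r t)" using t by (simp add: r_def)
    have "exp (r t) \<le> 1" "exp (- 1024) \<le> exp (r t)" using r0[OF t] r1[OF t] by auto
    then show ?thesis unfolding q[symmetric] using p t by (simp add: field_simps exp_minus)
  qed
  show ?thesis
    by (rule that[of k, OF sb _ _ kd]) (use k1 k2 d s'k in auto)
qed

section \<open>The operators Z and A\<close>

text \<open>
  A function with its first and second derivatives on the slab: \<open>g\<close> is the spatial gradient, \<open>wt\<close> the time derivative,
  and \<open>g'\<close>, \<open>wt'\<close> are the derivatives of these.  The last three assumptions name the boundary values at y = 0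
  of w, of Z w and of the flux y^a \<partial>_y w.
\<close>

locale jet = slab dim a c d for dim :: "'n::finite itself" and a c d +
  fixes w wt :: "'n pt \<times> real \<Rightarrow> real" and g :: "'n pt \<times> real \<Rightarrow> 'n pt"
    and wt' :: "'n pt \<times> real \<Rightarrow> 'n pt \<times> real \<Rightarrow> real" and g' :: "'n pt \<times> real \<Rightarrow> 'n pt \<times> real \<Rightarrow> 'n pt"
    and w0 z0 q :: "real^'n \<Rightarrow> real \<Rightarrow> real"
  assumes w_der: "\<And>p. p \<in> S \<Longrightarrow> (w has_derivative (\<lambda>h. g p \<bullet> fst h + wt p * snd h)) (at p)"
    and wt_der: "\<And>p. p \<in> S \<Longrightarrow> (wt has_derivative wt' p) (at p)"
    and g_der: "\<And>p. p \<in> S \<Longrightarrow> (g has_derivative g' p) (at p)"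
    and sym1: "\<And>p u v. p \<in> S \<Longrightarrow> u \<bullet> g' p (v, 0) = v \<bullet> g' p (u, 0)"
    and sym2: "\<And>p v. p \<in> S \<Longrightarrow> wt' p (v, 0) = v \<bullet> g' p (0, 1)"
    and adm_w: "adm w" and adm_wt: "adm wt" and adm_g: "adm g"
    and adm_wt': "\<And>b. b \<in> Basis \<Longrightarrow> adm (\<lambda>p. wt' p b)" and adm_g': "\<And>b. b \<in> Basis \<Longrightarrow> adm (\<lambda>p. g' p b)"
    and adm_gy: "adm (\<lambda>p. a * snd (g p) / snd (fst p))"
    and final: "\<And>X. X \<in> half_space \<Longrightarrow> w (X, d) = 0 \<and> g (X, d) = 0"
    and w_lim: "\<And>x t. t \<in> {c..d} \<Longrightarrow> ((\<lambda>y. w ((x, y), t)) \<longlongrightarrow> w0 x t) (at_right 0)"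
    and z_lim: "\<And>x t. t \<in> {c..d} \<Longrightarrow>
      ((\<lambda>y. wt ((x, y), t) + ((x, y) \<bullet> g ((x, y), t)) / (2 * t)) \<longlongrightarrow> z0 x t) (at_right 0)"
    and q_lim: "\<And>x t. t \<in> {c..d} \<Longrightarrow> ((\<lambda>y. y powr a * snd (g ((x, y), t))) \<longlongrightarrow> q x t) (at_right 0)"
begin

text \<open>
  \<open>Z\<close> is the derivative along the dilations, \<open>A\<close> the drift Laplacian, and \<open>Z'\<close> the derivative of \<open>Z\<close>.
\<close>

definition Z where "Z p = wt p + (fst p \<bullet> g p) / (2 * snd p)"
definition A where "A p = (\<Sum>b\<in>Basis. g' p (b, 0) \<bullet> b) + a * snd (g p) / snd (fst p) - (fst p \<bullet> g p) / (2 * snd p)"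
definition Z' where "Z' p h = wt' p h + (fst h \<bullet> g p + fst p \<bullet> g' p h) / (2 * snd p) - (fst p \<bullet> g p) * snd h / (2 * (snd p)\<^sup>2)"

definition BZ where "BZ t = (LINT x|lborel. z0 x t * q x t * G_kernel a (x, 0) t)"
definition BW where "BW t = (LINT x|lborel. w0 x t * q x t * G_kernel a (x, 0) t)"

lemma lin_g': "p \<in> S \<Longrightarrow> linear (g' p)" and lin_wt': "p \<in> S \<Longrightarrow> linear (wt' p)"
  by (rule has_derivative_linear[OF g_der], assumption, rule has_derivative_linear[OF wt_der])

lemma Basis_X: "b \<in> Basis \<Longrightarrow> (b, 0) \<in> (Basis :: ('n pt \<times> real) set)" for b :: "'n pt"
  unfolding Basis_prod_def[where 'a = "'n pt" and 'b = real] by (rule UnI1[OF imageI])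

lemma adm_Z: "adm Z"
  unfolding Z_def[abs_def] by (rule adm_add[OF adm_wt adm_div_2t[OF adm_inner2[OF tame_fst adm_g]]])

lemma adm_A: "adm A"
  unfolding A_def[abs_def]
  by (rule adm_diff[OF adm_add[OF adm_sum adm_gy] adm_div_2t[OF adm_inner2[OF tame_fst adm_g]]])
     (rule adm_inner1[OF adm_g'[OF Basis_X] tame_const])

lemma adm_gg: "adm (\<lambda>p. g p \<bullet> g p)" by (rule adm_inner1[OF adm_g admD[OF adm_g]])
lemma adm_ww: "adm (\<lambda>p. (w p)\<^sup>2)" by (rule adm_square[OF adm_w])

lemma adm_Z'X:
  assumes b: "b \<in> Basis" shows "adm (\<lambda>p. Z' p (b, 0))"
proof -
  have "adm (\<lambda>p. wt' p (b, 0) + (b \<bullet> g p + fst p \<bullet> g' p (b, 0)) / (2 * snd p))"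
    by (rule adm_add[OF adm_wt'[OF Basis_X[OF b]] adm_div_2t[OF adm_add[OF adm_inner2[OF tame_const adm_g]
      adm_inner2[OF tame_fst adm_g'[OF Basis_X[OF b]]]]]])
  then show ?thesis by (simp add: Z'_def)
qed

lemma Z_der:
  assumes p: "p \<in> S" shows "(Z has_derivative Z' p) (at p)"
proof -
  have t0: "2 * snd p \<noteq> 0" using S_D[OF p] by simp
  have 1: "((\<lambda>p. 2 * snd p) has_derivative (\<lambda>h. 2 * snd h)) (at p)"
    by (intro has_derivative_mult_right has_derivative_snd has_derivative_ident)
  have 2: "((\<lambda>p. fst p \<bullet> g p) has_derivative (\<lambda>h. fst p \<bullet> g' p h + fst h \<bullet> g p)) (at p)"
    by (rule has_derivative_inner[OF has_derivative_fst[OF has_derivative_ident] g_der[OF p]])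
  have 3: "((\<lambda>p. (fst p \<bullet> g p) / (2 * snd p)) has_derivative
      (\<lambda>h. (fst h \<bullet> g p + fst p \<bullet> g' p h) / (2 * snd p) - (fst p \<bullet> g p) * snd h / (2 * (snd p)\<^sup>2))) (at p)"
    by (rule has_derivative_eq_rhs[OF has_derivative_divide'[OF 2 1 t0]])
       (use t0 in \<open>simp add: fun_eq_iff field_simps power2_eq_square\<close>)
  show ?thesis
    using has_derivative_add[OF wt_der[OF p] 3] unfolding Z_def[abs_def] Z'_def[abs_def] by (simp add: add_diff_eq)
qed

text \<open>
  The commutator of Z with the gradient: Z |\<nabla>w|^2 = 2 \<nabla>w\<cdot>\<nabla>(Z w) - |\<nabla>w|^2/t.  This is where the symmetry of
  second derivatives enters.
\<close>

lemma Z'_g: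
  assumes p: "p \<in> S"
  shows "Z' p (g p, 0) = g p \<bullet> g' p ((1 / (2 * snd p)) *\<^sub>R fst p, 1) + (g p \<bullet> g p) / (2 * snd p)"
proof -
  have "g' p ((1 / (2 * snd p)) *\<^sub>R fst p, 1) = (1 / (2 * snd p)) *\<^sub>R g' p (fst p, 0) + g' p (0, 1)"
    using linear_add[OF lin_g'[OF p], of "((1 / (2 * snd p)) *\<^sub>R fst p, 0)" "(0,1)"]
      linear_scale[OF lin_g'[OF p], of "1 / (2 * snd p)" "(fst p, 0)"] by simp
  then show ?thesis
    unfolding Z'_def sym2[OF p]
    using sym1[OF p, of "fst p" "g p"] by (simp add: inner_add_right add_divide_distrib)
qed

lemma green:
  fixes v :: "'n pt \<times> real \<Rightarrow> real"
  assumes t: "t \<in> {c..d}"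
    and der: "\<And>p. p \<in> S \<Longrightarrow> (v has_derivative v' p) (at p)"
    and v: "adm v" and v': "\<And>b. b \<in> Basis \<Longrightarrow> adm (\<lambda>p. v' p (b, 0))"
    and lim: "\<And>x. ((\<lambda>y. v ((x, y), t)) \<longlongrightarrow> v0 x) (at_right 0)"
  shows "IX (\<lambda>p. v p * A p + v' p (g p, 0)) t = - (LINT x|lborel. v0 x * q x t * G_kernel a (x, 0) t)"
proof -
  \<comment> \<open>The field v \<nabla>w.\<close>
  define F where "F p = v p *\<^sub>R g p" for p
  define F' where "F' p h = v p *\<^sub>R g' p h + v' p h *\<^sub>R g p" for p h
  have lin: "linear (v' p)" if "p \<in> S" for p using has_derivative_linear[OF der[OF that]] .
  have "IX (\<lambda>p. (\<Sum>b\<in>Basis. F' p (b, 0) \<bullet> b) + a * snd (F p) / snd (fst p) - (fst p \<bullet> F p) / (2 * snd p)) t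
     = - (LINT x|lborel. (v0 x * q x t) * G_kernel a (x, 0) t)"
  proof (rule weighted_divergence[OF t])
    show "(F has_derivative F' p) (at p)" if "p \<in> S" for p
      unfolding F_def[abs_def] F'_def[abs_def] by (rule has_derivative_scaleR[OF der[OF that] g_der[OF that]])
    show "adm F" unfolding F_def[abs_def] by (rule adm_scaleR1[OF v admD[OF adm_g]])
    show "adm (\<lambda>p. F' p (b, 0))" if "b \<in> Basis" for b
      unfolding F'_def
      by (rule adm_add[OF adm_scaleR1[OF v admD[OF adm_g'[OF Basis_X[OF that]]]] adm_scaleR1[OF v'[OF that] admD[OF adm_g]]])
    show "adm (\<lambda>p. a * snd (F p) / snd (fst p))"
      using adm_mult2[OF admD[OF v] adm_gy] by (simp add: F_def mult_ac)
    show "((\<lambda>y. y powr a * snd (F ((x, y), t))) \<longlongrightarrow> v0 x * q x t) (at_right 0)" for x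
      using tendsto_mult[OF lim[of x] q_lim[OF t, of x]] by (simp add: F_def mult_ac)
  qed
  moreover have "(\<Sum>b\<in>Basis. F' p (b, 0) \<bullet> b) + a * snd (F p) / snd (fst p) - (fst p \<bullet> F p) / (2 * snd p)
      = v p * A p + v' p (g p, 0)" if p: "p \<in> S" for p
  proof -
    have "v' p (g p, 0) = (\<Sum>b\<in>Basis. (g p \<bullet> b) * v' p (b, 0))"
      by (rule linear_expand_fst[OF lin[OF p]])
    moreover have "(\<Sum>b\<in>Basis. F' p (b, 0) \<bullet> b) = v p * (\<Sum>b\<in>Basis. g' p (b, 0) \<bullet> b) + (\<Sum>b\<in>Basis. (g p \<bullet> b) * v' p (b, 0))"
      by (simp add: F'_def inner_add_left sum.distrib sum_distrib_left mult_ac)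
    ultimately show ?thesis by (simp add: A_def F_def algebra_simps)
  qed
  ultimately show ?thesis
    using t by (subst IX_cong[where g = "\<lambda>p. (\<Sum>b\<in>Basis. F' p (b, 0) \<bullet> b) + a * snd (F p) / snd (fst p) - (fst p \<bullet> F p) / (2 * snd p)"])
      (auto simp: S_def)
qed

lemma green_Z: "t \<in> {c..d} \<Longrightarrow> IX (\<lambda>p. Z p * A p + Z' p (g p, 0)) t = - BZ t"
  unfolding BZ_def by (rule green[OF _ Z_der adm_Z adm_Z'X]) (use z_lim in \<open>simp_all add: Z_def\<close>)

lemma adm_w_der: "b \<in> Basis \<Longrightarrow> adm (\<lambda>p. g p \<bullet> fst ((b, 0)::'n pt \<times> real) + wt p * snd ((b, 0)::'n pt \<times> real))"
  using adm_inner1[OF adm_g tame_const[of b]] by simp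

lemma green_w: "t \<in> {c..d} \<Longrightarrow> IX (\<lambda>p. w p * A p + g p \<bullet> g p) t = - BW t"
  using green[OF _ w_der adm_w adm_w_der w_lim, of t] by (simp add: BW_def)

lemma adm_green_Z: "adm (\<lambda>p. Z p * A p + Z' p (g p, 0))"
proof -
  have "linear (Z' p)" if "p \<in> S" for p using has_derivative_linear[OF Z_der[OF that]] .
  then have l: "linear (\<lambda>h. Z' p (h, 0))" if "p \<in> S" for p
    by (rule linear_compose[OF _ , of "\<lambda>h. (h, 0)", unfolded o_def, rotated]) (use that in \<open>auto intro!: linearI\<close>)
  show ?thesis
    by (rule adm_add[OF adm_mult1[OF adm_Z admD[OF adm_A]]
      adm_linear[where f' = "\<lambda>p h. Z' p (h, 0)" and h = g, OF l adm_Z'X admD[OF adm_g]]])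
qed

lemma adm_green_w: "adm (\<lambda>p. w p * A p + g p \<bullet> g p)"
  by (rule adm_add[OF adm_mult1[OF adm_w admD[OF adm_A]] adm_gg])

lemma adm_time: "continuous_on {c..d} m \<Longrightarrow> adm f \<Longrightarrow> adm (\<lambda>p. m (snd p) * f p :: real)"
  by (rule adm_mult2[OF tame_time])

lemma IS_time_weight:
  assumes m: "continuous_on {c..d} m" and f: "adm f" and eq: "\<And>t. t \<in> {c..d} \<Longrightarrow> IX f t = B t"
  shows "IS (\<lambda>p. m (snd p) * f p) = (LINT t:{c..d}|lborel. m t * B t)"
    and "set_integrable lborel {c..d} (\<lambda>t. m t * B t)"
proof -
  note sl = IS_slices[OF adm_time[OF m f], unfolded IX_cmult_time]
  show "IS (\<lambda>p. m (snd p) * f p) = (LINT t:{c..d}|lborel. m t * B t)"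
    unfolding sl(1) by (rule set_lebesgue_integral_cong) (use eq in auto)
  show "set_integrable lborel {c..d} (\<lambda>t. m t * B t)"
    using sl(2) eq by (subst set_integrable_cong[OF refl refl, where f' = "\<lambda>t. m t * IX f t"]) auto
qed

end

section \<open>The Carleman identity\<close>

text \<open>
  In the application P = \<sigma>^(-2\<alpha>), k = \<sigma>/(t \<sigma>') and \<theta>(t) = \<theta>_s(\<lambda>t); then \<alpha>/\<psi> is \<alpha> \<sigma>'/\<sigma>.
\<close>

locale weighted = jet dim a c d w wt g wt' g' w0 z0 q
  for dim :: "'n::finite itself" and a c d w wt g wt' g' w0 z0 q +
  fixes \<alpha> :: real and P k \<theta> :: "real \<Rightarrow> real"
  assumes alpha: "0 < \<alpha>"
    and P_der: "\<And>t. t \<in> {c..d} \<Longrightarrow> (P has_real_derivative - 2 * \<alpha> * P t / (t * k t)) (at t)"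
    and k_der: "\<And>t. t \<in> {c..d} \<Longrightarrow> (k has_real_derivative k t * \<theta> t / t) (at t)"
    and th_cont: "continuous_on {c..d} \<theta>"
    and P_pos: "\<And>t. t \<in> {c..d} \<Longrightarrow> 0 < P t" and k_ge_1: "\<And>t. t \<in> {c..d} \<Longrightarrow> 1 \<le> k t"
    and th_nonneg: "\<And>t. t \<in> {c..d} \<Longrightarrow> 0 \<le> \<theta> t"
begin

definition \<psi> where "\<psi> t = t * k t"

lemma P_cont: "continuous_on {c..d} P" and k_cont: "continuous_on {c..d} k"
  by (intro continuous_at_imp_continuous_on ballI; rule DERIV_isCont, erule P_der k_der)+

lemma psi_cont: "continuous_on {c..d} \<psi>"
  unfolding \<psi>_def[abs_def] by (intro continuous_on_mult continuous_on_id k_cont)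

lemma pos: "t \<in> {c..d} \<Longrightarrow> 0 < t" "t \<in> {c..d} \<Longrightarrow> 0 < \<psi> t"
  using c k_ge_1[of t] by (auto simp: \<psi>_def)

text \<open>
  The contributions of P' and of \<psi>' = k (1 + \<theta>) are kept apart: the first will cancel the gradient term that
  comes from 2 \<alpha> P w (A w), and the part P k of the second the commutator term |\<nabla>w|^2/t.
\<close>

lemma Ppsi_der:
  assumes t: "t \<in> {c..d}"
  shows "((\<lambda>t. P t * \<psi> t) has_real_derivative - 2 * \<alpha> * P t + P t * k t * (1 + \<theta> t)) (at t)"
proof -
  have "((\<lambda>t. P t * (t * k t)) has_real_derivative
      (- 2 * \<alpha> * P t / (t * k t)) * (t * k t) + (1 * k t + (k t * \<theta> t / t) * t) * P t) (at t)"
    by (intro DERIV_mult P_der k_der t DERIV_ident)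
  moreover have "(- 2 * \<alpha> * P t / (t * k t)) * (t * k t) + (1 * k t + (k t * \<theta> t / t) * t) * P t
      = - 2 * \<alpha> * P t + P t * k t * (1 + \<theta> t)"
    using pos[OF t] k_ge_1[OF t] by (simp add: field_simps)
  ultimately show ?thesis by (simp add: \<psi>_def)
qed

lemma has_derivative_time:
  assumes "(m has_real_derivative m') (at (snd p))"
  shows "((\<lambda>p. m (snd p)) has_derivative (\<lambda>h. m' * snd h)) (at p)"
  using has_derivative_compose[OF has_derivative_snd[OF has_derivative_ident]
      assms[unfolded has_field_derivative_def]] by simp

text \<open>
  \<open>integral_Z\<close> applied to P \<psi> |\<nabla>w|^2.
\<close>

lemma IS_Z_gradient:
  "IS (\<lambda>p. (- 2 * \<alpha> * P (snd p) + P (snd p) * k (snd p) * \<theta> (snd p)) * (g p \<bullet> g p)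
        + 2 * (P (snd p) * \<psi> (snd p)) * Z' p (g p, 0)) = - P c * \<psi> c * IX (\<lambda>p. g p \<bullet> g p) c" (is ?A)
  "adm (\<lambda>p. (- 2 * \<alpha> * P (snd p) + P (snd p) * k (snd p) * \<theta> (snd p)) * (g p \<bullet> g p)
        + 2 * (P (snd p) * \<psi> (snd p)) * Z' p (g p, 0))" (is ?B)
proof -
  define f where "f p = (P (snd p) * \<psi> (snd p)) * (g p \<bullet> g p)" for p
  define f' where "f' p h = (P (snd p) * \<psi> (snd p)) * (2 * (g p \<bullet> g' p h))
      + ((- 2 * \<alpha> * P (snd p) + P (snd p) * k (snd p) * (1 + \<theta> (snd p))) * snd h) * (g p \<bullet> g p)" for p h
  have c1: "continuous_on {c..d} (\<lambda>t. P t * \<psi> t)" by (intro continuous_on_mult P_cont psi_cont)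
  have c2: "continuous_on {c..d} (\<lambda>t. - 2 * \<alpha> * P t + P t * k t * (1 + \<theta> t))"
    by (intro continuous_intros P_cont k_cont th_cont)
  have D: "(f has_derivative f' p) (at p)" if p: "p \<in> S" for p
  proof -
    have t: "snd p \<in> {c..d}" using S_D[OF p] by simp
    have "((\<lambda>p. g p \<bullet> g p) has_derivative (\<lambda>h. g p \<bullet> g' p h + g' p h \<bullet> g p)) (at p)"
      by (rule has_derivative_inner[OF g_der[OF p] g_der[OF p]])
    then have 2: "((\<lambda>p. g p \<bullet> g p) has_derivative (\<lambda>h. 2 * (g p \<bullet> g' p h))) (at p)"
      by (simp add: inner_commute)
    show ?thesis
      using has_derivative_mult[OF has_derivative_time[OF Ppsi_der[OF t]] 2]
      unfolding f_def[abs_def] f'_def[abs_def] .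
  qed
  have af: "adm f" unfolding f_def[abs_def] by (rule adm_time[OF c1 adm_gg])
  have af': "adm (\<lambda>p. f' p b)" if b: "b \<in> Basis" for b
    unfolding f'_def
    by (rule adm_add[OF adm_mult2[OF tame_time[OF c1] adm_mult2[OF tame_const adm_inner1[OF adm_g admD[OF adm_g'[OF b]]]]]
       adm_mult2[OF tame_mult[OF tame_time[OF c2] tame_const] adm_gg]])
  have zero: "f (X, d) = 0" if "X \<in> half_space" for X using final[OF that] by (simp add: f_def)
  note integral_Z[of f f', OF D af af' zero]
  moreover have eq: "f' p ((1 / (2 * snd p)) *\<^sub>R fst p, 1) =
      (- 2 * \<alpha> * P (snd p) + P (snd p) * k (snd p) * \<theta> (snd p)) * (g p \<bullet> g p)
        + 2 * (P (snd p) * \<psi> (snd p)) * Z' p (g p, 0)" if p: "p \<in> S" for p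
  proof -
    have t: "0 < snd p" using S_D[OF p] by simp
    have k: "\<psi> (snd p) / (2 * snd p) = k (snd p) / 2" using t by (simp add: \<psi>_def)
    have "P (snd p) * \<psi> (snd p) * ((g p \<bullet> g p) / (2 * snd p)) = P (snd p) * (g p \<bullet> g p) * (\<psi> (snd p) / (2 * snd p))"
      by simp
    then show ?thesis unfolding f'_def Z'_g[OF p] k by (simp add: algebra_simps)
  qed
  moreover have "IX f c = P c * \<psi> c * IX (\<lambda>p. g p \<bullet> g p) c"
    unfolding f_def[abs_def] by (rule IX_cmult_time)
  ultimately show ?A ?B
    using IS_cong[OF eq] adm_cong[OF eq] by auto
qed

text \<open>
  \<open>integral_Z\<close> applied to P w^2.
\<close>

lemma IS_Z_function:
  "IS (\<lambda>p. - 2 * \<alpha> * (P (snd p) / \<psi> (snd p)) * (w p)\<^sup>2 + 2 * P (snd p) * (w p * Z p)) = - P c * IX (\<lambda>p. (w p)\<^sup>2) c" (is ?A)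
  "adm (\<lambda>p. - 2 * \<alpha> * (P (snd p) / \<psi> (snd p)) * (w p)\<^sup>2 + 2 * P (snd p) * (w p * Z p))" (is ?B)
proof -
  define f where "f p = P (snd p) * (w p * w p)" for p
  define w' where "w' p h = g p \<bullet> fst h + wt p * snd h" for p h
  define f' where "f' p h = P (snd p) * (w p * w' p h + w' p h * w p)
      + ((- 2 * \<alpha> * P (snd p) / \<psi> (snd p)) * snd h) * (w p * w p)" for p h
  have c2: "continuous_on {c..d} (\<lambda>t. - 2 * \<alpha> * P t / \<psi> t)"
    by (intro continuous_intros P_cont psi_cont) (use pos in force)
  have w': "adm (\<lambda>p. w' p b)" for b
    unfolding w'_def by (rule adm_add[OF adm_inner1[OF adm_g tame_const] adm_mult1[OF adm_wt tame_const]])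
  have aww: "adm (\<lambda>p. w p * w p)" by (rule adm_mult1[OF adm_w admD[OF adm_w]])
  have D: "(f has_derivative f' p) (at p)" if p: "p \<in> S" for p
  proof -
    have t: "snd p \<in> {c..d}" using S_D[OF p] by simp
    note W = w_der[OF p, folded w'_def]
    show ?thesis
      using has_derivative_mult[OF has_derivative_time[OF P_der[OF t]] has_derivative_mult[OF W W]]
      unfolding f_def[abs_def] f'_def[abs_def] \<psi>_def .
  qed
  have af: "adm f" unfolding f_def[abs_def] by (rule adm_time[OF P_cont aww])
  have af': "adm (\<lambda>p. f' p b)" for b
    unfolding f'_def
    by (rule adm_add[OF adm_mult2[OF tame_time[OF P_cont] adm_add[OF adm_mult1[OF adm_w admD[OF w']] adm_mult2[OF admD[OF w'] adm_w]]]
         adm_mult2[OF tame_mult[OF tame_time[OF c2] tame_const] aww]])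
  have zero: "f (X, d) = 0" if "X \<in> half_space" for X using final[OF that] by (simp add: f_def)
  have eq: "f' p ((1 / (2 * snd p)) *\<^sub>R fst p, 1) =
      - 2 * \<alpha> * (P (snd p) / \<psi> (snd p)) * (w p)\<^sup>2 + 2 * P (snd p) * (w p * Z p)" for p
    by (simp add: f'_def w'_def Z_def inner_commute power2_eq_square algebra_simps)
  have "IX f c = P c * IX (\<lambda>p. (w p)\<^sup>2) c"
    unfolding f_def[abs_def] power2_eq_square by (rule IX_cmult_time)
  then show ?A ?B
    using integral_Z[of f f', OF D af af' zero] unfolding eq by auto
qed

text \<open>
  \<open>Sq\<close> is the symmetric part of the conjugated operator; \<open>L\<close> is y^(-a) times the extension operator.
\<close>

definition Sq where "Sq p = A p + \<alpha> / \<psi> (snd p) * w p"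
definition L where "L p = Z p + A p"

lemma adm_w_over_psi: "adm (\<lambda>p. \<alpha> / \<psi> (snd p) * w p)"
  by (rule adm_time[OF _ adm_w]) (intro continuous_intros psi_cont, use pos in force)

lemma adm_Sq: "adm Sq" unfolding Sq_def[abs_def] by (rule adm_add[OF adm_A adm_w_over_psi])
lemma adm_L: "adm L" unfolding L_def[abs_def] by (rule adm_add[OF adm_Z adm_A])

text \<open>
  Since \<psi> \<cdot> \<alpha>/\<psi> is constant in time, the terms of the mixed product that are quadratic in w form the
  exact derivative Z(P w^2) and leave no bulk term.  The gradient terms form -Z(P \<psi> |\<nabla>w|^2) up to
  P k \<theta> |\<nabla>w|^2, which is the gain.
\<close>

theorem carleman_identity:
  "IS (\<lambda>p. (P (snd p) * \<psi> (snd p)) * (L p)\<^sup>2) =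
     IS (\<lambda>p. (P (snd p) * \<psi> (snd p)) * (Z p - \<alpha> / \<psi> (snd p) * w p)\<^sup>2)
   + IS (\<lambda>p. (P (snd p) * \<psi> (snd p)) * (Sq p)\<^sup>2)
   + IS (\<lambda>p. (P (snd p) * k (snd p) * \<theta> (snd p)) * (g p \<bullet> g p))
   + P c * \<psi> c * IX (\<lambda>p. g p \<bullet> g p) c - \<alpha> * P c * IX (\<lambda>p. (w p)\<^sup>2) c
   - 2 * (LINT t:{c..d}|lborel. P t * \<psi> t * BZ t) + 2 * \<alpha> * (LINT t:{c..d}|lborel. P t * BW t)"
proof -
  have c1: "continuous_on {c..d} (\<lambda>t. P t * \<psi> t)" by (intro continuous_on_mult P_cont psi_cont)
  have c2: "continuous_on {c..d} (\<lambda>t. P t * k t * \<theta> t)" by (intro continuous_on_mult P_cont k_cont th_cont)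
  define f1 where "f1 p = (P (snd p) * \<psi> (snd p)) * (Z p - \<alpha> / \<psi> (snd p) * w p)\<^sup>2" for p
  define f2 where "f2 p = (P (snd p) * \<psi> (snd p)) * (Sq p)\<^sup>2" for p
  define f3 where "f3 p = (P (snd p) * k (snd p) * \<theta> (snd p)) * (g p \<bullet> g p)" for p
  define f4 where "f4 p = (- 2 * \<alpha> * P (snd p) + P (snd p) * k (snd p) * \<theta> (snd p)) * (g p \<bullet> g p)
        + 2 * (P (snd p) * \<psi> (snd p)) * Z' p (g p, 0)" for p
  define f5 where "f5 p = - 2 * \<alpha> * (P (snd p) / \<psi> (snd p)) * (w p)\<^sup>2 + 2 * P (snd p) * (w p * Z p)" for p
  define f6 where "f6 p = (P (snd p) * \<psi> (snd p)) * (Z p * A p + Z' p (g p, 0))" for p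
  define f7 where "f7 p = P (snd p) * (w p * A p + g p \<bullet> g p)" for p
  have a1: "adm f1" unfolding f1_def[abs_def] by (rule adm_time[OF c1 adm_square[OF adm_diff[OF adm_Z adm_w_over_psi]]])
  have a2: "adm f2" unfolding f2_def[abs_def] by (rule adm_time[OF c1 adm_square[OF adm_Sq]])
  have a3: "adm f3" unfolding f3_def[abs_def] by (rule adm_time[OF c2 adm_gg])
  have a4: "adm f4" unfolding f4_def[abs_def] by (rule IS_Z_gradient)
  have a5: "adm f5" unfolding f5_def[abs_def] by (rule IS_Z_function)
  have a6: "adm f6" unfolding f6_def[abs_def] by (rule adm_time[OF c1 adm_green_Z])
  have a7: "adm f7" unfolding f7_def[abs_def] by (rule adm_time[OF P_cont adm_green_w])
  have pt: "(P (snd p) * \<psi> (snd p)) * (L p)\<^sup>2 = (f1 p + f2 p + f3 p + (- 1) * f4 p + \<alpha> * f5 p) + 2 * f6 p + (- 2 * \<alpha>) * f7 p"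
    if p: "p \<in> S" for p
  proof -
    have "\<psi> (snd p) \<noteq> 0" using pos S_D[OF p] by force
    then have "f1 p + f2 p = P (snd p) * \<psi> (snd p) * (L p)\<^sup>2
       - 2 * (P (snd p) * \<psi> (snd p)) * Z p * A p - 2 * \<alpha> * P (snd p) * w p * Z p + 2 * \<alpha> * P (snd p) * w p * A p
       + 2 * \<alpha> * \<alpha> * (P (snd p) / \<psi> (snd p)) * (w p)\<^sup>2"
      unfolding f1_def f2_def Sq_def L_def by (simp add: field_simps power2_eq_square)
    then show ?thesis unfolding f3_def f4_def f5_def f6_def f7_def by (simp add: algebra_simps)
  qed
  have m: "adm f \<Longrightarrow> adm (\<lambda>p. r * f p)" for f and r :: real by (rule adm_mult2[OF tame_const])
  have "IS (\<lambda>p. (P (snd p) * \<psi> (snd p)) * (L p)\<^sup>2) =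
     IS (\<lambda>p. (f1 p + f2 p + f3 p + (- 1) * f4 p + \<alpha> * f5 p) + 2 * f6 p + (- 2 * \<alpha>) * f7 p)"
    by (rule IS_cong[OF pt])
  also have "\<dots> = IS f1 + IS f2 + IS f3 + (-1) * IS f4 + \<alpha> * IS f5 + 2 * IS f6 + (- 2 * \<alpha>) * IS f7"
    by (simp only: IS_add IS_cmult adm_add m a1 a2 a3 a4 a5 a6 a7)
  finally show ?thesis
    using IS_Z_gradient(1) IS_Z_function(1) IS_time_weight(1)[OF c1 adm_green_Z green_Z]
      IS_time_weight(1)[OF P_cont adm_green_w green_w]
    unfolding f1_def f2_def f3_def f4_def f5_def f6_def f7_def
    by (simp add: set_integral_uminus[unfolded set_lebesgue_integral_def] set_lebesgue_integral_def)
qed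

text \<open>
  The symmetric part tested against P k \<theta> w; the factor \<theta> is chosen so that the gradient term is the gain of
  the Carleman identity.
\<close>

theorem mass_identity:
  "\<alpha> * IS (\<lambda>p. (P (snd p) * \<theta> (snd p) / snd p) * (w p)\<^sup>2) =
     IS (\<lambda>p. (P (snd p) * k (snd p) * \<theta> (snd p)) * (g p \<bullet> g p))
   + IS (\<lambda>p. (P (snd p) * k (snd p) * \<theta> (snd p)) * (w p * Sq p))
   + (LINT t:{c..d}|lborel. P t * k t * \<theta> t * BW t)"
proof -
  have c2: "continuous_on {c..d} (\<lambda>t. P t * k t * \<theta> t)" by (intro continuous_on_mult P_cont k_cont th_cont)
  define f1 where "f1 p = (P (snd p) * k (snd p) * \<theta> (snd p)) * (g p \<bullet> g p)" for p
  define f2 where "f2 p = (P (snd p) * k (snd p) * \<theta> (snd p)) * (w p * Sq p)" for p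
  define f3 where "f3 p = (P (snd p) * k (snd p) * \<theta> (snd p)) * (w p * A p + g p \<bullet> g p)" for p
  have a1: "adm f1" unfolding f1_def[abs_def] by (rule adm_time[OF c2 adm_gg])
  have a2: "adm f2" unfolding f2_def[abs_def] by (rule adm_time[OF c2 adm_mult1[OF adm_w admD[OF adm_Sq]]])
  have a3: "adm f3" unfolding f3_def[abs_def] by (rule adm_time[OF c2 adm_green_w])
  have pt: "\<alpha> * ((P (snd p) * \<theta> (snd p) / snd p) * (w p)\<^sup>2) = f1 p + f2 p + (- 1) * f3 p" if p: "p \<in> S" for p
  proof -
    have t: "snd p \<in> {c..d}" using S_D[OF p] by simp
    have "k (snd p) * (\<alpha> / \<psi> (snd p)) = \<alpha> / snd p" using k_ge_1[OF t] by (simp add: \<psi>_def)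
    moreover have "f1 p + f2 p + (- 1) * f3 p = P (snd p) * \<theta> (snd p) * (w p)\<^sup>2 * (k (snd p) * (\<alpha> / \<psi> (snd p)))"
      unfolding f1_def f2_def f3_def Sq_def by (simp add: algebra_simps power2_eq_square)
    ultimately show ?thesis by simp
  qed
  have "\<alpha> * IS (\<lambda>p. (P (snd p) * \<theta> (snd p) / snd p) * (w p)\<^sup>2) = IS (\<lambda>p. f1 p + f2 p + (- 1) * f3 p)"
    unfolding IS_cmult[symmetric] by (rule IS_cong[OF pt])
  also have "\<dots> = IS f1 + IS f2 + (- 1) * IS f3"
    by (simp only: IS_add IS_cmult adm_add adm_mult2[OF tame_const] a1 a2 a3)
  finally show ?thesis
    using IS_time_weight(1)[OF c2 adm_green_w green_w]
    unfolding f1_def f2_def f3_def by (simp add: set_integral_uminus[unfolded set_lebesgue_integral_def] set_lebesgue_integral_def)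
qed

end

section \<open>Absorption\<close>

context weighted begin

definition \<Delta> where "\<Delta> = IS (\<lambda>p. (P (snd p) * k (snd p) * \<theta> (snd p)) * (g p \<bullet> g p))"
definition W where "W = \<alpha> * IS (\<lambda>p. (P (snd p) * \<theta> (snd p) / snd p) * (w p)\<^sup>2)"

lemma cont_Pth: "continuous_on {c..d} (\<lambda>t. P t * \<theta> t / t)"
  by (intro continuous_on_divide continuous_on_mult P_cont th_cont continuous_on_id) (use c in auto)

lemma cont_Pkth: "continuous_on {c..d} (\<lambda>t. P t * k t * \<theta> t)"
  by (intro continuous_on_mult P_cont k_cont th_cont)

lemma IS_nonneg: "adm f \<Longrightarrow> (\<And>p. p \<in> S \<Longrightarrow> 0 \<le> f p) \<Longrightarrow> 0 \<le> IS f"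
  using IS_mono[of "\<lambda>p. 0" f] IS_cmult[of 0 f] by simp

lemma Delta_nonneg: "0 \<le> \<Delta>"
  unfolding \<Delta>_def
proof (rule IS_nonneg[OF adm_time[OF cont_Pkth adm_gg]])
  fix p assume "p \<in> S"
  then have "snd p \<in> {c..d}" using S_D by blast
  then show "0 \<le> (P (snd p) * k (snd p) * \<theta> (snd p)) * (g p \<bullet> g p)"
    using P_pos[of "snd p"] k_ge_1[of "snd p"] th_nonneg[of "snd p"] by (intro mult_nonneg_nonneg inner_ge_zero) auto
qed

lemma W_nonneg: "0 \<le> W"
  unfolding W_def
proof (rule mult_nonneg_nonneg[OF _ IS_nonneg[OF adm_time[OF cont_Pth adm_ww]]])
  fix p assume "p \<in> S"
  then have "snd p \<in> {c..d}" using S_D by blast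
  then show "0 \<le> (P (snd p) * \<theta> (snd p) / snd p) * (w p)\<^sup>2"
    using P_pos[of "snd p"] pos(1)[of "snd p"] th_nonneg[of "snd p"] by (intro mult_nonneg_nonneg divide_nonneg_nonneg) auto
qed (use alpha in simp)

text \<open>
  Half of the mass identity is added to the Carleman identity.  The product w Sq is split by Young's
  inequality; its w^2 part carries k \<theta>^2/(2t), at most a quarter of \<alpha> \<theta>/t.
\<close>

theorem weighted_absorption:
  assumes small: "\<And>t. t \<in> {c..d} \<Longrightarrow> 2 * k t * \<theta> t \<le> \<alpha>"
    and B1: "- (\<Delta> + W) / 16 - P c * \<psi> c * IX (\<lambda>p. g p \<bullet> g p) c / 2 - \<alpha> * P c * IX (\<lambda>p. (w p)\<^sup>2) c
      \<le> - 2 * (LINT t:{c..d}|lborel. P t * \<psi> t * BZ t) + 2 * \<alpha> * (LINT t:{c..d}|lborel. P t * BW t)"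
    and B2: "(LINT t:{c..d}|lborel. P t * k t * \<theta> t * BW t) \<le> (\<Delta> + W) / 16"
  shows "\<Delta> + W + 2 * P c * \<psi> c * IX (\<lambda>p. g p \<bullet> g p) c
    \<le> 4 * IS (\<lambda>p. (P (snd p) * \<psi> (snd p)) * (L p)\<^sup>2) + 8 * \<alpha> * P c * IX (\<lambda>p. (w p)\<^sup>2) c"
proof -
  have c1: "continuous_on {c..d} (\<lambda>t. P t * \<psi> t)" by (intro continuous_on_mult P_cont psi_cont)
  define Q where "Q = IS (\<lambda>p. (P (snd p) * \<psi> (snd p)) * (Sq p)\<^sup>2)"
  have aQ: "adm (\<lambda>p. (P (snd p) * \<psi> (snd p)) * (Sq p)\<^sup>2)" by (rule adm_time[OF c1 adm_square[OF adm_Sq]])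
  have aW: "adm (\<lambda>p. (P (snd p) * \<theta> (snd p) / snd p) * (w p)\<^sup>2)" by (rule adm_time[OF cont_Pth adm_ww])
  have m: "adm f \<Longrightarrow> adm (\<lambda>p. r * f p)" for f and r :: real by (rule adm_mult2[OF tame_const])
  have T: "snd p \<in> {c..d}" "0 < snd p" "0 < P (snd p)" "0 < \<psi> (snd p)" "0 \<le> \<theta> (snd p)" "1 \<le> k (snd p)" if "p \<in> S" for p
    using S_D[OF that] P_pos pos th_nonneg k_ge_1 by auto
  have "0 \<le> Q" unfolding Q_def by (rule IS_nonneg[OF aQ]) (use T in \<open>simp add: less_imp_le\<close>)
  moreover have "0 \<le> IS (\<lambda>p. (P (snd p) * \<psi> (snd p)) * (Z p - \<alpha> / \<psi> (snd p) * w p)\<^sup>2)"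
    by (rule IS_nonneg[OF adm_time[OF c1 adm_square[OF adm_diff[OF adm_Z adm_w_over_psi]]]]) (use T in \<open>simp add: less_imp_le\<close>)
  moreover note Delta_nonneg W_nonneg
  moreover have "IS (\<lambda>p. (P (snd p) * k (snd p) * \<theta> (snd p)) * (w p * Sq p)) \<le> Q / 2 + W / 4"
  proof -
    have "IS (\<lambda>p. (P (snd p) * k (snd p) * \<theta> (snd p)) * (w p * Sq p))
      \<le> IS (\<lambda>p. 1/2 * ((P (snd p) * \<psi> (snd p)) * (Sq p)\<^sup>2) + (\<alpha> / 4) * ((P (snd p) * \<theta> (snd p) / snd p) * (w p)\<^sup>2))"
    proof (rule IS_mono)
      fix p assume p: "p \<in> S"
      define t where "t = snd p"
      have t: "t \<in> {c..d}" "0 < t" "0 < P t" "0 < \<psi> t" "0 \<le> \<theta> t" "1 \<le> k t" using T[OF p] by (auto simp: t_def)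
      have "k t * \<theta> t * w p * Sq p \<le> \<psi> t * (Sq p)\<^sup>2 / 2 + (k t * \<theta> t)\<^sup>2 / (2 * \<psi> t) * (w p)\<^sup>2"
      proof -
        have "0 \<le> (\<psi> t * Sq p - k t * \<theta> t * w p)\<^sup>2 / (2 * \<psi> t)" using t by simp
        also have "\<dots> = \<psi> t * (Sq p)\<^sup>2 / 2 + (k t * \<theta> t)\<^sup>2 / (2 * \<psi> t) * (w p)\<^sup>2 - k t * \<theta> t * w p * Sq p"
          using t by (simp add: power2_eq_square field_simps)
        finally show ?thesis by simp
      qed
      also have "(k t * \<theta> t)\<^sup>2 / (2 * \<psi> t) * (w p)\<^sup>2 \<le> (\<alpha> / 4) * (\<theta> t / t) * (w p)\<^sup>2"
      proof (rule mult_right_mono)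
        have "(k t * \<theta> t)\<^sup>2 / (2 * \<psi> t) = (2 * k t * \<theta> t) * (\<theta> t / (4 * t))"
          using t by (simp add: \<psi>_def power2_eq_square field_simps)
        also have "\<dots> \<le> \<alpha> * (\<theta> t / (4 * t))" using small[OF t(1)] t by (intro mult_right_mono) auto
        finally show "(k t * \<theta> t)\<^sup>2 / (2 * \<psi> t) \<le> (\<alpha> / 4) * (\<theta> t / t)" by simp
      qed simp
      finally have "P t * (k t * \<theta> t * w p * Sq p) \<le> P t * (\<psi> t * (Sq p)\<^sup>2 / 2 + (\<alpha> / 4) * (\<theta> t / t) * (w p)\<^sup>2)"
        using t by (intro mult_left_mono) auto
      then show "(P (snd p) * k (snd p) * \<theta> (snd p)) * (w p * Sq p) \<le>
         1/2 * ((P (snd p) * \<psi> (snd p)) * (Sq p)\<^sup>2) + (\<alpha> / 4) * ((P (snd p) * \<theta> (snd p) / snd p) * (w p)\<^sup>2)"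
        by (simp add: t_def algebra_simps)
    qed (rule adm_time[OF cont_Pkth adm_mult1[OF adm_w admD[OF adm_Sq]]], rule adm_add[OF m[OF aQ] m[OF aW]])
    also have "\<dots> = Q / 2 + W / 4"
      unfolding IS_add[OF m[OF aQ] m[OF aW]] IS_cmult Q_def W_def by simp
    finally show ?thesis .
  qed
  moreover note B1 B2 mass_identity[folded \<Delta>_def W_def] carleman_identity[folded \<Delta>_def W_def Q_def]
  moreover have "De + w + 2 * (p * s * D) \<le> 4 * E + 8 * (al * p * H)"
    if "0 \<le> q" "0 \<le> z" "0 \<le> De" "0 \<le> w" "i \<le> q / 2 + w / 4"
      "- (De + w) / 16 - p * s * D / 2 - al * p * H \<le> - 2 * l + 2 * al * n" "j \<le> (De + w) / 16"
      "w = De + i + j" "E = z + q + De + p * s * D - al * p * H - 2 * l + 2 * al * n"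
    for q z De w i p s D al H l n j E :: real
    using that by argo
  ultimately have "\<Delta> + W + 2 * (P c * \<psi> c * IX (\<lambda>p. g p \<bullet> g p) c)
    \<le> 4 * IS (\<lambda>p. (P (snd p) * \<psi> (snd p)) * (L p)\<^sup>2) + 8 * (\<alpha> * P c * IX (\<lambda>p. (w p)\<^sup>2) c)"
    by blast
  then show ?thesis by (simp only: mult.assoc)
qed

end

section \<open>Trace and Hardy inequalities\<close>

text \<open>
  Integrating \<partial>_y (w^2 G) over y > 0 expresses the boundary integral through 2 w \<partial>_y w and (y/2t) w^2; the
  latter is bounded by Young's inequality and by Hardy's inequality for y^2 w^2, which comes from the
  field (0, y w^2).
\<close>

lemma (in jet) trace_inequality:
  assumes a0: "a = 0" and t: "t \<in> {c..d}" and e: "0 < \<eta>"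
  shows "(LINT x|lborel. (w0 x t)\<^sup>2 * G_kernel a (x, 0) t)
    \<le> 2 * \<eta> * IX (\<lambda>p. g p \<bullet> g p) t + (2 / \<eta> + \<eta> / (4 * t)) * IX (\<lambda>p. (w p)\<^sup>2) t"
proof -
  have t0: "0 < t" using t c by auto
  define y where "y p = snd (fst p)" for p :: "'n pt \<times> real"
  define w' where "w' p h = g p \<bullet> fst h + wt p * snd h" for p h
  have W: "((\<lambda>p. w p * w p) has_derivative (\<lambda>h. w p * w' p h + w' p h * w p)) (at p)" if "p \<in> S" for p
    using has_derivative_mult[OF w_der[OF that] w_der[OF that]] by (simp add: w'_def)
  have w': "adm (\<lambda>p. w' p (b, 0))" for b
    using adm_inner1[OF adm_g tame_const[of b]] by (simp add: w'_def)
  have ww: "adm (\<lambda>p. w p * w p)" by (rule adm_mult1[OF adm_w admD[OF adm_w]])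
  have dww: "adm (\<lambda>p. w p * w' p (b, 0) + w' p (b, 0) * w p)" for b
    by (rule adm_add[OF adm_mult1[OF adm_w admD[OF w']] adm_mult1[OF w' admD[OF adm_w]]])
  have eY: "(0, 1) \<in> (Basis :: 'n pt set)" by (simp add: Basis_prod_def)
  have sumY: "(\<Sum>b\<in>Basis. (0::real^'n, f b) \<bullet> b) = f (0, 1)" for f :: "'n pt \<Rightarrow> real"
  proof -
    have "(\<Sum>b\<in>Basis. (0::real^'n, f b) \<bullet> b) = (0::real^'n, f (0,1)) \<bullet> (0, 1) + (\<Sum>b\<in>Basis - {(0,1)}. (0::real^'n, f b) \<bullet> b)"
      by (rule sum.remove[OF finite_Basis eY])
    also have "(\<Sum>b\<in>Basis - {(0,1)}. (0::real^'n, f b) \<bullet> b) = 0"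
      by (rule sum.neutral) (auto simp: Basis_prod_def)
    finally show ?thesis by simp
  qed
  have admY: "adm (\<lambda>p. (0::real^'n, f p))" if "adm f" for f :: "'n pt \<times> real \<Rightarrow> real"
    using tame_Pair[OF tame_const admD[OF that], of 0] that by (simp add: adm_def zero_prod_def)
  have gy: "adm (\<lambda>p. snd (g p))"
    using adm_inner1[OF adm_g tame_const[of "(0,1)"]] by (simp add: inner_prod_def)
  have wy: "w' p ((0, 1), 0) = snd (g p)" for p by (simp add: w'_def inner_prod_def)
  have T: "IX (\<lambda>p. 2 * w p * snd (g p) - y p / (2 * snd p) * (w p)\<^sup>2) t = - (LINT x|lborel. (w0 x t)\<^sup>2 * G_kernel a (x, 0) t)"
  proof -
    define F :: "'n pt \<times> real \<Rightarrow> 'n pt" where "F p = (0, w p * w p)" for p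
    define F' :: "'n pt \<times> real \<Rightarrow> 'n pt \<times> real \<Rightarrow> 'n pt" where "F' p h = (0, w p * w' p h + w' p h * w p)" for p h
    have "IX (\<lambda>p. (\<Sum>b\<in>Basis. F' p (b, 0) \<bullet> b) + a * snd (F p) / snd (fst p) - (fst p \<bullet> F p) / (2 * snd p)) t
       = - (LINT x|lborel. (w0 x t)\<^sup>2 * G_kernel a (x, 0) t)"
    proof (rule weighted_divergence[OF t])
      show "(F has_derivative F' p) (at p)" if "p \<in> S" for p
        unfolding F_def[abs_def] F'_def[abs_def] by (rule has_derivative_Pair[OF has_derivative_const W[OF that]])
      show "adm F" unfolding F_def[abs_def] by (rule admY[OF ww])
      show "adm (\<lambda>p. F' p (b, 0))" for b unfolding F'_def by (rule admY[OF dww])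
      show "adm (\<lambda>p. a * snd (F p) / snd (fst p))" by (simp add: a0)
      show "((\<lambda>y. y powr a * snd (F ((x, y), t))) \<longlongrightarrow> (w0 x t)\<^sup>2) (at_right 0)" for x
      proof (rule Lim_transform_eventually)
        show "((\<lambda>y. (w ((x, y), t))\<^sup>2) \<longlongrightarrow> (w0 x t)\<^sup>2) (at_right 0)" by (rule tendsto_power[OF w_lim[OF t]])
        show "\<forall>\<^sub>F y in at_right 0. (w ((x, y), t))\<^sup>2 = y powr a * snd (F ((x, y), t))"
          by (auto simp: eventually_at_filter a0 F_def power2_eq_square)
      qed
    qed
    moreover have "(\<Sum>b\<in>Basis. F' p (b, 0) \<bullet> b) + a * snd (F p) / snd (fst p) - (fst p \<bullet> F p) / (2 * snd p)
        = 2 * w p * snd (g p) - y p / (2 * snd p) * (w p)\<^sup>2" for p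
      unfolding F'_def sumY wy by (simp add: a0 F_def y_def inner_prod_def power2_eq_square)
    ultimately show ?thesis by simp
  qed
  \<comment> \<open>The field (0, y w^2) has no flux at y = 0, so its weighted divergence integrates to zero.\<close>
  have Hd: "IX (\<lambda>p. (w p)\<^sup>2 + 2 * y p * w p * snd (g p) - (y p)\<^sup>2 / (2 * snd p) * (w p)\<^sup>2) t = 0"
  proof -
    define F :: "'n pt \<times> real \<Rightarrow> 'n pt" where "F p = (0, snd (fst p) * (w p * w p))" for p
    define F' :: "'n pt \<times> real \<Rightarrow> 'n pt \<times> real \<Rightarrow> 'n pt"
      where "F' p h = (0, snd (fst p) * (w p * w' p h + w' p h * w p) + snd (fst h) * (w p * w p))" for p h
    have "IX (\<lambda>p. (\<Sum>b\<in>Basis. F' p (b, 0) \<bullet> b) + a * snd (F p) / snd (fst p) - (fst p \<bullet> F p) / (2 * snd p)) t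
       = - (LINT x|lborel. 0 * G_kernel a (x::real^'n, 0) t)"
    proof (rule weighted_divergence[OF t])
      show "(F has_derivative F' p) (at p)" if "p \<in> S" for p
        unfolding F_def[abs_def] F'_def[abs_def]
        by (rule has_derivative_Pair[OF has_derivative_const
          has_derivative_mult[OF has_derivative_snd[OF has_derivative_fst[OF has_derivative_ident]] W[OF that]]])
      show "adm F" unfolding F_def[abs_def] by (rule admY[OF adm_mult2[OF tame_y ww]])
      show "adm (\<lambda>p. F' p (b, 0))" for b unfolding F'_def
        by (rule admY[OF adm_add[OF adm_mult2[OF tame_y dww] adm_mult2[OF tame_const ww]]])
      show "adm (\<lambda>p. a * snd (F p) / snd (fst p))" by (simp add: a0)
      show "((\<lambda>y. y powr a * snd (F ((x, y), t))) \<longlongrightarrow> 0) (at_right 0)" for x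
      proof (rule Lim_transform_eventually)
        have "((\<lambda>y. y * (w ((x, y), t))\<^sup>2) \<longlongrightarrow> 0 * (w0 x t)\<^sup>2) (at_right 0)"
          by (rule tendsto_mult[OF tendsto_ident_at tendsto_power[OF w_lim[OF t]]])
        then show "((\<lambda>y. y * (w ((x, y), t))\<^sup>2) \<longlongrightarrow> 0) (at_right 0)" by simp
        show "\<forall>\<^sub>F y in at_right 0. y * (w ((x, y), t))\<^sup>2 = y powr a * snd (F ((x, y), t))"
          by (auto simp: eventually_at_filter a0 F_def power2_eq_square)
      qed
    qed
    moreover have "(\<Sum>b\<in>Basis. F' p (b, 0) \<bullet> b) + a * snd (F p) / snd (fst p) - (fst p \<bullet> F p) / (2 * snd p)
        = (w p)\<^sup>2 + 2 * y p * w p * snd (g p) - (y p)\<^sup>2 / (2 * snd p) * (w p)\<^sup>2" for p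
      unfolding F'_def sumY wy by (simp add: a0 F_def y_def inner_prod_def power2_eq_square algebra_simps)
    ultimately show ?thesis by simp
  qed
  have m: "adm f \<Longrightarrow> adm (\<lambda>p. r * f p)" for f and r :: real by (rule adm_mult2[OF tame_const])
  have cm: "IX (\<lambda>p. r * f p) t = r * IX f t" for r f using IX_cmult_time[of "\<lambda>_. r" f t] by simp
  have gg: "(snd (g p))\<^sup>2 \<le> g p \<bullet> g p" for p by (simp add: inner_prod_def power2_eq_square)
  have ay: "tame y" unfolding y_def[abs_def] by (rule tame_y)
  define Y where "Y p = (y p)\<^sup>2 * (w p)\<^sup>2" for p
  have aY: "adm Y" unfolding Y_def[abs_def] by (rule adm_mult2[OF tame_square[OF ay] adm_ww])
  have a1: "adm (\<lambda>p. 2 * w p * snd (g p))" by (rule adm_mult2[OF tame_mult[OF tame_const admD[OF adm_w]] gy])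
  have a2: "adm (\<lambda>p. y p / (2 * snd p) * (w p)\<^sup>2)" by (rule adm_mult2[OF tame_div_2t[OF ay] adm_ww])
  have a3: "adm (\<lambda>p. 2 * y p * w p * snd (g p))"
    by (rule adm_mult2[OF tame_mult[OF tame_mult[OF tame_const ay] admD[OF adm_w]] gy])
  have a4: "adm (\<lambda>p. (y p)\<^sup>2 / (2 * snd p) * (w p)\<^sup>2)" by (rule adm_mult2[OF tame_div_2t[OF tame_square[OF ay]] adm_ww])
  have hardy: "IX Y t \<le> 4 * t * (IX (\<lambda>p. (w p)\<^sup>2) t + 4 * t * IX (\<lambda>p. g p \<bullet> g p) t)"
  proof -
    have "0 \<le> IX (\<lambda>p. (w p)\<^sup>2 + (4 * t) * (g p \<bullet> g p) + (- 1 / (4 * t)) * Y p) t"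
      unfolding Hd[symmetric]
    proof (rule IX_mono[OF adm_diff[OF adm_add[OF adm_ww a3] a4] adm_add[OF adm_add[OF adm_ww m[OF adm_gg]] m[OF aY]] t])
      fix X :: "'n pt"
      let ?p = "(X, t)"
      \<comment> \<open>Young's inequality for 2 y w \<partial>_y w with the factors y/(2 sqrt t) and 2 sqrt t.\<close>
      have "0 \<le> (y ?p * w ?p - 4 * t * snd (g ?p))\<^sup>2 / (4 * t)" using t0 by simp
      also have "\<dots> = Y ?p / (4 * t) - 2 * y ?p * w ?p * snd (g ?p) + 4 * t * (snd (g ?p))\<^sup>2"
        using t0 by (simp add: Y_def power2_eq_square field_simps)
      also have "\<dots> \<le> Y ?p / (4 * t) - 2 * y ?p * w ?p * snd (g ?p) + 4 * t * (g ?p \<bullet> g ?p)"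
        using gg[of ?p] t0 by simp
      finally have "0 \<le> Y ?p / (4 * t) - 2 * y ?p * w ?p * snd (g ?p) + 4 * t * (g ?p \<bullet> g ?p)" .
      moreover have "(y ?p)\<^sup>2 / (2 * snd ?p) * (w ?p)\<^sup>2 = 2 * (Y ?p / (4 * t))" using t0 by (simp add: Y_def)
      moreover have "(- 1 / (4 * t)) * Y ?p = - (Y ?p / (4 * t))" by simp
      ultimately show "(w ?p)\<^sup>2 + 2 * y ?p * w ?p * snd (g ?p) - (y ?p)\<^sup>2 / (2 * snd ?p) * (w ?p)\<^sup>2
         \<le> (w ?p)\<^sup>2 + (4 * t) * (g ?p \<bullet> g ?p) + (- 1 / (4 * t)) * Y ?p"
        by linarith
    qed
    also have "\<dots> = IX (\<lambda>p. (w p)\<^sup>2) t + 4 * t * IX (\<lambda>p. g p \<bullet> g p) t + (- 1 / (4 * t)) * IX Y t"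
      by (simp only: IX_add[OF adm_add[OF adm_ww m[OF adm_gg]] m[OF aY] t] IX_add[OF adm_ww m[OF adm_gg] t] cm)
    finally show ?thesis using t0 by (simp add: field_simps)
  qed
  have "(LINT x|lborel. (w0 x t)\<^sup>2 * G_kernel a (x, 0) t) = IX (\<lambda>p. (-1) * (2 * w p * snd (g p) - y p / (2 * snd p) * (w p)\<^sup>2)) t"
    unfolding cm T by simp
  also have "\<dots> \<le> IX (\<lambda>p. \<eta> * (g p \<bullet> g p) + (2 / \<eta>) * (w p)\<^sup>2 + (\<eta> / (16 * t\<^sup>2)) * Y p) t"
  proof (rule IX_mono[OF m[OF adm_diff[OF a1 a2]] adm_add[OF adm_add[OF m[OF adm_gg] m[OF adm_ww]] m[OF aY]] t])
    fix X :: "'n pt"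
    let ?p = "(X, t)"
    have "0 \<le> (\<eta> * snd (g ?p) + w ?p)\<^sup>2 / \<eta>" using e by simp
    also have "\<dots> = \<eta> * (snd (g ?p))\<^sup>2 + 2 * w ?p * snd (g ?p) + (w ?p)\<^sup>2 / \<eta>"
      using e by (simp add: power2_eq_square field_simps)
    also have "\<dots> \<le> \<eta> * (g ?p \<bullet> g ?p) + 2 * w ?p * snd (g ?p) + (w ?p)\<^sup>2 / \<eta>" using gg[of ?p] e by simp
    finally have 1: "- (2 * w ?p * snd (g ?p)) \<le> \<eta> * (g ?p \<bullet> g ?p) + (w ?p)\<^sup>2 / \<eta>" by simp
    \<comment> \<open>The same for (y/2t) w^2, so that Hardy's inequality can be applied to the part with y^2.\<close>
    have "0 \<le> (\<eta> * y ?p / (4 * t) - 1)\<^sup>2 / \<eta> * (w ?p)\<^sup>2" using e by simp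
    also have "\<dots> = (\<eta> / (16 * t\<^sup>2)) * Y ?p + (w ?p)\<^sup>2 / \<eta> - y ?p / (2 * t) * (w ?p)\<^sup>2"
      using e t0 by (simp add: Y_def power2_eq_square field_simps)
    finally show "(-1) * (2 * w ?p * snd (g ?p) - y ?p / (2 * snd ?p) * (w ?p)\<^sup>2)
      \<le> \<eta> * (g ?p \<bullet> g ?p) + (2 / \<eta>) * (w ?p)\<^sup>2 + (\<eta> / (16 * t\<^sup>2)) * Y ?p" using 1 by simp
  qed
  also have "\<dots> = \<eta> * IX (\<lambda>p. g p \<bullet> g p) t + (2 / \<eta>) * IX (\<lambda>p. (w p)\<^sup>2) t + (\<eta> / (16 * t\<^sup>2)) * IX Y t"
    by (simp only: IX_add[OF adm_add[OF m[OF adm_gg] m[OF adm_ww]] m[OF aY] t] IX_add[OF m[OF adm_gg] m[OF adm_ww] t] cm)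
  also have "(\<eta> / (16 * t\<^sup>2)) * IX Y t \<le> (\<eta> / (16 * t\<^sup>2)) * (4 * t * (IX (\<lambda>p. (w p)\<^sup>2) t + 4 * t * IX (\<lambda>p. g p \<bullet> g p) t))"
    using e by (intro mult_left_mono hardy) auto
  also have "\<dots> = \<eta> / (4 * t) * IX (\<lambda>p. (w p)\<^sup>2) t + \<eta> * IX (\<lambda>p. g p \<bullet> g p) t"
    using t0 by (simp add: power2_eq_square field_simps)
  finally show ?thesis by (simp add: algebra_simps)
qed

section \<open>Integration by parts along the boundary\<close>

context slab begin

definition U :: "((real^'n) \<times> real) set" where "U = UNIV \<times> {c..d}"

definition edge :: "((real^'n) \<times> real \<Rightarrow> real) \<Rightarrow> bool" where
  "edge f \<longleftrightarrow> continuous_on U f \<and> (\<forall>x. \<forall>t\<in>{c..d}. 4 \<le> norm x \<longrightarrow> f (x, t) = 0)"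

lemma edge_add: "edge f \<Longrightarrow> edge g \<Longrightarrow> edge (\<lambda>p. f p + g p)"
  unfolding edge_def by (auto intro: continuous_on_add)
lemma edge_mult1: "edge f \<Longrightarrow> continuous_on U g \<Longrightarrow> edge (\<lambda>p. f p * g p)"
  unfolding edge_def by (auto intro: continuous_on_mult)
lemma edge_mult2: "continuous_on U f \<Longrightarrow> edge g \<Longrightarrow> edge (\<lambda>p. f p * g p)"
  unfolding edge_def by (auto intro: continuous_on_mult)
lemma edge_sum: "(\<And>i. i \<in> I \<Longrightarrow> edge (f i)) \<Longrightarrow> edge (\<lambda>p. \<Sum>i\<in>I. f i p)"
  unfolding edge_def by (auto intro: continuous_on_sum)
lemma edgeD: "edge f \<Longrightarrow> continuous_on U f" by (simp add: edge_def)

lemma edge_integrable: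
  assumes "edge f" shows "set_integrable lborel U f"
proof -
  have "compact (cball 0 4 \<times> {c..d} :: ((real^'n) \<times> real) set)" by (intro compact_Times) auto
  moreover have "continuous_on (cball 0 4 \<times> {c..d}) f"
    using edgeD[OF assms] by (rule continuous_on_subset) (auto simp: U_def)
  ultimately have "set_integrable lborel (cball 0 4 \<times> {c..d}) f"
    unfolding set_integrable_def by (rule borel_integrable_compact)
  moreover have "(\<lambda>p. indicator (cball 0 4 \<times> {c..d}) p *\<^sub>R f p) = (\<lambda>p. indicator U p *\<^sub>R f p)"
    using assms by (auto simp: edge_def U_def indicator_def fun_eq_iff)
  ultimately show ?thesis unfolding set_integrable_def by simp
qed

lemma edge_slice_continuous:
  assumes "edge f" "t \<in> {c..d}" shows "continuous_on UNIV (\<lambda>x. f (x, t))"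
  using edgeD[OF assms(1)] by (rule continuous_on_compose2) (use assms(2) in \<open>auto simp: U_def intro!: continuous_intros\<close>)

lemma edge_slice_integrable:
  assumes "edge f" "t \<in> {c..d}" shows "integrable lborel (\<lambda>x. f (x, t))"
proof -
  have "set_integrable lborel (cball 0 4) (\<lambda>x. f (x, t))"
    unfolding set_integrable_def
    by (rule borel_integrable_compact) (auto intro: continuous_on_subset[OF edge_slice_continuous[OF assms]])
  moreover have "(\<lambda>x. indicator (cball 0 4) x *\<^sub>R f (x, t)) = (\<lambda>x. f (x, t))"
    using assms by (auto simp: edge_def indicator_def fun_eq_iff)
  ultimately show ?thesis unfolding set_integrable_def by simp
qed

lemma edge_slices:
  assumes "edge f"
  shows "(LINT p:U|lborel. f p) = (LINT t:{c..d}|lborel. LINT x|lborel. f (x, t))"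
    and "set_integrable lborel {c..d} (\<lambda>t. LINT x|lborel. f (x, t))"
  using integral_slices[OF edge_integrable[OF assms, unfolded U_def]]
  by (simp_all add: U_def set_lebesgue_integral_def)

lemma U_time: "continuous_on {c..d} h \<Longrightarrow> continuous_on U (\<lambda>p. h (snd p))"
  by (erule continuous_on_compose2) (auto simp: U_def intro!: continuous_intros)

lemma U_kernel: "continuous_on U (\<lambda>p. G_kernel a (fst p, 0) (snd p))"
  unfolding G_kernel_def U_def by (intro continuous_intros ballI) (use c in auto)

text \<open>
  The analogue of \<open>integral_Z\<close> on y = 0.  The kernel G restricted to the boundary is t^(-1/2) times the heat
  kernel of one dimension less, and differentiating t^(-1/2) produces the additional term f/(2t).
\<close>

lemma edge_integral_Z:
  assumes a0: "a = 0"
    and der: "\<And>p. p \<in> U \<Longrightarrow> (f has_derivative f' p) (at p)"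
    and f: "edge f" and f': "\<And>b. b \<in> Basis \<Longrightarrow> edge (\<lambda>p. f' p b)" and zero: "\<And>x. f (x, d) = 0"
  shows "(LINT t:{c..d}|lborel. LINT x|lborel. f' (x, t) ((1 / (2 * t)) *\<^sub>R x, 1) * G_kernel a (x, 0) t)
    = (LINT t:{c..d}|lborel. LINT x|lborel. f (x, t) / (2 * t) * G_kernel a (x, 0) t)
      - (LINT x|lborel. f (x, c) * G_kernel a (x, 0) c)"
    and "edge (\<lambda>p. f' p ((1 / (2 * snd p)) *\<^sub>R fst p, 1))"
proof -
  have lin: "linear (f' p)" if "p \<in> U" for p using has_derivative_linear[OF der[OF that]] .
  define g0 where "g0 p = G_kernel a (fst p, 0) (snd p)" for p :: "(real^'n) \<times> real"
  define m where "m p = (norm (fst p))\<^sup>2 / (4 * (snd p)\<^sup>2) - (real CARD('n) + 1) / (2 * snd p)" for p :: "(real^'n) \<times> real"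
  have tpos: "0 < snd p" if "p \<in> U" for p using that c by (auto simp: U_def)
  have g0: "continuous_on U g0" unfolding g0_def[abs_def] by (rule U_kernel)
  have inv: "continuous_on U (\<lambda>p. 1 / (2 * snd p))"
    by (intro continuous_intros) (use tpos in force)
  have m: "continuous_on U m"
    unfolding m_def[abs_def] by (intro continuous_intros) (use tpos in force)+
  have cm: "continuous_on U (\<lambda>p. m p + 1 / (2 * snd p))" by (rule continuous_on_add[OF m inv])
  have t01: "(0, 1) \<in> (Basis :: ((real^'n) \<times> real) set)" by (simp add: Basis_prod_def)
  have bX: "(b, 0) \<in> (Basis :: ((real^'n) \<times> real) set)" if "b \<in> Basis" for b
    using that unfolding Basis_prod_def by (rule UnI1[OF imageI])
  have expand: "f' p ((1 / (2 * snd p)) *\<^sub>R fst p, 0) = (\<Sum>b\<in>Basis. f' p (b, 0) * (fst p \<bullet> b) * (1 / (2 * snd p)))" if "p \<in> U" for p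
    unfolding linear_expand_fst[OF lin[OF that], of "(1 / (2 * snd p)) *\<^sub>R fst p"] by (simp add: mult_ac)
  \<comment> \<open>D b is the derivative in direction b of the component along b of the field G f x/(2t).\<close>
  define D where "D b p = (f' p (b, 0) * ((fst p \<bullet> b) * (1 / (2 * snd p))) + f p * (1 / (2 * snd p) - ((fst p \<bullet> b) * (1 / (2 * snd p)))\<^sup>2)) * g0 p" for b p
  have D: "edge (D b)" if "b \<in> Basis" for b
    unfolding D_def[abs_def]
    by (rule edge_mult1[OF edge_add[OF edge_mult1[OF f'[OF bX[OF that]]] edge_mult1[OF f]] g0])
       (intro continuous_on_mult continuous_on_diff continuous_on_power continuous_on_inner continuous_on_fst continuous_on_id continuous_on_const inv)+
  define E' where "E' p = (f' p (0,1) + f p * m p) * g0 p" for p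
  have E': "edge E'" unfolding E'_def[abs_def] by (rule edge_mult1[OF edge_add[OF f'[OF t01] edge_mult1[OF f m]] g0])
  define F where "F p = f p * (1 / (2 * snd p)) * g0 p" for p
  have F: "edge F" unfolding F_def[abs_def] by (rule edge_mult1[OF edge_mult1[OF f inv] g0])
  have sD: "edge (\<lambda>p. \<Sum>b\<in>Basis. D b p)" by (rule edge_sum[OF D])
  have split: "f' p ((1 / (2 * snd p)) *\<^sub>R fst p, 1) = f' p (0, 1) + (\<Sum>b\<in>Basis. f' p (b, 0) * (fst p \<bullet> b) * (1 / (2 * snd p)))"
    if "p \<in> U" for p
    using linear_add[OF lin[OF that], of "(0,1)" "((1 / (2 * snd p)) *\<^sub>R fst p, 0)"] expand[OF that] by simp
  have pt: "f' p ((1 / (2 * snd p)) *\<^sub>R fst p, 1) * g0 p = E' p + (\<Sum>b\<in>Basis. D b p) + F p" if p: "p \<in> U" for p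
  proof -
    have "(\<Sum>b\<in>(Basis::(real^'n) set). ((fst p \<bullet> b) * (1 / (2 * snd p)))\<^sup>2) = (norm (fst p))\<^sup>2 / (4 * (snd p)\<^sup>2)"
    proof -
      have "(\<Sum>b\<in>(Basis::(real^'n) set). ((fst p \<bullet> b) * (1 / (2 * snd p)))\<^sup>2) = (\<Sum>b\<in>Basis. (fst p \<bullet> b) * (fst p \<bullet> b)) * (1 / (2 * snd p))\<^sup>2"
        unfolding sum_distrib_right by (rule sum.cong) (simp_all add: power2_eq_square)
      also have "\<dots> = (norm (fst p))\<^sup>2 * (1 / (2 * snd p))\<^sup>2"
        using euclidean_inner[of "fst p" "fst p"] by (simp add: dot_square_norm)
      finally show ?thesis by (simp add: power_mult_distrib power_divide)
    qed
    then have "(\<Sum>b\<in>(Basis::(real^'n) set). 1 / (2 * snd p) - ((fst p \<bullet> b) * (1 / (2 * snd p)))\<^sup>2) = - (m p + 1 / (2 * snd p))"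
      unfolding sum_subtractf by (simp add: m_def add_divide_distrib)
    then have fB: "f p * (\<Sum>b\<in>(Basis::(real^'n) set). 1 / (2 * snd p) - ((fst p \<bullet> b) * (1 / (2 * snd p)))\<^sup>2) = - f p * (m p + 1 / (2 * snd p))"
      by (simp only: mult_minus_left mult_minus_right)
    have "(\<Sum>b\<in>Basis. D b p) = ((\<Sum>b\<in>Basis. f' p (b, 0) * (fst p \<bullet> b) * (1 / (2 * snd p)))
        + f p * (\<Sum>b\<in>(Basis::(real^'n) set). 1 / (2 * snd p) - ((fst p \<bullet> b) * (1 / (2 * snd p)))\<^sup>2)) * g0 p"
      unfolding D_def by (simp only: sum_distrib_right sum_distrib_left sum.distrib[symmetric] mult.assoc)
    then show ?thesis unfolding fB split[OF p] E'_def F_def by (simp add: algebra_simps)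
  qed
  have cong: "edge h1" if "\<And>p. p \<in> U \<Longrightarrow> h1 p = h2 p" "edge h2" for h1 h2
  proof -
    have "continuous_on U h1 = continuous_on U h2" by (rule continuous_on_cong) (use that in auto)
    then show ?thesis using that by (auto simp: edge_def U_def)
  qed
  show 2: "edge (\<lambda>p. f' p ((1 / (2 * snd p)) *\<^sub>R fst p, 1))"
    by (rule cong[OF split edge_add[OF f'[OF t01] edge_sum[OF edge_mult1[OF edge_mult1[OF f'[OF bX]] inv]]]])
       (auto intro!: continuous_intros)
  have I1: "(LINT p:U|lborel. E' p) = - (LINT x|lborel. f (x, c) * g0 (x, c))"
  proof -
    have "(LINT p:UNIV \<times> {c..d}|lborel. E' p) = - (LINT x:UNIV|lborel. f (x, c) * g0 (x, c))"
    proof (rule integral_time_derivative[OF cd, where F = "\<lambda>p. f p * g0 p"])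
      show "((\<lambda>t. f (x, t) * g0 (x, t)) has_real_derivative E' (x, t)) (at t)" if t: "t \<in> {c..d}" for x t
      proof -
        have p: "(x, t) \<in> U" using t by (simp add: U_def)
        have "((\<lambda>t. f (x, t)) has_derivative (\<lambda>h. f' (x, t) (0, h))) (at t)"
          using has_derivative_compose[OF has_derivative_Pair[OF has_derivative_const has_derivative_ident],
            of f "f' (x, t)" x t UNIV] der[OF p] by simp
        moreover have "(\<lambda>h. f' (x, t) (0, h)) = (*) (f' (x, t) (0, 1))"
        proof
          show "f' (x, t) (0, h) = f' (x, t) (0, 1) * h" for h
            using linear_scale[OF lin[OF p], of h "(0,1)"] by simp
        qed
        ultimately have 1: "((\<lambda>t. f (x, t)) has_real_derivative f' (x, t) (0, 1)) (at t)"
          by (simp add: has_field_derivative_def)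
        have 2: "((\<lambda>t. g0 (x, t)) has_real_derivative g0 (x, t) * m (x, t)) (at t)"
          unfolding m_def g0_def using G_deriv_time[of t "(x, 0)"] t c by (simp add: a0)
        show ?thesis
          using DERIV_mult[OF 1 2] by (simp add: E'_def algebra_simps)
      qed
    qed (use zero edgeD[OF E'] edge_integrable[OF E'] in \<open>auto simp: U_def\<close>)
    then show ?thesis by (simp add: U_def set_lebesgue_integral_def)
  qed
  have I2: "(LINT x|lborel. D b (x, t)) = 0" if b: "b \<in> Basis" and t: "t \<in> {c..d}" for b t
  proof (rule integral_directional_derivative[where h = "\<lambda>x. f (x, t) * ((x \<bullet> b) * (1 / (2 * t))) * g0 (x, t)" and e = b])
    have t0: "0 < t" using t c by auto
    have "edge (\<lambda>p. f p * ((fst p \<bullet> b) * (1 / (2 * snd p))) * g0 p)"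
      by (rule edge_mult1[OF edge_mult1[OF f] g0]) (intro continuous_on_mult continuous_on_inner continuous_on_fst continuous_on_id continuous_on_const inv)
    from edge_slice_integrable[OF this t] show "integrable lborel (\<lambda>x. f (x, t) * ((x \<bullet> b) * (1 / (2 * t))) * g0 (x, t))" by simp
    show "integrable lborel (\<lambda>x. D b (x, t))" by (rule edge_slice_integrable[OF D[OF b] t])
    show "continuous_on UNIV (\<lambda>r. D b (x + r *\<^sub>R b, t))" for x
      by (rule continuous_on_compose2[OF edge_slice_continuous[OF D[OF b] t]]) (auto intro!: continuous_intros)
    show "((\<lambda>r. f (x + r *\<^sub>R b, t) * ((x + r *\<^sub>R b) \<bullet> b * (1 / (2 * t))) * g0 (x + r *\<^sub>R b, t)) has_real_derivative D b (x + r *\<^sub>R b, t)) (at r)" for x r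
    proof -
      define z where "z = x + r *\<^sub>R b"
      have p: "(z, t) \<in> U" using t by (simp add: U_def)
      have bb: "b \<bullet> b = 1" using b by (simp add: inner_same_Basis)
      have line: "((\<lambda>r. x + r *\<^sub>R b) has_derivative (\<lambda>h. h *\<^sub>R b)) (at r)" by (auto intro!: derivative_eq_intros)
      have "((\<lambda>r. f (x + r *\<^sub>R b, t)) has_derivative (\<lambda>h. f' (z, t) (h *\<^sub>R b, 0))) (at r)"
        using has_derivative_compose[OF has_derivative_Pair[OF line has_derivative_const], of f "f' (z, t)" t] der[OF p]
        by (simp add: z_def)
      moreover have "(\<lambda>h. f' (z, t) (h *\<^sub>R b, 0)) = (*) (f' (z, t) (b, 0))"
      proof
        show "f' (z, t) (h *\<^sub>R b, 0) = f' (z, t) (b, 0) * h" for h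
          using linear_scale[OF lin[OF p], of h "(b,0)"] by simp
      qed
      ultimately have 1: "((\<lambda>r. f (x + r *\<^sub>R b, t)) has_real_derivative f' (z, t) (b, 0)) (at r)"
        by (simp add: has_field_derivative_def)
      have "((\<lambda>r. g0 (x + r *\<^sub>R b, t)) has_derivative (\<lambda>h. - g0 (z, t) * ((z, 0::real) \<bullet> (h *\<^sub>R b, 0)) / (2 * t))) (at r)"
        unfolding g0_def fst_conv snd_conv z_def
        by (rule has_derivative_compose[OF has_derivative_Pair[OF line has_derivative_const] G_deriv_space[OF t0]])
      then have 2: "((\<lambda>r. g0 (x + r *\<^sub>R b, t)) has_real_derivative - g0 (z, t) * ((z \<bullet> b) * (1 / (2 * t)))) (at r)"
        unfolding has_field_derivative_def by (rule has_derivative_eq_rhs) (simp add: fun_eq_iff)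
      have 3: "((\<lambda>r. (x + r *\<^sub>R b) \<bullet> b * (1 / (2 * t))) has_real_derivative 1 * (1 / (2 * t))) (at r)"
        unfolding inner_add_left inner_scaleR_left bb using t0 by (auto intro!: derivative_eq_intros)
      show ?thesis
        using DERIV_mult[OF DERIV_mult[OF 1 3] 2]
        unfolding D_def fst_conv snd_conv z_def[symmetric] by (simp add: algebra_simps power2_eq_square)
    qed
  qed
  have edge1: "edge (\<lambda>p. f' p ((1 / (2 * snd p)) *\<^sub>R fst p, 1) * g0 p)" by (rule edge_mult1[OF 2 g0])
  have "(LINT t:{c..d}|lborel. LINT x|lborel. f' (x, t) ((1 / (2 * t)) *\<^sub>R x, 1) * G_kernel a (x, 0) t)
     = (LINT p:U|lborel. f' p ((1 / (2 * snd p)) *\<^sub>R fst p, 1) * g0 p)"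
    using edge_slices(1)[OF edge1] by (simp add: g0_def)
  also have "\<dots> = (LINT p:U|lborel. E' p + (\<Sum>b\<in>Basis. D b p) + F p)"
    unfolding set_lebesgue_integral_def by (rule Bochner_Integration.integral_cong) (use pt in \<open>auto simp: indicator_def\<close>)
  also have "\<dots> = (LINT p:U|lborel. E' p) + (LINT p:U|lborel. (\<Sum>b\<in>Basis. D b p)) + (LINT p:U|lborel. F p)"
    using edge_integrable[OF E'] edge_integrable[OF sD] edge_integrable[OF F] edge_integrable[OF edge_add[OF E' sD]]
    by (simp add: set_integral_add)
  also have "(LINT p:U|lborel. (\<Sum>b\<in>Basis. D b p)) = (LINT t:{c..d}|lborel. 0)"
    unfolding edge_slices(1)[OF sD]
  proof (rule set_lebesgue_integral_cong)
    show "\<forall>t. t \<in> {c..d} \<longrightarrow> (LINT x|lborel. (\<Sum>b\<in>Basis. D b (x, t))) = 0"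
      using I2 by (auto simp: Bochner_Integration.integral_sum[OF edge_slice_integrable[OF D]])
  qed simp
  also have "(LINT p:U|lborel. F p) = (LINT t:{c..d}|lborel. LINT x|lborel. f (x, t) / (2 * t) * G_kernel a (x, 0) t)"
    using edge_slices(1)[OF F] by (simp add: F_def g0_def)
  finally show "(LINT t:{c..d}|lborel. LINT x|lborel. f' (x, t) ((1 / (2 * t)) *\<^sub>R x, 1) * G_kernel a (x, 0) t)
    = (LINT t:{c..d}|lborel. LINT x|lborel. f (x, t) / (2 * t) * G_kernel a (x, 0) t)
      - (LINT x|lborel. f (x, c) * G_kernel a (x, 0) c)"
    unfolding I1 by (simp add: g0_def)
qed

end

section \<open>The boundary terms for s = 1/2\<close>

context slab begin

lemma IX_nonneg:
  assumes "adm f" "t \<in> {c..d}" "\<And>X. X \<in> half_space \<Longrightarrow> 0 \<le> f (X, t)"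
  shows "0 \<le> IX f t"
  using IX_mono[OF adm_zero assms] by (simp add: IX_def)

definition J where "J h = (LINT p:U|lborel. h p * G_kernel a (fst p, 0) (snd p))"

lemma J_slices:
  assumes "edge h"
  shows "J h = (LINT t:{c..d}|lborel. LINT x|lborel. h (x, t) * G_kernel a (x, 0) t)"
    and "set_integrable lborel {c..d} (\<lambda>t. LINT x|lborel. h (x, t) * G_kernel a (x, 0) t)"
  using edge_slices[OF edge_mult1[OF assms U_kernel]] by (simp_all add: J_def)

lemma J_add: "edge f \<Longrightarrow> edge g \<Longrightarrow> J (\<lambda>p. f p + g p) = J f + J g"
  using set_integral_add(2)[OF edge_integrable[OF edge_mult1[OF _ U_kernel]] edge_integrable[OF edge_mult1[OF _ U_kernel]], of f g]
  unfolding J_def by (simp add: algebra_simps)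

lemma J_cmult: "J (\<lambda>p. k * f p) = k * J f"
  unfolding J_def by (simp add: mult.assoc)

lemma J_cong: "(\<And>p. p \<in> U \<Longrightarrow> f p = g p) \<Longrightarrow> J f = J g"
  unfolding J_def set_lebesgue_integral_def by (auto intro!: Bochner_Integration.integral_cong simp: indicator_def)

lemma J_mono:
  assumes "edge f" "edge g" "\<And>p. p \<in> U \<Longrightarrow> f p \<le> g p"
  shows "J f \<le> J g"
  unfolding J_def
proof (rule set_integral_mono[OF edge_integrable[OF edge_mult1[OF _ U_kernel]] edge_integrable[OF edge_mult1[OF _ U_kernel]]])
  fix p :: "(real^'n) \<times> real" assume "p \<in> U"
  with assms(3)[OF this] G_kernel_bound(1)[of "snd p" "(fst p, 0)"]
  show "f p * G_kernel a (fst p, 0) (snd p) \<le> g p * G_kernel a (fst p, 0) (snd p)"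
    by (intro mult_right_mono) (auto simp: U_def)
qed (use assms in auto)

lemma J_time:
  assumes f: "edge f" and m: "continuous_on {c..d} m"
  shows "J (\<lambda>p. m (snd p) * f p) = (LINT t:{c..d}|lborel. m t * (LINT x|lborel. f (x, t) * G_kernel a (x, 0) t))"
    and "set_integrable lborel {c..d} (\<lambda>t. m t * (LINT x|lborel. f (x, t) * G_kernel a (x, 0) t))"
  using J_slices[OF edge_mult2[OF U_time[OF m] f]] by (simp_all add: mult.assoc)

end

text \<open>
  The Robin condition \<partial>_y w = b w at y = 0.  In the application \<open>r\<close> is R and \<open>B\<close> a multiple of R^2.
\<close>

locale robin = weighted dim a c d w wt g wt' g' w0 z0 q \<alpha> P k \<theta>
  for dim :: "'n::finite itself" and a c d w wt g wt' g' w0 z0 q \<alpha> P k \<theta> +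
  fixes b :: "(real^'n) \<times> real \<Rightarrow> real" and b' w0' :: "(real^'n) \<times> real \<Rightarrow> (real^'n) \<times> real \<Rightarrow> real" and r B :: real
  assumes a0: "a = 0"
    and q_eq: "\<And>x t. t \<in> {c..d} \<Longrightarrow> q x t = b (x, t) * w0 x t"
    and z0_eq: "\<And>x t. t \<in> {c..d} \<Longrightarrow> z0 x t = w0' (x, t) ((1 / (2 * t)) *\<^sub>R x, 1)"
    and b_der: "\<And>p. p \<in> U \<Longrightarrow> (b has_derivative b' p) (at p)"
    and b'_cont: "\<And>e. e \<in> Basis \<Longrightarrow> continuous_on U (\<lambda>p. b' p e)"
    and w0_der: "\<And>p. p \<in> U \<Longrightarrow> ((\<lambda>p. w0 (fst p) (snd p)) has_derivative w0' p) (at p)"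
    and edge_w0: "edge (\<lambda>p. w0 (fst p) (snd p))"
    and edge_w0': "\<And>e. e \<in> Basis \<Longrightarrow> edge (\<lambda>p. w0' p e)"
    and w0_final: "\<And>x. w0 x d = 0"
    and r_pos: "0 < r"
    and b_bound: "\<And>p. p \<in> U \<Longrightarrow> norm (fst p) \<le> 4 \<Longrightarrow> \<bar>b p\<bar> \<le> r"
    and b'_bound: "\<And>p. p \<in> U \<Longrightarrow> norm (fst p) \<le> 4 \<Longrightarrow> \<bar>snd p * b' p ((1 / (2 * snd p)) *\<^sub>R fst p, 1)\<bar> \<le> B"
begin

text \<open>
  \<open>v\<close> is the boundary value of w, \<open>Tr\<close> its weighted square integral at a fixed time, and \<open>Zb\<close>, \<open>Zv\<close> are the
  derivatives of b and v along the dilations.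
\<close>

definition v where "v p = w0 (fst p) (snd p)"
definition Tr where "Tr t = (LINT x|lborel. (w0 x t)\<^sup>2 * G_kernel a (x, 0) t)"
definition Zb where "Zb p = b' p ((1 / (2 * snd p)) *\<^sub>R fst p, 1)"
definition Zv where "Zv p = w0' p ((1 / (2 * snd p)) *\<^sub>R fst p, 1)"

lemma UD: "p \<in> U \<Longrightarrow> snd p \<in> {c..d}" "p \<in> U \<Longrightarrow> 0 < snd p" using c by (auto simp: U_def)

lemma cont_Zdir: "continuous_on U (\<lambda>p. ((1 / (2 * snd p)) *\<^sub>R fst p, 1::real))"
  by (intro continuous_intros) (use UD(2) in force)

lemma cont_linear:
  fixes f' :: "_ \<Rightarrow> (real^'n) \<times> real \<Rightarrow> real"
  assumes lin: "\<And>p. p \<in> U \<Longrightarrow> linear (f' p)"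
    and f': "\<And>e. e \<in> Basis \<Longrightarrow> continuous_on U (\<lambda>p. f' p e)" and h: "continuous_on U h"
  shows "continuous_on U (\<lambda>p. f' p (h p))"
proof -
  have 1: "continuous_on U (\<lambda>p. \<Sum>e\<in>Basis. (h p \<bullet> e) * f' p e)"
    by (intro continuous_on_sum continuous_on_mult continuous_on_inner continuous_on_const h f')
  have eq: "(\<Sum>e\<in>Basis. (h p \<bullet> e) * f' p e) = f' p (h p)" if "p \<in> U" for p
    using linear_expand_Basis[OF lin[OF that], of "h p"] by simp
  show ?thesis using 1 by (subst (asm) continuous_on_cong[OF refl eq]) auto
qed

lemma edge_v: "edge v" using edge_w0 by (simp add: v_def[abs_def])
lemma edge_vv: "edge (\<lambda>p. v p * v p)" by (rule edge_mult1[OF edge_v edgeD[OF edge_v]])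
lemma cont_b: "continuous_on U b"
  by (meson b_der continuous_at_imp_continuous_on has_derivative_continuous)
lemma cont_Zb: "continuous_on U Zb"
  unfolding Zb_def[abs_def]
  by (rule cont_linear[OF has_derivative_linear[OF b_der] b'_cont cont_Zdir])
lemma cont_Zv: "continuous_on U Zv"
  unfolding Zv_def[abs_def]
  by (rule cont_linear[OF has_derivative_linear[OF w0_der] edgeD[OF edge_w0'] cont_Zdir])

lemma Tr_integrable:
  assumes m: "continuous_on {c..d} m"
  shows "(LINT t:{c..d}|lborel. m t * Tr t) = J (\<lambda>p. m (snd p) * (v p * v p))"
    and "set_integrable lborel {c..d} (\<lambda>t. m t * Tr t)"
  using J_time[OF edge_vv m] by (simp_all add: Tr_def v_def power2_eq_square)

lemma BW_J:
  assumes m: "continuous_on {c..d} m"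
  shows "(LINT t:{c..d}|lborel. m t * BW t) = J (\<lambda>p. m (snd p) * (b p * (v p * v p)))"
proof -
  have "(LINT t:{c..d}|lborel. m t * BW t) = (LINT t:{c..d}|lborel. m t * (LINT x|lborel. b (x, t) * (v (x, t) * v (x, t)) * G_kernel a (x, 0) t))"
    by (rule set_lebesgue_integral_cong) (auto simp: BW_def q_eq v_def mult_ac)
  then show ?thesis using J_time(1)[OF edge_mult2[OF cont_b edge_vv] m] by simp
qed

lemma BZ_J:
  assumes m: "continuous_on {c..d} m"
  shows "(LINT t:{c..d}|lborel. m t * BZ t) = J (\<lambda>p. m (snd p) * (b p * (v p * Zv p)))"
proof -
  have "(LINT t:{c..d}|lborel. m t * BZ t) = (LINT t:{c..d}|lborel. m t * (LINT x|lborel. b (x, t) * (v (x, t) * Zv (x, t)) * G_kernel a (x, 0) t))"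
    by (rule set_lebesgue_integral_cong) (auto simp: BZ_def q_eq z0_eq v_def Zv_def mult_ac)
  then show ?thesis using J_time(1)[OF edge_mult2[OF cont_b edge_mult1[OF edge_v cont_Zv]] m] by simp
qed

lemma cPpsi: "continuous_on {c..d} (\<lambda>t. P t * \<psi> t)" by (intro continuous_on_mult P_cont psi_cont)

text \<open>
  Since Z commutes with restriction to y = 0, 2 b v Zv = Z(b v^2) - v^2 Zb there, and the exact derivative is
  integrated by \<open>edge_integral_Z\<close>.  The two terms containing \<alpha> cancel, so that what is left grows only with b
  and its first derivatives.
\<close>

lemma boundary_energy:
  "- 2 * (LINT t:{c..d}|lborel. P t * \<psi> t * BZ t) + 2 * \<alpha> * (LINT t:{c..d}|lborel. P t * BW t)
   = P c * \<psi> c * (LINT x|lborel. b (x, c) * (v (x, c) * v (x, c)) * G_kernel a (x, 0) c)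
     + J (\<lambda>p. (P (snd p) * k (snd p) * (b p * (1/2 + \<theta> (snd p)) + snd p * Zb p)) * (v p * v p))"
proof -
  define f where "f p = (P (snd p) * \<psi> (snd p)) * (b p * (v p * v p))" for p
  define f' where "f' p h = (P (snd p) * \<psi> (snd p)) * (b p * (v p * w0' p h + w0' p h * v p) + b' p h * (v p * v p))
     + ((- 2 * \<alpha> * P (snd p) + P (snd p) * k (snd p) * (1 + \<theta> (snd p))) * snd h) * (b p * (v p * v p))" for p h
  have c2: "continuous_on {c..d} (\<lambda>t. - 2 * \<alpha> * P t + P t * k t * (1 + \<theta> t))"
    by (intro continuous_intros P_cont k_cont th_cont)
  have ebv: "edge (\<lambda>p. b p * (v p * v p))" by (rule edge_mult2[OF cont_b edge_vv])
  have D: "(f has_derivative f' p) (at p)" if p: "p \<in> U" for p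
  proof -
    note W = w0_der[OF p, folded v_def]
    show ?thesis
      using has_derivative_mult[OF has_derivative_time[OF Ppsi_der[OF UD(1)[OF p]]]
         has_derivative_mult[OF b_der[OF p] has_derivative_mult[OF W W]]]
      unfolding f_def[abs_def] f'_def[abs_def] .
  qed
  have ef: "edge f" unfolding f_def[abs_def] by (rule edge_mult2[OF U_time[OF cPpsi] ebv])
  have ef': "edge (\<lambda>p. f' p e)" if e: "e \<in> Basis" for e
    unfolding f'_def
    by (rule edge_add[OF edge_mult2[OF U_time[OF cPpsi] edge_add[OF edge_mult2[OF cont_b edge_add[OF
          edge_mult1[OF edge_v edgeD[OF edge_w0'[OF e]]] edge_mult1[OF edge_w0'[OF e] edgeD[OF edge_v]]]]
          edge_mult2[OF b'_cont[OF e] edge_vv]]]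
        edge_mult2[OF continuous_on_mult[OF U_time[OF c2] continuous_on_const] ebv]])
  have zero: "f (x, d) = 0" for x by (simp add: f_def v_def w0_final)
  note T = edge_integral_Z[of f f', OF a0 D ef ef' zero]
  have t0: "continuous_on {c..d} (\<lambda>t. 1 / (2 * t))" by (intro continuous_intros) (use c in auto)
  define h1 where "h1 p = f' p ((1 / (2 * snd p)) *\<^sub>R fst p, 1)" for p
  define h2 where "h2 p = 1 / (2 * snd p) * f p" for p
  define h3 where "h3 p = (P (snd p) * k (snd p) * (b p * (1/2 + \<theta> (snd p)) + snd p * Zb p)) * (v p * v p)" for p
  define h4 where "h4 p = (P (snd p) * \<psi> (snd p)) * (b p * (v p * Zv p))" for p
  define h5 where "h5 p = P (snd p) * (b p * (v p * v p))" for p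
  have e1: "edge h1" unfolding h1_def[abs_def] by (rule T(2))
  have e2: "edge h2" unfolding h2_def[abs_def] by (rule edge_mult2[OF U_time[OF t0] ef])
  have e3: "edge h3" unfolding h3_def[abs_def]
    by (rule edge_mult2[OF _ edge_vv], intro continuous_on_mult continuous_on_add U_time P_cont k_cont th_cont cont_b cont_Zb
      continuous_on_const continuous_on_snd continuous_on_id)
  have e4: "edge h4" unfolding h4_def[abs_def] by (rule edge_mult2[OF U_time[OF cPpsi] edge_mult2[OF cont_b edge_mult1[OF edge_v cont_Zv]]])
  have e5: "edge h5" unfolding h5_def[abs_def] by (rule edge_mult2[OF U_time[OF P_cont] ebv])
  have m: "edge f \<Longrightarrow> edge (\<lambda>p. r * f p)" for f and r :: real by (rule edge_mult2[OF continuous_on_const])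
  have pt: "(- 2) * h4 p + (2 * \<alpha>) * h5 p = (- 1) * h1 p + h2 p + h3 p" if p: "p \<in> U" for p
  proof -
    have "h2 p = P (snd p) * k (snd p) / 2 * (b p * (v p * v p))"
      using UD(2)[OF p] by (simp add: h2_def f_def \<psi>_def)
    then show ?thesis
      unfolding h1_def h3_def h4_def h5_def f'_def Zb_def[symmetric] Zv_def[symmetric] by (simp add: \<psi>_def algebra_simps)
  qed
  have "(- 2) * J h4 + (2 * \<alpha>) * J h5 = J (\<lambda>p. (- 2) * h4 p + (2 * \<alpha>) * h5 p)"
    by (simp only: J_add[OF m[OF e4] m[OF e5]] J_cmult)
  also have "\<dots> = J (\<lambda>p. (- 1) * h1 p + h2 p + h3 p)" by (rule J_cong[OF pt])
  also have "\<dots> = (- 1) * J h1 + J h2 + J h3"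
    by (simp only: J_add[OF edge_add[OF m[OF e1] e2] e3] J_add[OF m[OF e1] e2] J_cmult)
  also have "J h1 = J h2 - (LINT x|lborel. f (x, c) * G_kernel a (x, 0) c)"
    using T(1) J_slices(1)[OF e1] J_slices(1)[OF e2] by (simp add: h1_def h2_def)
  also have "(LINT x|lborel. f (x, c) * G_kernel a (x, 0) c)
      = P c * \<psi> c * (LINT x|lborel. b (x, c) * (v (x, c) * v (x, c)) * G_kernel a (x, 0) c)"
    by (simp add: f_def mult.assoc)
  finally show ?thesis
    using BZ_J[OF cPpsi] BW_J[OF P_cont] by (simp add: h3_def[abs_def] h4_def[abs_def] h5_def[abs_def])
qed

lemma Tr_bound:
  assumes t: "t \<in> {c..d}" and "0 < \<eta>"
  shows "Tr t \<le> 2 * \<eta> * IX (\<lambda>p. g p \<bullet> g p) t + (2 / \<eta> + \<eta> / (4 * t)) * IX (\<lambda>p. (w p)\<^sup>2) t"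
  unfolding Tr_def by (rule trace_inequality[OF a0 t \<open>0 < \<eta>\<close>])

lemma v_zero: "p \<in> U \<Longrightarrow> 4 \<le> norm (fst p) \<Longrightarrow> v p = 0"
  using edge_v unfolding edge_def U_def by auto

lemma b_vv_bound: "p \<in> U \<Longrightarrow> \<bar>b p * (v p * v p)\<bar> \<le> r * (v p * v p)"
  using b_bound[of p] v_zero[of p] by (cases "norm (fst p) \<le> 4") (auto simp: abs_mult intro!: mult_right_mono)

context
  fixes \<Gamma> :: real
  assumes G1: "\<And>t. t \<in> {c..d} \<Longrightarrow> k t * (r * (1/2 + \<theta> t) + B) \<le> \<Gamma>"
    and G2: "\<And>t. t \<in> {c..d} \<Longrightarrow> k t * \<theta> t * r \<le> \<Gamma>"
    and G0: "0 < \<Gamma>"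
    and th_sq: "\<And>t. t \<in> {c..d} \<Longrightarrow> \<alpha> * t \<le> (\<theta> t)\<^sup>2"
    and al: "46 * \<Gamma> \<le> \<alpha>" "1 \<le> \<alpha>" and alc: "k c * (8 * r\<^sup>2 * c + 1/16) \<le> \<alpha>"
begin

lemma th_pos: "t \<in> {c..d} \<Longrightarrow> 0 < \<theta> t"
  using th_sq[of t] th_nonneg[of t] pos(1)[of t] alpha by (cases "\<theta> t = 0") (auto simp: mult_le_0_iff)

text \<open>
  The trace inequality with \<eta> = \<theta>/(32 \<Gamma>): the gradient part is then P k \<theta>/16 at most, and the w^2 part is of
  size \<Gamma>^2/\<theta>, to be compared with \<alpha> \<theta>/t; this is the place where \<theta>^2 \<ge> \<alpha> t is needed.
\<close>

lemma bulk_trace: "\<Gamma> * (LINT t:{c..d}|lborel. P t * Tr t) \<le> (\<Delta> + W) / 16"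
proof -
  define f where "f p = (1/16) * ((P (snd p) * k (snd p) * \<theta> (snd p)) * (g p \<bullet> g p)) + (\<alpha>/16) * ((P (snd p) * \<theta> (snd p) / snd p) * (w p)\<^sup>2)" for p
  have m: "adm f \<Longrightarrow> adm (\<lambda>p. r * f p)" for f and r :: real by (rule adm_mult2[OF tame_const])
  note a1 = m[OF adm_time[OF cont_Pkth adm_gg], of "1/16"] and a2 = m[OF adm_time[OF cont_Pth adm_ww], of "\<alpha>/16"]
  have af: "adm f" unfolding f_def[abs_def] by (rule adm_add[OF a1 a2])
  have "\<Gamma> * (LINT t:{c..d}|lborel. P t * Tr t) = (LINT t:{c..d}|lborel. \<Gamma> * (P t * Tr t))" by simp
  also have "\<dots> \<le> (LINT t:{c..d}|lborel. IX f t)"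
  proof (rule set_integral_mono)
    show "set_integrable lborel {c..d} (\<lambda>t. \<Gamma> * (P t * Tr t))" using Tr_integrable(2)[OF P_cont] by simp
    show "set_integrable lborel {c..d} (IX f)" by (rule IS_slices(2)[OF af])
    fix t assume t: "t \<in> {c..d}"
    define D where "D = IX (\<lambda>p. g p \<bullet> g p) t"
    define H where "H = IX (\<lambda>p. (w p)\<^sup>2) t"
    have D0: "0 \<le> D" unfolding D_def by (rule IX_nonneg[OF adm_gg t]) simp
    have H0: "0 \<le> H" unfolding H_def by (rule IX_nonneg[OF adm_ww t]) simp
    have tp: "0 < t" "0 < \<theta> t" "0 < P t" "1 \<le> k t" using pos(1)[OF t] th_pos[OF t] P_pos[OF t] k_ge_1[OF t] by auto
    have T: "Tr t \<le> 2 * (\<theta> t / (32 * \<Gamma>)) * D + (2 / (\<theta> t / (32 * \<Gamma>)) + (\<theta> t / (32 * \<Gamma>)) / (4 * t)) * H"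
      unfolding D_def H_def by (rule Tr_bound[OF t]) (use tp G0 in simp)
    have "\<Gamma> * Tr t \<le> \<theta> t / 16 * D + (64 * \<Gamma>\<^sup>2 / \<theta> t + \<theta> t / (128 * t)) * H"
    proof -
      have "\<Gamma> * (2 * (\<theta> t / (32 * \<Gamma>)) * D + (2 / (\<theta> t / (32 * \<Gamma>)) + (\<theta> t / (32 * \<Gamma>)) / (4 * t)) * H)
        = \<theta> t / 16 * D + (64 * \<Gamma>\<^sup>2 / \<theta> t + \<theta> t / (128 * t)) * H"
        using G0 tp by (simp add: field_simps power2_eq_square)
      then show ?thesis using mult_left_mono[OF T less_imp_le[OF G0]] by (simp only:)
    qed
    also have "\<dots> \<le> k t * \<theta> t / 16 * D + \<alpha> / 16 * (\<theta> t / t) * H"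
    proof (intro add_mono mult_right_mono D0 H0)
      show "\<theta> t / 16 \<le> k t * \<theta> t / 16" using tp by simp
      have "2116 * \<Gamma>\<^sup>2 \<le> \<alpha>\<^sup>2"
        using power_mono[OF al(1), of 2] G0 by (simp add: power_mult_distrib)
      moreover have "0 \<le> \<Gamma>\<^sup>2" by simp
      ultimately have "64 * \<Gamma>\<^sup>2 \<le> \<alpha>\<^sup>2 / 32" by linarith
      then have "64 * \<Gamma>\<^sup>2 * t \<le> \<alpha>\<^sup>2 / 32 * t" using tp by (intro mult_right_mono) auto
      also have "\<dots> = \<alpha> / 32 * (\<alpha> * t)" by (simp add: power2_eq_square)
      also have "\<dots> \<le> \<alpha> / 32 * (\<theta> t)\<^sup>2" using th_sq[OF t] al by (intro mult_left_mono) auto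
      finally have "64 * \<Gamma>\<^sup>2 / \<theta> t \<le> \<alpha> / 32 * (\<theta> t / t)"
        using tp by (simp add: field_simps power2_eq_square)
      moreover have "\<theta> t / (128 * t) \<le> \<alpha> / 32 * (\<theta> t / t)"
        using tp al mult_right_mono[of "1/128" "\<alpha>/32" "\<theta> t / t"] by simp
      ultimately show "64 * \<Gamma>\<^sup>2 / \<theta> t + \<theta> t / (128 * t) \<le> \<alpha> / 16 * (\<theta> t / t)" by simp
    qed
    finally have "P t * (\<Gamma> * Tr t) \<le> P t * (k t * \<theta> t / 16 * D + \<alpha> / 16 * (\<theta> t / t) * H)"
      using tp by (intro mult_left_mono) auto
    also have "\<dots> = IX f t"
      unfolding f_def[abs_def] IX_add[OF a1 a2 t] D_def H_def
      using IX_cmult_time[of "\<lambda>t. 1/16 * (P t * k t * \<theta> t)" "\<lambda>p. g p \<bullet> g p" t]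
        IX_cmult_time[of "\<lambda>t. \<alpha>/16 * (P t * \<theta> t / t)" "\<lambda>p. (w p)\<^sup>2" t]
      by (simp add: mult.assoc algebra_simps)
    finally show "\<Gamma> * (P t * Tr t) \<le> IX f t" by (simp add: mult_ac)
  qed
  also have "\<dots> = IS f" by (rule IS_slices(1)[OF af, symmetric])
  also have "\<dots> = \<Delta> / 16 + W / 16"
    unfolding f_def[abs_def] IS_add[OF a1 a2] IS_cmult \<Delta>_def W_def by simp
  finally show ?thesis by (simp add: add_divide_distrib)
qed

lemma boundary_mass: "(LINT t:{c..d}|lborel. P t * k t * \<theta> t * BW t) \<le> (\<Delta> + W) / 16"
proof -
  have "(LINT t:{c..d}|lborel. P t * k t * \<theta> t * BW t) = J (\<lambda>p. (P (snd p) * k (snd p) * \<theta> (snd p)) * (b p * (v p * v p)))"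
    using BW_J[OF cont_Pkth] by simp
  also have "\<dots> \<le> J (\<lambda>p. \<Gamma> * (P (snd p) * (v p * v p)))"
  proof (rule J_mono)
    show "edge (\<lambda>p. (P (snd p) * k (snd p) * \<theta> (snd p)) * (b p * (v p * v p)))"
      by (rule edge_mult2[OF U_time[OF cont_Pkth] edge_mult2[OF cont_b edge_vv]])
    show "edge (\<lambda>p. \<Gamma> * (P (snd p) * (v p * v p)))"
      by (rule edge_mult2[OF continuous_on_const edge_mult2[OF U_time[OF P_cont] edge_vv]])
    fix p assume p: "p \<in> U"
    note t = UD(1)[OF p]
    have "(P (snd p) * k (snd p) * \<theta> (snd p)) * (b p * (v p * v p)) \<le> (P (snd p) * k (snd p) * \<theta> (snd p)) * (r * (v p * v p))"
      using b_vv_bound[OF p] P_pos[OF t] k_ge_1[OF t] th_nonneg[OF t] by (intro mult_left_mono) auto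
    also have "\<dots> = P (snd p) * (v p * v p) * (k (snd p) * \<theta> (snd p) * r)" by simp
    also have "\<dots> \<le> P (snd p) * (v p * v p) * \<Gamma>" using G2[OF t] P_pos[OF t] by (intro mult_left_mono) auto
    finally show "(P (snd p) * k (snd p) * \<theta> (snd p)) * (b p * (v p * v p)) \<le> \<Gamma> * (P (snd p) * (v p * v p))" by (simp add: mult_ac)
  qed
  also have "\<dots> = \<Gamma> * (LINT t:{c..d}|lborel. P t * Tr t)"
    unfolding J_cmult Tr_integrable(1)[OF P_cont] ..
  finally show ?thesis using bulk_trace by simp
qed

text \<open>
  In the bulk \<open>bulk_trace\<close> applies; on the slice t = c the trace inequality is used with \<eta> = 1/(4 r), which
  costs half of the gradient term available there.
\<close>

lemma boundary_energy_bound: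
  "- (\<Delta> + W) / 16 - P c * \<psi> c * IX (\<lambda>p. g p \<bullet> g p) c / 2 - \<alpha> * P c * IX (\<lambda>p. (w p)\<^sup>2) c
      \<le> - 2 * (LINT t:{c..d}|lborel. P t * \<psi> t * BZ t) + 2 * \<alpha> * (LINT t:{c..d}|lborel. P t * BW t)"
proof -
  have ct: "c \<in> {c..d}" using cd by simp
  define D where "D = IX (\<lambda>p. g p \<bullet> g p) c"
  define H where "H = IX (\<lambda>p. (w p)\<^sup>2) c"
  have H0: "0 \<le> H" unfolding H_def by (rule IX_nonneg[OF adm_ww ct]) simp
  have "- (\<Gamma> * (LINT t:{c..d}|lborel. P t * Tr t)) = J (\<lambda>p. (- \<Gamma>) * (P (snd p) * (v p * v p)))"
    unfolding J_cmult Tr_integrable(1)[OF P_cont] by simp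
  also have "\<dots> \<le> J (\<lambda>p. (P (snd p) * k (snd p) * (b p * (1/2 + \<theta> (snd p)) + snd p * Zb p)) * (v p * v p))"
  proof (rule J_mono)
    show "edge (\<lambda>p. (P (snd p) * k (snd p) * (b p * (1/2 + \<theta> (snd p)) + snd p * Zb p)) * (v p * v p))"
      by (rule edge_mult2[OF _ edge_vv], intro continuous_on_mult continuous_on_add U_time P_cont k_cont th_cont cont_b cont_Zb
        continuous_on_const continuous_on_snd continuous_on_id)
    show "edge (\<lambda>p. (- \<Gamma>) * (P (snd p) * (v p * v p)))"
      by (rule edge_mult2[OF continuous_on_const edge_mult2[OF U_time[OF P_cont] edge_vv]])
    fix p assume p: "p \<in> U"
    note t = UD(1)[OF p]
    define s where "s = b p * (1/2 + \<theta> (snd p)) + snd p * Zb p"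
    show "(- \<Gamma>) * (P (snd p) * (v p * v p)) \<le> (P (snd p) * k (snd p) * (b p * (1/2 + \<theta> (snd p)) + snd p * Zb p)) * (v p * v p)"
    proof (cases "norm (fst p) \<le> 4")
      case True
      have "\<bar>b p\<bar> * (1/2 + \<theta> (snd p)) \<le> r * (1/2 + \<theta> (snd p))"
        using b_bound[OF p True] th_nonneg[OF t] by (intro mult_right_mono) auto
      then have "\<bar>b p * (1/2 + \<theta> (snd p))\<bar> \<le> r * (1/2 + \<theta> (snd p))"
        using th_nonneg[OF t] by (simp add: abs_mult del: mult_le_cancel_right)
      then have "\<bar>s\<bar> \<le> r * (1/2 + \<theta> (snd p)) + B"
        using b'_bound[OF p True] abs_triangle_ineq[of "b p * (1/2 + \<theta> (snd p))" "snd p * Zb p"]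
        unfolding s_def Zb_def by linarith
      then have "k (snd p) * \<bar>s\<bar> \<le> k (snd p) * (r * (1/2 + \<theta> (snd p)) + B)"
        using k_ge_1[OF t] by (intro mult_left_mono) auto
      also have "\<dots> \<le> \<Gamma>" by (rule G1[OF t])
      finally have "\<bar>k (snd p) * s\<bar> \<le> \<Gamma>" using k_ge_1[OF t] by (simp add: abs_mult)
      then have "(- \<Gamma>) * (P (snd p) * (v p * v p)) \<le> (k (snd p) * s) * (P (snd p) * (v p * v p))"
        using P_pos[OF t] by (intro mult_right_mono) auto
      then show ?thesis by (simp add: s_def mult_ac)
    next
      case False
      then show ?thesis using v_zero[OF p] by simp
    qed
  qed
  finally have 1: "- (\<Delta> + W) / 16 \<le> J (\<lambda>p. (P (snd p) * k (snd p) * (b p * (1/2 + \<theta> (snd p)) + snd p * Zb p)) * (v p * v p))"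
    using bulk_trace by simp
  define s where "s = (LINT x|lborel. b (x, c) * (v (x, c) * v (x, c)) * G_kernel a (x, 0) c)"
  have "- r * Tr c = (LINT x|lborel. (- r) * (v (x, c) * v (x, c)) * G_kernel a (x, 0) c)"
    by (simp add: Tr_def v_def power2_eq_square mult.assoc)
  also have "\<dots> \<le> s"
    unfolding s_def
  proof (rule integral_mono)
    show "integrable lborel (\<lambda>x. (- r) * (v (x, c) * v (x, c)) * G_kernel a (x, 0) c)"
      using edge_slice_integrable[OF edge_mult1[OF edge_mult2[OF continuous_on_const[of _ "- r"] edge_vv] U_kernel] ct] by simp
    show "integrable lborel (\<lambda>x. b (x, c) * (v (x, c) * v (x, c)) * G_kernel a (x, 0) c)"
      using edge_slice_integrable[OF edge_mult1[OF edge_mult2[OF cont_b edge_vv] U_kernel] ct] by simp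
    fix x :: "real^'n"
    have "(x, c) \<in> U" using ct by (simp add: U_def)
    from b_vv_bound[OF this] have "(- r) * (v (x, c) * v (x, c)) \<le> b (x, c) * (v (x, c) * v (x, c))"
      unfolding mult_minus_left by linarith
    then show "(- r) * (v (x, c) * v (x, c)) * G_kernel a (x, 0) c \<le> b (x, c) * (v (x, c) * v (x, c)) * G_kernel a (x, 0) c"
      by (rule mult_right_mono) (rule less_imp_le[OF G_kernel_bound(1)[OF order_refl]])
  qed
  finally have 2: "- r * Tr c \<le> s" .
  have T: "Tr c \<le> 2 * (1 / (4 * r)) * D + (2 / (1 / (4 * r)) + (1 / (4 * r)) / (4 * c)) * H"
    unfolding D_def H_def by (rule Tr_bound[OF ct]) (use r_pos in simp)
  have "r * Tr c \<le> D / 2 + (8 * r\<^sup>2 + 1 / (16 * c)) * H"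
  proof -
    have "r * (2 * (1 / (4 * r)) * D + (2 / (1 / (4 * r)) + (1 / (4 * r)) / (4 * c)) * H)
      = D / 2 + (8 * r\<^sup>2 + 1 / (16 * c)) * H"
      using r_pos c by (simp add: field_simps power2_eq_square)
    then show ?thesis using mult_left_mono[OF T less_imp_le[OF r_pos]] by (simp only:)
  qed
  then have "\<psi> c * (r * Tr c) \<le> \<psi> c * (D / 2 + (8 * r\<^sup>2 + 1 / (16 * c)) * H)"
    using pos(2)[OF ct] by (intro mult_left_mono) auto
  also have "\<dots> = \<psi> c * D / 2 + k c * (8 * r\<^sup>2 * c + 1/16) * H"
    using c by (simp add: \<psi>_def field_simps)
  also have "\<dots> \<le> \<psi> c * D / 2 + \<alpha> * H" using alc H0 by (intro add_left_mono mult_right_mono) auto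
  finally have "\<psi> c * (- r * Tr c) \<ge> - (\<psi> c * D / 2 + \<alpha> * H)" by simp
  also have "\<psi> c * (- r * Tr c) \<le> \<psi> c * s" using 2 pos(2)[OF ct] by (intro mult_left_mono) auto
  finally have "P c * (- (\<psi> c * D / 2 + \<alpha> * H)) \<le> P c * (\<psi> c * s)" using P_pos[OF ct] by (intro mult_left_mono) auto
  then have "- (P c * \<psi> c * D / 2) - \<alpha> * P c * H \<le> P c * \<psi> c * s" by (simp add: algebra_simps)
  then show ?thesis using 1 unfolding boundary_energy s_def[symmetric] D_def[symmetric] H_def[symmetric] by linarith
qed

end

end

section \<open>Smooth functions up to the boundary\<close>

text \<open>
  Two applications of the mean value theorem write the second difference quotient as a value of the mixed
  derivative near p.  The quotient is symmetric in u and v, which gives the next lemma.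
\<close>

lemma second_difference_tendsto:
  fixes f :: "'a::real_normed_vector \<Rightarrow> real"
  assumes N: "open N" "p \<in> N"
    and fu: "\<And>x. x \<in> N \<Longrightarrow> ((\<lambda>r. f (x + r *\<^sub>R u)) has_real_derivative fu x) (at 0)"
    and fuv: "\<And>x. x \<in> N \<Longrightarrow> ((\<lambda>r. fu (x + r *\<^sub>R v)) has_real_derivative fuv x) (at 0)"
    and cont: "isCont fuv p"
  shows "((\<lambda>h. (f (p + h *\<^sub>R u + h *\<^sub>R v) - f (p + h *\<^sub>R u) - f (p + h *\<^sub>R v) + f p) / h\<^sup>2) \<longlongrightarrow> fuv p) (at_right 0)"
proof (rule tendstoI)
  fix e :: real assume e: "0 < e"
  obtain r1 where r1: "0 < r1" "ball p r1 \<subseteq> N" using N openE by blast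
  obtain r2 where r2: "0 < r2" "\<And>x. dist x p < r2 \<Longrightarrow> dist (fuv x) (fuv p) < e"
    using cont e unfolding continuous_at_eps_delta by blast
  define r where "r = min r1 r2"
  \<comment> \<open>The parallelogram spanned by \<delta> u and \<delta> v stays in the ball of radius r.\<close>
  define \<delta> where "\<delta> = r / (norm u + norm v + 1)"
  have n: "0 < norm u + norm v + 1" using norm_ge_zero[of u] norm_ge_zero[of v] by linarith
  have d: "0 < \<delta>" using r1 r2 n by (simp add: \<delta>_def r_def)
  have inside: "dist (p + s *\<^sub>R u + t *\<^sub>R v) p < r" if "0 \<le> s" "s \<le> h" "0 \<le> t" "t \<le> h" "h < \<delta>" "0 < h" for s t h
  proof -
    have "dist (p + s *\<^sub>R u + t *\<^sub>R v) p = norm (s *\<^sub>R u + t *\<^sub>R v)" by (simp add: dist_norm add.assoc)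
    also have "\<dots> \<le> s * norm u + t * norm v"
      using norm_triangle_ineq[of "s *\<^sub>R u" "t *\<^sub>R v"] that by simp
    also have "\<dots> \<le> h * norm u + h * norm v" using that by (intro add_mono mult_right_mono) auto
    also have "\<dots> \<le> h * (norm u + norm v + 1)" using that by (simp add: algebra_simps)
    also have "\<dots> < \<delta> * (norm u + norm v + 1)" using that n by (intro mult_strict_right_mono) auto
    also have "\<dots> = r" using n by (simp add: \<delta>_def)
    finally show ?thesis .
  qed
  have inN: "p + s *\<^sub>R u + t *\<^sub>R v \<in> N" if "0 \<le> s" "s \<le> h" "0 \<le> t" "t \<le> h" "h < \<delta>" "0 < h" for s t h
    using inside[OF that] r1 by (auto simp: r_def dist_commute)
  have du: "((\<lambda>s. f (p + s *\<^sub>R u + y)) has_real_derivative fu (p + s *\<^sub>R u + y)) (at s)" if "p + s *\<^sub>R u + y \<in> N" for s y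
    using fu[OF that] DERIV_shift[of "\<lambda>s. f (p + s *\<^sub>R u + y)" _ 0 s] by (simp add: algebra_simps)
  have dv: "((\<lambda>t. fu (x + t *\<^sub>R v)) has_real_derivative fuv (x + t *\<^sub>R v)) (at t)" if "x + t *\<^sub>R v \<in> N" for t x
    using fuv[OF that] DERIV_shift[of "\<lambda>t. fu (x + t *\<^sub>R v)" _ 0 t] by (simp add: algebra_simps)
  have "dist ((f (p + h *\<^sub>R u + h *\<^sub>R v) - f (p + h *\<^sub>R u) - f (p + h *\<^sub>R v) + f p) / h\<^sup>2) (fuv p) < e"
    if h: "0 < h" "h < \<delta>" for h
  proof -
    have "\<exists>s>0. s < h \<and> (f (p + h *\<^sub>R u + h *\<^sub>R v) - f (p + h *\<^sub>R u + 0)) - (f (p + 0 *\<^sub>R u + h *\<^sub>R v) - f (p + 0 *\<^sub>R u + 0))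
        = (h - 0) * (fu (p + s *\<^sub>R u + h *\<^sub>R v) - fu (p + s *\<^sub>R u + 0))"
    proof (rule MVT2)
      fix s assume s: "0 \<le> s" "s \<le> h"
      show "((\<lambda>s. f (p + s *\<^sub>R u + h *\<^sub>R v) - f (p + s *\<^sub>R u + 0)) has_real_derivative
          fu (p + s *\<^sub>R u + h *\<^sub>R v) - fu (p + s *\<^sub>R u + 0)) (at s)"
        by (intro DERIV_diff du) (use inN[of s h h] inN[of s h 0] s h in auto)
    qed (use h in simp)
    then obtain s where s: "0 < s" "s < h"
      "f (p + h *\<^sub>R u + h *\<^sub>R v) - f (p + h *\<^sub>R u) - f (p + h *\<^sub>R v) + f p = h * (fu (p + s *\<^sub>R u + h *\<^sub>R v) - fu (p + s *\<^sub>R u))"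
      by auto
    have "\<exists>t>0. t < h \<and> fu (p + s *\<^sub>R u + h *\<^sub>R v) - fu (p + s *\<^sub>R u + 0 *\<^sub>R v) = (h - 0) * fuv (p + s *\<^sub>R u + t *\<^sub>R v)"
    proof (rule MVT2)
      fix t assume t: "0 \<le> t" "t \<le> h"
      show "((\<lambda>t. fu (p + s *\<^sub>R u + t *\<^sub>R v)) has_real_derivative fuv (p + s *\<^sub>R u + t *\<^sub>R v)) (at t)"
        by (rule dv) (use inN[of s h t] s t h in auto)
    qed (use h in simp)
    then obtain t where t: "0 < t" "t < h" "fu (p + s *\<^sub>R u + h *\<^sub>R v) - fu (p + s *\<^sub>R u) = h * fuv (p + s *\<^sub>R u + t *\<^sub>R v)"
      by auto
    have "(f (p + h *\<^sub>R u + h *\<^sub>R v) - f (p + h *\<^sub>R u) - f (p + h *\<^sub>R v) + f p) / h\<^sup>2 = fuv (p + s *\<^sub>R u + t *\<^sub>R v)"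
      unfolding s(3) t(3) using h by (simp add: power2_eq_square)
    then show ?thesis using r2(2) inside[of s h t] s t h by (simp add: r_def)
  qed
  then show "\<forall>\<^sub>F h in at_right 0. dist ((f (p + h *\<^sub>R u + h *\<^sub>R v) - f (p + h *\<^sub>R u) - f (p + h *\<^sub>R v) + f p) / h\<^sup>2) (fuv p) < e"
    using d by (auto simp: eventually_at_right_field)
qed

lemma mixed_derivatives_commute:
  fixes f :: "'a::real_normed_vector \<Rightarrow> real"
  assumes N: "open N" "p \<in> N"
    and fu: "\<And>x. x \<in> N \<Longrightarrow> ((\<lambda>r. f (x + r *\<^sub>R u)) has_real_derivative fu x) (at 0)"
    and fv: "\<And>x. x \<in> N \<Longrightarrow> ((\<lambda>r. f (x + r *\<^sub>R v)) has_real_derivative fv x) (at 0)"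
    and fuv: "\<And>x. x \<in> N \<Longrightarrow> ((\<lambda>r. fu (x + r *\<^sub>R v)) has_real_derivative fuv x) (at 0)"
    and fvu: "\<And>x. x \<in> N \<Longrightarrow> ((\<lambda>r. fv (x + r *\<^sub>R u)) has_real_derivative fvu x) (at 0)"
    and "isCont fuv p" "isCont fvu p"
  shows "fuv p = fvu p"
proof (rule tendsto_unique[OF _ second_difference_tendsto[OF N fu fuv assms(7)]])
  show "((\<lambda>h. (f (p + h *\<^sub>R u + h *\<^sub>R v) - f (p + h *\<^sub>R u) - f (p + h *\<^sub>R v) + f p) / h\<^sup>2) \<longlongrightarrow> fvu p) (at_right 0)"
    using second_difference_tendsto[OF N fv fvu assms(8)] by (simp add: algebra_simps)
qed simp

text \<open>
  \<open>DD\<close> is the closed domain on which the test function is smooth, \<open>D0\<close> is its interior, and \<open>K\<close> is the support.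
  All derivatives are taken within \<open>DD\<close>, so that they are continuous up to y = 0.
\<close>

locale test_function =
  fixes \<tau> :: real and w :: "'n::finite pt \<times> real \<Rightarrow> real"
  assumes test: "test_fun 4 \<tau> w"
begin

definition DD :: "('n pt \<times> real) set" where "DD = {X. 0 \<le> snd X} \<times> {0..}"
definition D0 :: "('n pt \<times> real) set" where "D0 = half_space \<times> {0<..}"
definition K where "K = closure {p \<in> DD. w p \<noteq> 0}"

definition F where "F f p = frechet_derivative f (at p within DD)"
definition W1 where "W1 e = pderiv_within DD e w"
definition W2 where "W2 e1 e2 = pderiv_within DD e2 (W1 e1)"

lemma open_D0: "open D0" unfolding D0_def by (intro open_Times open_half_space) simp
lemma D0_DD: "p \<in> D0 \<Longrightarrow> p \<in> DD" by (auto simp: D0_def DD_def half_space_def)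
lemma at_D0: "p \<in> D0 \<Longrightarrow> at p within DD = at p"
  by (rule at_within_open_subset[OF _ open_D0]) (auto intro: D0_DD)

lemma Ck: "Ck_on (Suc (Suc (Suc 0))) DD w"
  and K_sub: "K \<subseteq> {X. norm X < 4 \<and> 0 \<le> snd X} \<times> {0..<\<tau>}"
  using test unfolding test_fun_def Let_def smooth_upto_def DD_def[symmetric] K_def by blast+

lemma diff_w: "w differentiable_on DD" using Ck by simp
lemma diff_W1: "e \<in> Basis \<Longrightarrow> W1 e differentiable_on DD" using Ck by (simp add: W1_def)
lemma diff_W2: "e1 \<in> Basis \<Longrightarrow> e2 \<in> Basis \<Longrightarrow> W2 e1 e2 differentiable_on DD"
  using Ck by (simp add: W1_def W2_def)

lemma has_F: "f differentiable_on DD \<Longrightarrow> p \<in> DD \<Longrightarrow> (f has_derivative F f p) (at p within DD)"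
  unfolding F_def differentiable_on_def by (simp add: frechet_derivative_works)

end

context test_function begin

lemma F_lin: "f differentiable_on DD \<Longrightarrow> p \<in> DD \<Longrightarrow> linear (F f p)"
  by (rule has_derivative_linear[OF has_F])

lemma has_F0: "f differentiable_on DD \<Longrightarrow> p \<in> D0 \<Longrightarrow> (f has_derivative F f p) (at p)"
  using has_F[of f p] at_D0[of p] D0_DD[of p] by simp

lemma W1_F: "W1 e p = F w p e" and W2_F: "W2 e1 e2 p = F (W1 e1) p e2"
  by (simp_all add: W1_def W2_def F_def pderiv_within_def)

lemma cont_DD: "f differentiable_on DD \<Longrightarrow> continuous_on DD f" by (rule differentiable_imp_continuous_on)

lemma Basis_X: "b \<in> Basis \<Longrightarrow> (b, 0) \<in> (Basis :: ('n pt \<times> real) set)" for b :: "'n pt"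
  unfolding Basis_prod_def[where 'a = "'n pt" and 'b = real] by (rule UnI1[OF imageI])

lemma Basis_T: "(0, 1) \<in> (Basis :: ('n pt \<times> real) set)" by (simp add: Basis_prod_def)

text \<open>
  Each point of \<open>DD\<close> can be moved inside \<open>DD\<close> in every positive coordinate direction.
\<close>

lemma F_unique:
  assumes p: "p \<in> DD" and 1: "(f has_derivative f') (at p within DD)" and 2: "(f has_derivative f'') (at p within DD)"
  shows "f' = f''"
proof (rule frechet_derivative_unique_within[OF 1 2])
  fix i :: "'n pt \<times> real" and e :: real assume i: "i \<in> Basis" and e: "0 < e"
  have "0 \<le> snd (fst i)" "0 \<le> snd i" using i by (auto simp: Basis_prod_def)
  then have "p + (e/2) *\<^sub>R i \<in> DD" using p e by (auto simp: DD_def mem_Times_iff)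
  then show "\<exists>d. 0 < \<bar>d\<bar> \<and> \<bar>d\<bar> < e \<and> p + d *\<^sub>R i \<in> DD" using e by (intro exI[of _ "e/2"]) auto
qed

definition vanishes :: "('n pt \<times> real \<Rightarrow> real) \<Rightarrow> bool" where "vanishes f \<longleftrightarrow> (\<forall>p\<in>DD - K. f p = 0)"

lemma F_vanishes:
  assumes d: "f differentiable_on DD" and v: "vanishes f" and p: "p \<in> DD - K"
  shows "F f p = (\<lambda>_. 0)"
proof -
  have "open (- K)" unfolding K_def by (rule open_Compl[OF closed_closure])
  then obtain r where r: "0 < r" "ball p r \<subseteq> - K" using p by (meson ComplI DiffD2 openE)
  have "((\<lambda>_. 0) has_derivative (\<lambda>_. 0)) (at p within DD)" by simp
  then have "(f has_derivative (\<lambda>_. 0)) (at p within DD)"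
    by (rule has_derivative_transform_within[OF _ r(1)]) (use p v r(2) in \<open>auto simp: vanishes_def dist_commute\<close>)
  then show ?thesis using F_unique[OF _ has_F[OF d]] p by blast
qed

lemma vanishes_w: "vanishes w"
  using closure_subset[of "{p \<in> DD. w p \<noteq> 0}"] by (auto simp: vanishes_def K_def)
lemma vanishes_W1: "e \<in> Basis \<Longrightarrow> vanishes (W1 e)"
  using F_vanishes[OF diff_w vanishes_w] by (simp add: vanishes_def W1_F)
lemma vanishes_W2: "e1 \<in> Basis \<Longrightarrow> e2 \<in> Basis \<Longrightarrow> vanishes (W2 e1 e2)"
  using F_vanishes[OF diff_W1 vanishes_W1] by (simp add: vanishes_def W2_F)

lemma outside_K: "p \<in> DD \<Longrightarrow> 4 \<le> norm (fst p) \<or> \<tau> \<le> snd p \<Longrightarrow> p \<in> DD - K"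
  using K_sub by auto

lemma line_derivative:
  assumes "(f has_derivative f') (at p)"
  shows "((\<lambda>r. f (p + r *\<^sub>R e)) has_real_derivative f' e) (at 0)"
proof -
  have "((\<lambda>r. f (p + r *\<^sub>R e)) has_derivative (\<lambda>r. f' (r *\<^sub>R e))) (at 0)"
    using assms by (intro has_derivative_compose[of "\<lambda>r. p + r *\<^sub>R e" _ 0 UNIV f f']) (auto intro!: derivative_eq_intros)
  then show ?thesis
    using has_derivative_linear[OF assms] by (simp add: has_field_derivative_def linear_cmul mult_commute_abs)
qed

lemma W2_sym:
  assumes e: "e1 \<in> Basis" "e2 \<in> Basis" and p: "p \<in> D0"
  shows "W2 e1 e2 p = W2 e2 e1 p"
proof (rule mixed_derivatives_commute[OF open_D0 p, where f = w and fu = "W1 e1" and fv = "W1 e2" and u = e1 and v = e2])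
  show "isCont (W2 e1 e2) p" "isCont (W2 e2 e1) p"
    using has_derivative_continuous[OF has_F0[OF diff_W2 p]] e by auto
qed (use line_derivative[OF has_F0[OF diff_w]] line_derivative[OF has_F0[OF diff_W1]] e in \<open>simp_all add: W1_F[symmetric] W2_F[symmetric]\<close>)

definition g where "g p = (\<Sum>b\<in>Basis. W1 (b, 0) p *\<^sub>R b)" for p :: "'n pt \<times> real"
definition gt where "gt = W1 (0, 1)"
definition g' where "g' p h = (\<Sum>b\<in>Basis. F (W1 (b, 0)) p h *\<^sub>R b)" for p :: "'n pt \<times> real"
definition gt' where "gt' = F (W1 (0, 1))"

lemma g_Basis: "b \<in> Basis \<Longrightarrow> g p \<bullet> b = W1 (b, 0) p"
  by (simp add: g_def inner_sum_left inner_Basis if_distrib cong: if_cong)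

lemma snd_g: "snd (g p) = W1 ((0, 1), 0) p"
  using g_Basis[of "(0, 1)" p] by (simp add: Basis_prod_def inner_prod_def)

lemma F_X:
  assumes d: "f differentiable_on DD" and p: "p \<in> DD"
  shows "F f p (v, 0) = (\<Sum>b\<in>Basis. (v \<bullet> b) * F f p (b, 0))"
  by (rule linear_expand_fst[OF F_lin[OF d p]])

lemma F_split:
  assumes d: "f differentiable_on DD" and p: "p \<in> DD"
  shows "F f p h = F f p (fst h, 0) + F f p (0, 1) * snd h"
proof -
  have "h = (fst h, 0) + snd h *\<^sub>R (0, 1)" by simp
  then have "F f p h = F f p ((fst h, 0) + snd h *\<^sub>R (0, 1))" by simp
  also have "\<dots> = F f p (fst h, 0) + F f p (0, 1) * snd h"
    by (simp only: linear_add[OF F_lin[OF d p]] linear_scale[OF F_lin[OF d p]]) simp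
  finally show ?thesis .
qed

lemma F_w: "p \<in> DD \<Longrightarrow> F w p h = g p \<bullet> fst h + gt p * snd h"
  unfolding F_split[OF diff_w, of p h] F_X[OF diff_w, of p "fst h"]
  by (simp add: g_def gt_def W1_F inner_sum_left inner_commute[of "fst h"] mult.commute[of "_ \<bullet> fst h"])

lemma w_derivative:
  assumes "p \<in> D0" shows "(w has_derivative (\<lambda>h. g p \<bullet> fst h + gt p * snd h)) (at p)"
  by (rule has_derivative_eq_rhs[OF has_F0[OF diff_w assms]]) (rule ext, rule F_w[OF D0_DD[OF assms]])

lemma gt_derivative: "p \<in> D0 \<Longrightarrow> (gt has_derivative gt' p) (at p)"
  unfolding gt_def gt'_def by (rule has_F0[OF diff_W1[OF Basis_T]])

lemma g_derivative:
  assumes "p \<in> D0" shows "(g has_derivative g' p) (at p)"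
  unfolding g_def[abs_def] g'_def[abs_def]
  by (rule has_derivative_sum, rule has_derivative_scaleR_left, rule has_F0[OF diff_W1[OF Basis_X] assms])

lemma g'_inner: "p \<in> DD \<Longrightarrow> u \<bullet> g' p h = (\<Sum>b\<in>Basis. (u \<bullet> b) * F (W1 (b, 0)) p h)"
  by (simp add: g'_def inner_sum_right mult.commute)

lemma g'_sym:
  assumes p: "p \<in> D0" shows "u \<bullet> g' p (v, 0) = v \<bullet> g' p (u, 0)"
proof -
  note pD = D0_DD[OF p]
  have "u \<bullet> g' p (v, 0) = (\<Sum>b\<in>Basis. \<Sum>e\<in>Basis. (u \<bullet> b) * ((v \<bullet> e) * W2 (b, 0) (e, 0) p))" for u v
    unfolding g'_inner[OF pD]
    by (intro sum.cong refl, subst F_X[OF diff_W1[OF Basis_X] pD, of _ v]) (simp_all add: W2_F sum_distrib_left)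
  note eq = this
  have "u \<bullet> g' p (v, 0) = (\<Sum>e\<in>Basis. \<Sum>b\<in>Basis. (u \<bullet> b) * ((v \<bullet> e) * W2 (b, 0) (e, 0) p))"
    unfolding eq by (rule sum.swap)
  also have "\<dots> = v \<bullet> g' p (u, 0)"
    unfolding eq by (intro sum.cong refl) (simp add: W2_sym[OF Basis_X Basis_X p])
  finally show ?thesis .
qed

lemma gt'_sym:
  assumes p: "p \<in> D0" shows "gt' p (v, 0) = v \<bullet> g' p (0, 1)"
proof -
  note pD = D0_DD[OF p]
  have "gt' p (v, 0) = (\<Sum>b\<in>Basis. (v \<bullet> b) * W2 (0, 1) (b, 0) p)"
    unfolding gt'_def W2_F by (rule F_X[OF diff_W1[OF Basis_T] pD])
  also have "\<dots> = (\<Sum>b\<in>Basis. (v \<bullet> b) * W2 (b, 0) (0, 1) p)"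
    by (intro sum.cong refl) (simp add: W2_sym[OF Basis_X Basis_T p])
  finally show ?thesis unfolding g'_inner[OF pD] W2_F .
qed

lemma cont_g: "continuous_on DD g"
  unfolding g_def[abs_def] by (intro continuous_on_sum continuous_on_scaleR continuous_on_const cont_DD diff_W1 Basis_X)

lemma boundary_limit:
  assumes "continuous_on DD f" "0 \<le> t"
  shows "((\<lambda>y. f ((x, y), t)) \<longlongrightarrow> f ((x, 0), t)) (at_right 0)"
proof -
  have "continuous_on {0..} (\<lambda>y. f ((x, y), t))"
    by (rule continuous_on_compose2[OF assms(1)]) (use assms(2) in \<open>auto simp: DD_def intro!: continuous_intros\<close>)
  then have "((\<lambda>y. f ((x, y), t)) \<longlongrightarrow> f ((x, 0), t)) (at 0 within {0..})"
    by (auto simp: continuous_on_def)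
  then show ?thesis by (rule tendsto_within_subset) auto
qed

lemma deriv_normal:
  assumes "0 < y" "0 < t"
  shows "deriv (\<lambda>z. w ((x, z), t)) y = W1 ((0, 1), 0) ((x, y), t)"
proof -
  have p: "((x, y), t) \<in> D0" using assms by (simp add: D0_def half_space_def)
  have "((\<lambda>r. w (((x, y), t) + r *\<^sub>R ((0, 1), 0))) has_real_derivative W1 ((0, 1), 0) ((x, y), t)) (at 0)"
    using line_derivative[OF has_F0[OF diff_w p], of "((0, 1), 0)"] by (simp add: W1_F)
  then have "((\<lambda>r. w ((x, y + r), t)) has_real_derivative W1 ((0, 1), 0) ((x, y), t)) (at 0)" by simp
  then have "((\<lambda>z. w ((x, z), t)) has_real_derivative W1 ((0, 1), 0) ((x, y), t)) (at y)"
    using DERIV_shift[of "\<lambda>z. w ((x, z), t)" _ 0 y] by (simp add: add.commute)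
  then show ?thesis by (rule DERIV_imp_deriv)
qed

lemma eY: "((0, 1), 0) \<in> (Basis :: ('n pt \<times> real) set)" by (rule Basis_X) (simp add: Basis_prod_def)

lemma normal_limit:
  assumes "0 < t" "has_weighted_normal_deriv a w x t l"
  shows "((\<lambda>y. y powr a * W1 ((0, 1), 0) ((x, y), t)) \<longlongrightarrow> l) (at_right 0)"
  using assms(2) unfolding has_weighted_normal_deriv_def
  by (rule Lim_transform_eventually) (use assms(1) in \<open>auto simp: eventually_at_filter deriv_normal\<close>)

text \<open>
  \<partial>_y w is the product of y^(-a), which tends to 0, and of y^a \<partial>_y w, which has a finite limit.
\<close>

lemma normal_zero:
  assumes a: "a < 0" and t: "0 < t" and l: "t < \<tau> \<Longrightarrow> has_weighted_normal_deriv a w x t l"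
  shows "W1 ((0, 1), 0) ((x, 0), t) = 0"
proof (cases "t < \<tau>")
  case True
  have "((\<lambda>y. y powr (- a)) \<longlongrightarrow> 0 powr (- a)) (at_right 0)"
    by (rule tendsto_powr'[OF tendsto_ident_at tendsto_const]) (use a in \<open>auto simp: eventually_at_filter\<close>)
  then have "((\<lambda>y. y powr (- a)) \<longlongrightarrow> 0) (at_right 0)" by simp
  from tendsto_mult[OF this normal_limit[OF t l[OF True]]]
  have "((\<lambda>y. y powr (- a) * (y powr a * W1 ((0, 1), 0) ((x, y), t))) \<longlongrightarrow> 0 * l) (at_right 0)" .
  then have "((\<lambda>y. W1 ((0, 1), 0) ((x, y), t)) \<longlongrightarrow> 0 * l) (at_right 0)"
    by (rule Lim_transform_eventually) (auto simp: eventually_at_filter powr_minus)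
  from tendsto_unique[OF _ this boundary_limit[OF cont_DD[OF diff_W1[OF eY]]]] show ?thesis using t by simp
next
  case False
  then have "((x, 0), t) \<in> DD - K" using t by (intro outside_K) (auto simp: DD_def)
  then show ?thesis using vanishes_W1[OF eY] by (simp add: vanishes_def)
qed

end

context test_function begin

lemma grad_X_eq:
  assumes p: "(X, t) \<in> D0" shows "grad_X w X t = g (X, t)"
proof -
  have "((\<lambda>Y. w (Y, t)) has_derivative (\<lambda>h. g (X, t) \<bullet> h)) (at X)"
    using has_derivative_compose[OF has_derivative_Pair[OF has_derivative_ident has_derivative_const],
      of w "\<lambda>h. g (X, t) \<bullet> fst h + gt (X, t) * snd h" X t UNIV] w_derivative[OF p] by simp
  then have 1: "GDERIV (\<lambda>Y. w (Y, t)) X :> g (X, t)" by (simp add: gderiv_def inner_commute)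
  show ?thesis
    unfolding grad_X_def grad_def
  proof (rule the_equality)
    show "GDERIV (\<lambda>Y. w (Y, t)) X :> g (X, t)" by (rule 1)
    fix D :: "'n pt" assume "GDERIV (\<lambda>Y. w (Y, t)) X :> D"
    then have "(\<lambda>h. h \<bullet> D) = (\<lambda>h. h \<bullet> g (X, t))"
      using 1 unfolding gderiv_def by (rule has_derivative_unique)
    then have "(D - g (X, t)) \<bullet> D = (D - g (X, t)) \<bullet> g (X, t)" by (rule fun_cong)
    then have "(D - g (X, t)) \<bullet> (D - g (X, t)) = 0" by (simp only: inner_diff_right)
    then show "D = g (X, t)" using inner_eq_zero_iff[of "D - g (X, t)"] by simp
  qed
qed

lemma ext_op_eq:
  assumes p: "(X, t) \<in> D0"
  shows "ext_op a w X t = snd X powr a *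
    (gt (X, t) + (\<Sum>b\<in>Basis. g' (X, t) (b, 0) \<bullet> b) + a * snd (g (X, t)) / snd X)"
proof -
  have X: "X \<in> half_space" and t: "0 < t" and y: "0 < snd X" using p by (auto simp: D0_def half_space_def)
  have "((\<lambda>\<tau>. w (X, \<tau>)) has_derivative (\<lambda>h. gt (X, t) * h)) (at t)"
    using has_derivative_compose[OF has_derivative_Pair[OF has_derivative_const has_derivative_ident],
      of w "\<lambda>h. g (X, t) \<bullet> fst h + gt (X, t) * snd h" X t UNIV] w_derivative[OF p] by simp
  then have 1: "deriv (\<lambda>\<tau>. w (X, \<tau>)) t = gt (X, t)"
    by (intro DERIV_imp_deriv) (simp add: has_field_derivative_def)
  have 2: "((\<lambda>Y. g (Y, t)) has_derivative (\<lambda>h. g' (X, t) (h, 0))) (at X)"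
    using has_derivative_compose[OF has_derivative_Pair[OF has_derivative_ident has_derivative_const],
      of g "g' (X, t)" X t UNIV] g_derivative[OF p] by simp
  have 3: "((\<lambda>Y. snd Y powr a) has_derivative (\<lambda>h. a * (snd X powr a / snd X) * snd h)) (at X)"
    using y by (auto intro!: derivative_eq_intros simp: powr_diff field_simps)
  note 4 = has_derivative_scaleR[OF 3 2]
  have "((\<lambda>Y. snd Y powr a *\<^sub>R grad_X w Y t) has_derivative
      (\<lambda>h. snd X powr a *\<^sub>R g' (X, t) (h, 0) + (a * (snd X powr a / snd X) * snd h) *\<^sub>R g (X, t))) (at X)"
    by (rule has_derivative_transform_within_open[OF 4 open_half_space X])
       (use t in \<open>auto simp: grad_X_eq D0_def\<close>)
  then have 5: "frechet_derivative (\<lambda>Y. snd Y powr a *\<^sub>R grad_X w Y t) (at X) =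
      (\<lambda>h. snd X powr a *\<^sub>R g' (X, t) (h, 0) + (a * (snd X powr a / snd X) * snd h) *\<^sub>R g (X, t))"
    by (rule frechet_derivative_at[symmetric])
  have "(\<Sum>b\<in>Basis. snd b * (g (X, t) \<bullet> b)) = snd (\<Sum>b\<in>Basis. (g (X, t) \<bullet> b) *\<^sub>R b)"
    by (simp add: snd_sum mult.commute)
  then have 6: "(\<Sum>b\<in>Basis. snd b * (g (X, t) \<bullet> b)) = snd (g (X, t))" by (simp add: euclidean_representation)
  have "divergence (\<lambda>Y. snd Y powr a *\<^sub>R grad_X w Y t) X =
     snd X powr a * (\<Sum>b\<in>Basis. g' (X, t) (b, 0) \<bullet> b) + (a * (snd X powr a / snd X)) * (\<Sum>b\<in>Basis. snd b * (g (X, t) \<bullet> b))"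
    unfolding divergence_def 5 by (simp add: inner_add_left sum.distrib sum_distrib_left mult_ac)
  then show ?thesis unfolding ext_op_def 1 6 using y by (simp add: algebra_simps)
qed

lemma g_vanishes: "p \<in> DD - K \<Longrightarrow> g p = 0"
  using vanishes_W1[OF Basis_X] by (simp add: g_def vanishes_def)

end

locale test_function_slab = test_function \<tau> w + slab dim a c \<tau>
  for dim :: "'n::finite itself" and a c \<tau> :: real and w :: "'n pt \<times> real \<Rightarrow> real"
begin

lemma S_D0: "p \<in> S \<Longrightarrow> p \<in> D0" using c by (auto simp: S_def D0_def)
lemma S_DD: "p \<in> S \<Longrightarrow> p \<in> DD" by (rule D0_DD[OF S_D0])

lemma tame_DD:
  fixes f :: "'n pt \<times> real \<Rightarrow> 'b::real_normed_vector"
  assumes f: "continuous_on DD f" shows "tame f"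
proof -
  define Q where "Q = (cball 0 4 \<inter> {X::'n pt. 0 \<le> snd X}) \<times> {c..\<tau>}"
  have "closed {X::'n pt. 0 \<le> snd X}" by (intro closed_Collect_le continuous_intros)
  then have "compact Q" unfolding Q_def by (intro compact_Times compact_Int_closed) auto
  moreover have "continuous_on Q f" by (rule continuous_on_subset[OF f]) (use c in \<open>auto simp: Q_def DD_def\<close>)
  ultimately have "bounded (f ` Q)" by (intro compact_imp_bounded compact_continuous_image)
  then obtain C where C: "\<And>p. p \<in> Q \<Longrightarrow> norm (f p) \<le> C" by (auto simp: bounded_iff)
  show ?thesis
  proof (rule tameI)
    show "continuous_on S f" by (rule continuous_on_subset[OF f]) (auto intro: S_DD)
    show "norm (f p) \<le> C" if "p \<in> S" "norm (fst p) \<le> 4" for p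
      by (rule C) (use that S_D[OF that(1)] in \<open>auto simp: Q_def mem_Times_iff\<close>)
  qed
qed

lemma adm_DD:
  assumes "f differentiable_on DD" "vanishes f" shows "adm f"
  unfolding adm_def
  using tame_DD[OF cont_DD[OF assms(1)]] assms(2) outside_K[OF S_DD] by (auto simp: vanishes_def)

lemma adm_W1: "e \<in> Basis \<Longrightarrow> adm (W1 e)"
  by (rule adm_DD[OF diff_W1 vanishes_W1])
lemma adm_W2: "e1 \<in> Basis \<Longrightarrow> e2 \<in> Basis \<Longrightarrow> adm (W2 e1 e2)"
  by (rule adm_DD[OF diff_W2 vanishes_W2])

lemma adm_sum_Basis:
  assumes "\<And>b. b \<in> Basis \<Longrightarrow> adm (f b)"
  shows "adm (\<lambda>p. \<Sum>b\<in>Basis. f b p *\<^sub>R (b::'n pt))"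
proof -
  have 1: "adm (\<lambda>p. f b p *\<^sub>R b)" if "b \<in> Basis" for b using assms[OF that] by (rule adm_scaleR1) simp
  show ?thesis by (rule adm_sum[OF 1])
qed

text \<open>
  A y-derivative that vanishes at y = 0 is bounded by a multiple of y, by the mean value theorem; so
  the singular coefficient a/y of the operator is harmless.
\<close>

lemma normal_quotient_adm:
  assumes z: "\<And>x t. t \<in> {c..\<tau>} \<Longrightarrow> a \<noteq> 0 \<Longrightarrow> W1 ((0, 1), 0) ((x, 0), t) = 0"
  shows "adm (\<lambda>p. a * snd (g p) / snd (fst p))"
    and "a \<noteq> 0 \<Longrightarrow> \<exists>C. \<forall>p\<in>S. \<bar>snd (g p)\<bar> \<le> C * snd (fst p)"
proof -
  obtain C where C: "\<And>p. p \<in> S \<Longrightarrow> norm (W2 ((0,1),0) ((0,1),0) p) \<le> C"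
    by (rule adm_bounded[OF adm_W2[OF eY eY]]) blast
  have lip: "\<bar>snd (g p)\<bar> \<le> C * snd (fst p)" if p: "p \<in> S" and a: "a \<noteq> 0" for p
  proof -
    obtain x y t where pe: "p = ((x, y), t)" by (metis prod.collapse)
    have y: "0 < y" and t: "t \<in> {c..\<tau>}" "0 < t" using S_D[OF p] by (auto simp: pe)
    have contW: "continuous_on {0..y} (\<lambda>y. W1 ((0, 1), 0) ((x, y), t))"
      by (rule continuous_on_compose2[OF cont_DD[OF diff_W1[OF eY]]])
         (use t in \<open>auto simp: DD_def intro!: continuous_intros\<close>)
    have d: "((\<lambda>y. W1 ((0, 1), 0) ((x, y), t)) has_real_derivative W2 ((0, 1), 0) ((0, 1), 0) ((x, z), t)) (at z)"
      if "0 < z" for z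
    proof -
      have q: "((x, z), t) \<in> D0" using that t by (simp add: D0_def half_space_def)
      have "((\<lambda>r. W1 ((0, 1), 0) (((x, z), t) + r *\<^sub>R ((0, 1), 0))) has_real_derivative W2 ((0, 1), 0) ((0, 1), 0) ((x, z), t)) (at 0)"
        using line_derivative[OF has_F0[OF diff_W1[OF eY] q], of "((0, 1), 0)"] by (simp add: W2_F)
      then have "((\<lambda>r. W1 ((0, 1), 0) ((x, z + r), t)) has_real_derivative W2 ((0, 1), 0) ((0, 1), 0) ((x, z), t)) (at 0)"
        by simp
      then show ?thesis using DERIV_shift[of "\<lambda>z. W1 ((0, 1), 0) ((x, z), t)" _ 0 z] by (simp add: add.commute)
    qed
    have "\<exists>l z. 0 < z \<and> z < y \<and> DERIV (\<lambda>y. W1 ((0, 1), 0) ((x, y), t)) z :> l \<and>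
        W1 ((0, 1), 0) ((x, y), t) - W1 ((0, 1), 0) ((x, 0), t) = (y - 0) * l"
      by (rule MVT[OF y contW]) (use d in \<open>auto simp: real_differentiable_def\<close>)
    then obtain l z where z': "0 < z" "z < y" "DERIV (\<lambda>y. W1 ((0, 1), 0) ((x, y), t)) z :> l"
      "W1 ((0, 1), 0) ((x, y), t) = y * l"
      using z[OF t(1) a] by auto
    have "l = W2 ((0, 1), 0) ((0, 1), 0) ((x, z), t)" using DERIV_unique[OF z'(3) d[OF z'(1)]] .
    moreover have "((x, z), t) \<in> S" using z'(1) t by (simp add: S_def half_space_def)
    ultimately have "\<bar>l\<bar> \<le> C" using C by force
    then show ?thesis unfolding snd_g pe using z'(4) y by (simp add: abs_mult mult.commute mult_left_mono)
  qed
  then show "\<exists>C. \<forall>p\<in>S. \<bar>snd (g p)\<bar> \<le> C * snd (fst p)" if "a \<noteq> 0" using that by blast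
  show "adm (\<lambda>p. a * snd (g p) / snd (fst p))"
  proof (cases "a = 0")
    case False
    have "tame (\<lambda>p. a * snd (g p) / snd (fst p))"
    proof (rule tameI)
      have "continuous_on S (\<lambda>p. W1 ((0, 1), 0) p)" using adm_W1[OF eY] by (simp add: adm_def tame_def)
      then show "continuous_on S (\<lambda>p. a * snd (g p) / snd (fst p))"
        unfolding snd_g by (intro continuous_on_divide continuous_on_mult continuous_on_const continuous_on_snd continuous_on_fst continuous_on_id)
          (auto dest: S_D)
      show "norm (a * snd (g p) / snd (fst p)) \<le> \<bar>a\<bar> * C" if "p \<in> S" for p
      proof -
        have "\<bar>snd (g p)\<bar> / snd (fst p) \<le> C" using lip[OF that False] S_D[OF that] by (simp add: divide_le_eq)
        then have "\<bar>a\<bar> * (\<bar>snd (g p)\<bar> / snd (fst p)) \<le> \<bar>a\<bar> * C" by (rule mult_left_mono) simp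
        then show ?thesis using S_D[OF that] by (simp add: abs_mult)
      qed
    qed
    then show ?thesis
      using outside_K[OF S_DD] g_vanishes by (auto simp: adm_def)
  qed simp
qed

lemma is_jet:
  assumes z: "\<And>x t. t \<in> {c..\<tau>} \<Longrightarrow> a \<noteq> 0 \<Longrightarrow> W1 ((0, 1), 0) ((x, 0), t) = 0"
    and q: "\<And>x t. t \<in> {c..\<tau>} \<Longrightarrow> ((\<lambda>y. y powr a * W1 ((0, 1), 0) ((x, y), t)) \<longlongrightarrow> q x t) (at_right 0)"
  shows "jet a c \<tau> w gt g gt' g' (\<lambda>x t. w ((x, 0), t)) (\<lambda>x t. gt ((x, 0), t) + ((x, 0) \<bullet> g ((x, 0), t)) / (2 * t)) q"
proof (unfold_locales)
  show "adm w" by (rule adm_DD[OF diff_w vanishes_w])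
  show "adm gt" unfolding gt_def by (rule adm_W1[OF Basis_T])
  show "adm g" unfolding g_def[abs_def] by (rule adm_sum_Basis[OF adm_W1[OF Basis_X]])
  show "adm (\<lambda>p. gt' p b)" if "b \<in> Basis" for b
    using adm_W2[OF Basis_T that] by (simp add: gt'_def W2_F[abs_def])
  show "adm (\<lambda>p. g' p b)" if "b \<in> Basis" for b
    unfolding g'_def using adm_sum_Basis[OF adm_W2[OF Basis_X that]] by (simp add: W2_F)
  show "adm (\<lambda>p. a * snd (g p) / snd (fst p))" by (rule normal_quotient_adm(1)[OF z])
  show "w (X, \<tau>) = 0 \<and> g (X, \<tau>) = 0" if "X \<in> half_space" for X
  proof -
    have "(X, \<tau>) \<in> DD - K" using that c cd by (intro outside_K) (auto simp: DD_def half_space_def)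
    then show ?thesis using vanishes_w g_vanishes by (simp add: vanishes_def)
  qed
  fix x :: "real^'n" and t assume t: "t \<in> {c..\<tau>}"
  then have t0: "0 \<le> t" "0 < t" using c by auto
  show "((\<lambda>y. w ((x, y), t)) \<longlongrightarrow> w ((x, 0), t)) (at_right 0)"
    by (rule boundary_limit[OF cont_DD[OF diff_w] t0(1)])
  show "((\<lambda>y. gt ((x, y), t) + ((x, y) \<bullet> g ((x, y), t)) / (2 * t)) \<longlongrightarrow>
      gt ((x, 0), t) + ((x, 0) \<bullet> g ((x, 0), t)) / (2 * t)) (at_right 0)"
    by (intro tendsto_add tendsto_divide tendsto_inner tendsto_const tendsto_Pair tendsto_ident_at
      boundary_limit[OF _ t0(1)] cont_g cont_DD[OF diff_W1[OF Basis_T, folded gt_def]]) (use t0 in simp)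
  show "((\<lambda>y. y powr a * snd (g ((x, y), t))) \<longlongrightarrow> q x t) (at_right 0)"
    unfolding snd_g by (rule q[OF t])
qed (simp_all add: w_derivative gt_derivative g_derivative g'_sym gt'_sym S_D0)

text \<open>
  The flux is of size y^(1+a), and 1 + a > 0.
\<close>

lemma flux_zero:
  assumes a: "a < 0" and t: "t \<in> {c..\<tau>}"
    and z: "\<And>x t. t \<in> {c..\<tau>} \<Longrightarrow> a \<noteq> 0 \<Longrightarrow> W1 ((0, 1), 0) ((x, 0), t) = 0"
    and a1: "-1 < a"
  shows "((\<lambda>y. y powr a * W1 ((0, 1), 0) ((x, y), t)) \<longlongrightarrow> 0) (at_right 0)"
proof -
  obtain C where C: "\<And>p. p \<in> S \<Longrightarrow> \<bar>snd (g p)\<bar> \<le> C * snd (fst p)"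
    using normal_quotient_adm(2)[OF z] a by blast
  have "((\<lambda>y. C * y powr (1 + a)) \<longlongrightarrow> C * 0 powr (1 + a)) (at_right 0)"
    by (rule tendsto_mult[OF tendsto_const tendsto_powr'[OF tendsto_ident_at tendsto_const]])
       (use a1 in \<open>auto simp: eventually_at_filter\<close>)
  then have l: "((\<lambda>y. C * y powr (1 + a)) \<longlongrightarrow> 0) (at_right 0)" using a1 by simp
  show ?thesis
  proof (rule Lim_null_comparison[OF _ l])
    show "\<forall>\<^sub>F y in at_right 0. norm (y powr a * W1 ((0, 1), 0) ((x, y), t)) \<le> C * y powr (1 + a)"
      unfolding eventually_at_filter
    proof (intro always_eventually allI impI)
      fix y :: real assume "y \<in> {0<..}"
      then have y: "0 < y" and p: "((x, y), t) \<in> S" using t by (auto simp: S_def half_space_def)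
      have "y powr a * \<bar>W1 ((0, 1), 0) ((x, y), t)\<bar> \<le> y powr a * (C * y)"
        using C[OF p] by (intro mult_left_mono) (auto simp: snd_g)
      also have "\<dots> = C * y powr (1 + a)" using y by (simp add: powr_add)
      finally show "norm (y powr a * W1 ((0, 1), 0) ((x, y), t)) \<le> C * y powr (1 + a)" by (simp add: abs_mult)
    qed
  qed
qed

end

section \<open>The potential\<close>

lemma C2_potential:
  fixes V :: "'a::euclidean_space \<Rightarrow> real"
  assumes V: "Ck_on 2 Q V" and n: "Ck_norm 2 Q V \<le> 1"
  shows "p \<in> Q \<Longrightarrow> \<bar>V p\<bar> \<le> 1"
    and "p \<in> Q \<Longrightarrow> i \<in> Basis \<Longrightarrow> \<bar>frechet_derivative V (at p within Q) i\<bar> \<le> 1"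
    and "V differentiable_on Q"
    and "i \<in> Basis \<Longrightarrow> continuous_on Q (\<lambda>p. frechet_derivative V (at p within Q) i)"
proof -
  have b: "\<bar>foldr (pderiv_within Q) bs V p\<bar> \<le> 1" if "set bs \<subseteq> Basis" "length bs \<le> 2" "p \<in> Q" for bs p
  proof -
    have "ennreal \<bar>foldr (pderiv_within Q) bs V p\<bar> \<le> Ck_norm 2 Q V"
      unfolding Ck_norm_def by (rule SUP_upper2[of bs]) (use that in \<open>auto intro: SUP_upper\<close>)
    also have "\<dots> \<le> ennreal 1" using n by simp
    finally show ?thesis by simp
  qed
  show "\<bar>V p\<bar> \<le> 1" if "p \<in> Q" using b[of "[]" p] that by simp
  show "\<bar>frechet_derivative V (at p within Q) i\<bar> \<le> 1" if "p \<in> Q" "i \<in> Basis"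
    using b[of "[i]" p] that by (simp add: pderiv_within_def)
  have "Ck_on (Suc (Suc 0)) Q V" using V by (simp add: numeral_2_eq_2)
  then show "V differentiable_on Q"
    and "i \<in> Basis \<Longrightarrow> continuous_on Q (\<lambda>p. frechet_derivative V (at p within Q) i)"
    by (auto simp: pderiv_within_def[abs_def] intro: differentiable_imp_continuous_on)
qed

lemma linear_bound_Basis:
  fixes f :: "'a::euclidean_space \<Rightarrow> real"
  assumes "linear f" "\<And>i. i \<in> Basis \<Longrightarrow> \<bar>f i\<bar> \<le> 1"
  shows "\<bar>f h\<bar> \<le> (\<Sum>i\<in>Basis. \<bar>h \<bullet> i\<bar>)"
proof -
  have "\<bar>f h\<bar> \<le> (\<Sum>i\<in>Basis. \<bar>(h \<bullet> i) * f i\<bar>)"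
    unfolding linear_expand_Basis[OF assms(1), of h] by simp
  also have "\<dots> \<le> (\<Sum>i\<in>Basis. \<bar>h \<bullet> i\<bar> * 1)"
    unfolding abs_mult by (intro sum_mono mult_left_mono assms(2)) auto
  finally show ?thesis by simp
qed

lemma sum_Basis_abs_pair:
  fixes x :: "real^'n"
  shows "(\<Sum>i\<in>Basis. \<bar>(x, s::real) \<bullet> i\<bar>) \<le> real CARD('n) * norm x + \<bar>s\<bar>"
proof -
  have "(\<Sum>i\<in>Basis. \<bar>(x, s) \<bullet> i\<bar>) = (\<Sum>i\<in>(Basis::(real^'n) set). \<bar>x \<bullet> i\<bar>) + \<bar>s\<bar>"
    by (simp add: Basis_prod_def sum.union_disjoint sum.reindex inj_on_def disjoint_iff image_iff sum.insert)
  also have "(\<Sum>i\<in>(Basis::(real^'n) set). \<bar>x \<bullet> i\<bar>) \<le> (\<Sum>i\<in>(Basis::(real^'n) set). norm x)"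
    by (intro sum_mono Basis_le_norm)
  finally show ?thesis by simp
qed

context test_function_slab
begin

lemma edge_boundary:
  assumes "continuous_on DD f" "vanishes f"
  shows "edge (\<lambda>p. f ((fst p, 0), snd p))"
  unfolding edge_def
proof (intro conjI allI ballI impI)
  show "continuous_on U (\<lambda>p. f ((fst p, 0), snd p))"
    by (rule continuous_on_compose2[OF assms(1)]) (use c in \<open>auto simp: U_def DD_def intro!: continuous_intros\<close>)
  fix x :: "real^'n" and t assume "t \<in> {c..\<tau>}" "4 \<le> norm x"
  then have "((x, 0), t) \<in> DD - K" using c by (intro outside_K) (auto simp: DD_def)
  then show "f ((fst (x, t), 0), snd (x, t)) = 0" using assms(2) by (simp add: vanishes_def)
qed

lemma gt_vanishes: "vanishes gt" unfolding gt_def by (rule vanishes_W1[OF Basis_T])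

lemma boundary_derivative:
  assumes p: "p \<in> U"
  shows "((\<lambda>p. w ((fst p, 0), snd p)) has_derivative (\<lambda>h. F w ((fst p, 0), snd p) ((fst h, 0), snd h))) (at p)"
proof -
  define N where "N = (UNIV :: (real^'n) set) \<times> {0::real<..}"
  have N: "open N" "p \<in> N" using p c by (auto simp: N_def U_def intro: open_Times)
  define \<iota> where "\<iota> p = ((fst p, 0::real), snd p)" for p :: "(real^'n) \<times> real"
  have 1: "(\<iota> has_derivative \<iota>) (at p within N)"
    unfolding \<iota>_def[abs_def] by (intro has_derivative_Pair has_derivative_fst has_derivative_snd has_derivative_ident has_derivative_const)
  have sub: "\<iota> ` N \<subseteq> DD" by (auto simp: \<iota>_def N_def DD_def)
  then have "\<iota> p \<in> DD" using N by auto
  from has_derivative_subset[OF has_F[OF diff_w this] sub]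
  have "((\<lambda>x. w (\<iota> x)) has_derivative (\<lambda>h. F w (\<iota> p) (\<iota> h))) (at p within N)"
    by (rule has_derivative_in_compose[OF 1])
  then show ?thesis using at_within_open[OF N(2,1)] by (simp add: \<iota>_def)
qed

text \<open>
  For s = 1/2 the boundary coefficient is b(x,t) = R V(R x + x0, R^2 t + t0).  A derivative in x costs R and a
  derivative in t costs R^2; along the dilations t Zb combines R |x| R and t R^3, both of size R^2 as R^2 t \<le> 1.
\<close>

lemma robin_of_potential:
  fixes V :: "(real^'n) \<times> real \<Rightarrow> real"
  assumes a0: "a = 0"
    and W: "weighted a c \<tau> w gt g gt' g' (\<lambda>x t. w ((x, 0), t))
        (\<lambda>x t. gt ((x, 0), t) + ((x, 0) \<bullet> g ((x, 0), t)) / (2 * t)) (\<lambda>x t. W1 ((0, 1), 0) ((x, 0), t)) \<alpha> P k \<theta>"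
    and V: "Ck_on 2 (UNIV \<times> {0..<T}) V" "Ck_norm 2 (UNIV \<times> {0..<T}) V \<le> 1"
    and R: "1 \<le> R" and t0: "0 \<le> t0" and rng: "R\<^sup>2 * \<tau> + t0 < T" "R\<^sup>2 * \<tau> \<le> 1"
    and bc: "\<And>x t. t \<in> {0..<\<tau>} \<Longrightarrow> has_weighted_normal_deriv a w x t (R * V (R *\<^sub>R x + x0, R\<^sup>2 * t + t0) * w ((x, 0), t))"
  shows "robin a c \<tau> w gt g gt' g' (\<lambda>x t. w ((x, 0), t))
        (\<lambda>x t. gt ((x, 0), t) + ((x, 0) \<bullet> g ((x, 0), t)) / (2 * t)) (\<lambda>x t. W1 ((0, 1), 0) ((x, 0), t)) \<alpha> P k \<theta>
        (\<lambda>p. R * V (R *\<^sub>R fst p + x0, R\<^sup>2 * snd p + t0))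
        (\<lambda>p h. R * frechet_derivative V (at (R *\<^sub>R fst p + x0, R\<^sup>2 * snd p + t0) within UNIV \<times> {0..<T}) (R *\<^sub>R fst h, R\<^sup>2 * snd h))
        (\<lambda>p h. F w ((fst p, 0), snd p) ((fst h, 0), snd h)) R ((2 * real CARD('n) + 1) * R\<^sup>2)"
proof -
  interpret weighted dim a c \<tau> w gt g gt' g' "\<lambda>x t. w ((x, 0), t)"
        "\<lambda>x t. gt ((x, 0), t) + ((x, 0) \<bullet> g ((x, 0), t)) / (2 * t)" "\<lambda>x t. W1 ((0, 1), 0) ((x, 0), t)" \<alpha> P k \<theta> by (rule W)
  define Q where "Q = (UNIV :: (real^'n) set) \<times> {0..<T}"
  define Q0 where "Q0 = (UNIV :: (real^'n) set) \<times> {0<..<T}"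
  define j where "j p = (R *\<^sub>R fst p + x0, R\<^sup>2 * snd p + t0)" for p :: "(real^'n) \<times> real"
  define DV where "DV q = frechet_derivative V (at q within Q)" for q
  note V2 = C2_potential[OF V, folded Q_def, folded DV_def]
  have Rp: "0 < R" using R by simp
  have jQ0: "j p \<in> Q0" if "p \<in> U" for p
  proof -
    have t: "0 < snd p" "snd p \<le> \<tau>" using that c by (auto simp: U_def)
    have "R\<^sup>2 * snd p \<le> R\<^sup>2 * \<tau>" using t by (intro mult_left_mono) auto
    moreover have "0 < R\<^sup>2 * snd p" using t Rp by simp
    ultimately show ?thesis using rng t0 by (simp add: j_def Q0_def)
  qed
  have oQ0: "open Q0" by (simp add: Q0_def open_Times)
  have jQ: "j p \<in> Q" if "p \<in> U" for p using jQ0[OF that] by (auto simp: Q_def Q0_def)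
  have derV: "(V has_derivative DV (j p)) (at (j p))" if "p \<in> U" for p
  proof -
    have "at (j p) within Q = at (j p)"
      by (rule at_within_open_subset[OF jQ0[OF that] oQ0]) (auto simp: Q_def Q0_def)
    then show ?thesis using V2(3) jQ[OF that] unfolding differentiable_on_def DV_def frechet_derivative_works by metis
  qed
  have lin: "linear (DV (j p))" if "p \<in> U" for p by (rule has_derivative_linear[OF derV[OF that]])
  have cj: "continuous_on U j" unfolding j_def[abs_def] by (intro continuous_intros)
  note simps = j_def[symmetric] DV_def[symmetric] Q_def[symmetric]
  show ?thesis
    unfolding simps
  proof (unfold_locales)
    show "a = 0" by (rule a0)
    show "0 < R" by (rule Rp)
    fix x :: "real^'n" and t assume t: "t \<in> {c..\<tau>}"
    then have tp: "0 < t" using c by auto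
    show "W1 ((0, 1), 0) ((x, 0), t) = R * V (j (x, t)) * w ((x, 0), t)"
    proof (cases "t < \<tau>")
      case True
      have "((\<lambda>y. y powr a * W1 ((0, 1), 0) ((x, y), t)) \<longlongrightarrow> R * V (j (x, t)) * w ((x, 0), t)) (at_right 0)"
        using normal_limit[OF tp bc[of t x]] True tp by (simp add: j_def)
      then have "((\<lambda>y. W1 ((0, 1), 0) ((x, y), t)) \<longlongrightarrow> R * V (j (x, t)) * w ((x, 0), t)) (at_right 0)"
        by (rule Lim_transform_eventually) (auto simp: eventually_at_filter a0)
      from tendsto_unique[OF _ boundary_limit[OF cont_DD[OF diff_W1[OF eY]]] this] show ?thesis using tp by simp
    next
      case False
      then have "((x, 0), t) \<in> DD - K" using tp by (intro outside_K) (auto simp: DD_def)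
      then show ?thesis using vanishes_W1[OF eY] vanishes_w by (simp add: vanishes_def)
    qed
    have "((x, 0), t) \<in> DD" using tp by (simp add: DD_def)
    then show "gt ((x, 0), t) + ((x, 0) \<bullet> g ((x, 0), t)) / (2 * t) =
       F w ((fst (x, t), 0), snd (x, t)) ((fst ((1 / (2 * t)) *\<^sub>R x, 1::real), 0), snd ((1 / (2 * t)) *\<^sub>R x, 1::real))"
      by (simp add: F_w inner_prod_def inner_commute)
  next
    fix p :: "(real^'n) \<times> real" assume p: "p \<in> U"
    have dj: "(j has_derivative (\<lambda>h. (R *\<^sub>R fst h, R\<^sup>2 * snd h))) (at p)"
      unfolding j_def[abs_def] by (auto intro!: derivative_eq_intros)
    show "((\<lambda>p. R * V (j p)) has_derivative (\<lambda>h. R * DV (j p) (R *\<^sub>R fst h, R\<^sup>2 * snd h))) (at p)"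
      by (rule has_derivative_mult_right[OF has_derivative_compose[OF dj derV[OF p]]])
    show "((\<lambda>p. w ((fst p, 0), snd p)) has_derivative (\<lambda>h. F w ((fst p, 0), snd p) ((fst h, 0), snd h))) (at p)"
      by (rule boundary_derivative[OF p])
  next
    fix e :: "(real^'n) \<times> real" assume e: "e \<in> Basis"
    let ?h = "(R *\<^sub>R fst e, R\<^sup>2 * snd e)"
    have "continuous_on U (\<lambda>p. R * (\<Sum>i\<in>Basis. (?h \<bullet> i) * DV (j p) i))"
      by (intro continuous_on_mult continuous_on_sum continuous_on_const continuous_on_compose2[OF V2(4) cj])
         (use jQ in auto)
    moreover have "R * (\<Sum>i\<in>Basis. (?h \<bullet> i) * DV (j p) i) = R * DV (j p) ?h" if "p \<in> U" for p
      using linear_expand_Basis[OF lin[OF that], of ?h] by simp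
    ultimately show "continuous_on U (\<lambda>p. R * DV (j p) ?h)"
      by (simp cong: continuous_on_cong)
    show "edge (\<lambda>p. F w ((fst p, 0), snd p) ((fst e, 0), snd e))"
    proof -
      have "edge (\<lambda>p. g ((fst p, 0), snd p) \<bullet> (fst e, 0) + gt ((fst p, 0), snd p) * snd e)"
        by (rule edge_boundary[of "\<lambda>p. g p \<bullet> (fst e, 0) + gt p * snd e"])
           (use g_vanishes gt_vanishes in \<open>auto simp: vanishes_def gt_def intro!: continuous_on_add continuous_on_inner
             continuous_on_mult continuous_on_const cont_g cont_DD[OF diff_W1[OF Basis_T]]\<close>)
      moreover have "((fst p, 0), snd p) \<in> DD" if "p \<in> U" for p using that c by (auto simp: U_def DD_def)
      ultimately show ?thesis by (auto simp: edge_def F_w U_def cong: continuous_on_cong)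
    qed
  next
    show "edge (\<lambda>p. w ((fst p, 0), snd p))" by (rule edge_boundary[OF cont_DD[OF diff_w] vanishes_w])
    show "w ((x, 0), \<tau>) = 0" for x
    proof -
      have "((x, 0), \<tau>) \<in> DD - K" using c cd by (intro outside_K) (auto simp: DD_def)
      then show ?thesis using vanishes_w by (simp add: vanishes_def)
    qed
  next
    fix p :: "(real^'n) \<times> real" assume p: "p \<in> U" and n: "norm (fst p) \<le> 4"
    show "\<bar>R * V (j p)\<bar> \<le> R"
      using V2(1)[OF jQ[OF p]] Rp by (simp add: abs_mult mult_left_le)
    have t: "0 < snd p" "snd p \<le> \<tau>" using p c by (auto simp: U_def)
    have "R\<^sup>2 * snd p \<le> R\<^sup>2 * \<tau>" using t by (intro mult_left_mono) auto
    then have R2t: "R\<^sup>2 * snd p \<le> 1" using rng by linarith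
    let ?h = "(R *\<^sub>R ((1 / (2 * snd p)) *\<^sub>R fst p), R\<^sup>2 * 1)"
    have "\<bar>DV (j p) ?h\<bar> \<le> (\<Sum>i\<in>Basis. \<bar>?h \<bullet> i\<bar>)"
      by (rule linear_bound_Basis[OF lin[OF p] V2(2)[OF jQ[OF p]]])
    also have "\<dots> \<le> real CARD('n) * norm (R *\<^sub>R ((1 / (2 * snd p)) *\<^sub>R fst p)) + \<bar>R\<^sup>2 * 1\<bar>"
      by (rule sum_Basis_abs_pair)
    also have "\<dots> \<le> real CARD('n) * (R * 2 / snd p) + R\<^sup>2"
    proof -
      have "norm (R *\<^sub>R ((1 / (2 * snd p)) *\<^sub>R fst p)) = R * norm (fst p) / (2 * snd p)"
        using Rp t by simp
      also have "\<dots> \<le> R * 4 / (2 * snd p)" using n Rp t by (intro divide_right_mono mult_left_mono) auto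
      finally have "norm (R *\<^sub>R ((1 / (2 * snd p)) *\<^sub>R fst p)) \<le> R * 2 / snd p" using t by simp
      from mult_left_mono[OF this, of "real CARD('n)"] show ?thesis by simp
    qed
    finally have b: "\<bar>DV (j p) ?h\<bar> \<le> real CARD('n) * (R * 2 / snd p) + R\<^sup>2" .
    have "\<bar>snd p * (R * DV (j p) ?h)\<bar> = snd p * R * \<bar>DV (j p) ?h\<bar>" using t Rp by (simp add: abs_mult)
    also have "\<dots> \<le> snd p * R * (real CARD('n) * (R * 2 / snd p) + R\<^sup>2)" using b t Rp by (intro mult_left_mono) auto
    also have "\<dots> = 2 * real CARD('n) * R\<^sup>2 + R * (R\<^sup>2 * snd p)" using t by (simp add: field_simps power2_eq_square)
    also have "R * (R\<^sup>2 * snd p) \<le> R * 1" using R2t Rp by (intro mult_left_mono) auto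
    also have "R * 1 \<le> R\<^sup>2" using R by (simp add: power2_eq_square)
    finally show "\<bar>snd p * (R * DV (j p) (R *\<^sub>R fst ((1 / (2 * snd p)) *\<^sub>R fst p, 1::real), R\<^sup>2 * snd ((1 / (2 * snd p)) *\<^sub>R fst p, 1::real)))\<bar>
       \<le> (2 * real CARD('n) + 1) * R\<^sup>2" by (simp add: algebra_simps)
  qed
qed

end

section \<open>The Carleman estimate\<close>

text \<open>
  Replaces the weights \<theta>/t, k \<theta> and \<psi> by \<alpha>, \<alpha> \<sigma> and a multiple of \<sigma>.
\<close>

lemma (in weighted) unweighted_conclusion:
  assumes sg: "\<And>t. t \<in> {c..d} \<Longrightarrow> 0 < \<sigma> t \<and> \<sigma> t \<le> t \<and> t \<le> K1 * \<sigma> t" and sg_cont: "continuous_on {c..d} \<sigma>"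
    and k2: "\<And>t. t \<in> {c..d} \<Longrightarrow> k t \<le> K2" and th: "\<And>t. t \<in> {c..d} \<Longrightarrow> \<alpha> * t \<le> \<theta> t"
    and main: "\<Delta> + W + 2 * P c * \<psi> c * IX (\<lambda>p. g p \<bullet> g p) c
    \<le> 4 * IS (\<lambda>p. (P (snd p) * \<psi> (snd p)) * (L p)\<^sup>2) + 8 * \<alpha> * P c * IX (\<lambda>p. (w p)\<^sup>2) c"
  shows "\<alpha>\<^sup>2 * IS (\<lambda>p. P (snd p) * (w p)\<^sup>2) + \<alpha> * IS (\<lambda>p. (P (snd p) * \<sigma> (snd p)) * (g p \<bullet> g p))
    \<le> 4 * (K1 * K2) * IS (\<lambda>p. (P (snd p) * \<sigma> (snd p)) * (L p)\<^sup>2)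
      + P c * (8 * \<alpha> * IX (\<lambda>p. (w p)\<^sup>2) c - 2 * c * IX (\<lambda>p. g p \<bullet> g p) c)"
proof -
  have ct: "c \<in> {c..d}" using cd by simp
  have T: "snd p \<in> {c..d}" "0 < snd p" if "p \<in> S" for p using S_D[OF that] by auto
  have c3: "continuous_on {c..d} (\<lambda>t. P t * \<sigma> t)" by (intro continuous_on_mult P_cont sg_cont)
  have c1: "continuous_on {c..d} (\<lambda>t. P t * \<psi> t)" by (intro continuous_on_mult P_cont psi_cont)
  have m: "adm f \<Longrightarrow> adm (\<lambda>p. r * f p)" for f and r :: real by (rule adm_mult2[OF tame_const])
  have aL: "adm (\<lambda>p. (L p)\<^sup>2)" by (rule adm_square[OF adm_L])
  have "\<alpha>\<^sup>2 * IS (\<lambda>p. P (snd p) * (w p)\<^sup>2) = \<alpha> * IS (\<lambda>p. \<alpha> * (P (snd p) * (w p)\<^sup>2))"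
    unfolding IS_cmult by (simp add: power2_eq_square)
  also have "\<dots> \<le> W"
    unfolding W_def
  proof (rule mult_left_mono[OF IS_mono[OF m[OF adm_time[OF P_cont adm_ww]] adm_time[OF cont_Pth adm_ww]]])
    fix p assume p: "p \<in> S"
    have "\<alpha> \<le> \<theta> (snd p) / snd p" using th[OF T(1)[OF p]] T(2)[OF p] by (simp add: field_simps)
    then have "\<alpha> * (P (snd p) * (w p)\<^sup>2) \<le> \<theta> (snd p) / snd p * (P (snd p) * (w p)\<^sup>2)"
      using P_pos[OF T(1)[OF p]] by (intro mult_right_mono) auto
    then show "\<alpha> * (P (snd p) * (w p)\<^sup>2) \<le> (P (snd p) * \<theta> (snd p) / snd p) * (w p)\<^sup>2" by (simp add: mult_ac)
  qed (use alpha in simp)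
  finally have 1: "\<alpha>\<^sup>2 * IS (\<lambda>p. P (snd p) * (w p)\<^sup>2) \<le> W" .
  have "\<alpha> * IS (\<lambda>p. (P (snd p) * \<sigma> (snd p)) * (g p \<bullet> g p)) = IS (\<lambda>p. \<alpha> * ((P (snd p) * \<sigma> (snd p)) * (g p \<bullet> g p)))"
    unfolding IS_cmult ..
  also have "\<dots> \<le> \<Delta>"
    unfolding \<Delta>_def
  proof (rule IS_mono[OF m[OF adm_time[OF c3 adm_gg]] adm_time[OF cont_Pkth adm_gg]])
    fix p assume p: "p \<in> S"
    note t = T(1)[OF p]
    have "\<alpha> * \<sigma> (snd p) \<le> \<alpha> * snd p" using sg[OF t] alpha by (intro mult_left_mono) auto
    also have "\<dots> \<le> 1 * \<theta> (snd p)" using th[OF t] by simp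
    also have "\<dots> \<le> k (snd p) * \<theta> (snd p)" using k_ge_1[OF t] th_nonneg[OF t] by (intro mult_right_mono) auto
    finally have "(P (snd p) * (g p \<bullet> g p)) * (\<alpha> * \<sigma> (snd p)) \<le> (P (snd p) * (g p \<bullet> g p)) * (k (snd p) * \<theta> (snd p))"
      using P_pos[OF t] by (intro mult_left_mono) auto
    then show "\<alpha> * ((P (snd p) * \<sigma> (snd p)) * (g p \<bullet> g p)) \<le> (P (snd p) * k (snd p) * \<theta> (snd p)) * (g p \<bullet> g p)"
      by (simp add: mult_ac)
  qed
  finally have 2: "\<alpha> * IS (\<lambda>p. (P (snd p) * \<sigma> (snd p)) * (g p \<bullet> g p)) \<le> \<Delta>" .
  have "IS (\<lambda>p. (P (snd p) * \<psi> (snd p)) * (L p)\<^sup>2) \<le> IS (\<lambda>p. (K1 * K2) * ((P (snd p) * \<sigma> (snd p)) * (L p)\<^sup>2))"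
  proof (rule IS_mono[OF adm_time[OF c1 aL] m[OF adm_time[OF c3 aL]]])
    fix p assume p: "p \<in> S"
    note t = T(1)[OF p]
    have "\<psi> (snd p) \<le> (K1 * \<sigma> (snd p)) * K2"
      unfolding \<psi>_def using sg[OF t] k2[OF t] k_ge_1[OF t] T(2)[OF p] by (intro mult_mono) auto
    then have "(P (snd p) * (L p)\<^sup>2) * \<psi> (snd p) \<le> (P (snd p) * (L p)\<^sup>2) * ((K1 * \<sigma> (snd p)) * K2)"
      using P_pos[OF t] by (intro mult_left_mono) auto
    then show "(P (snd p) * \<psi> (snd p)) * (L p)\<^sup>2 \<le> (K1 * K2) * ((P (snd p) * \<sigma> (snd p)) * (L p)\<^sup>2)"
      by (simp add: mult_ac)
  qed
  then have 3: "IS (\<lambda>p. (P (snd p) * \<psi> (snd p)) * (L p)\<^sup>2) \<le> (K1 * K2) * IS (\<lambda>p. (P (snd p) * \<sigma> (snd p)) * (L p)\<^sup>2)"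
    unfolding IS_cmult .
  have "0 \<le> IX (\<lambda>p. g p \<bullet> g p) c" by (rule IX_nonneg[OF adm_gg ct]) simp
  then have "c * IX (\<lambda>p. g p \<bullet> g p) c \<le> \<psi> c * IX (\<lambda>p. g p \<bullet> g p) c"
    using k_ge_1[OF ct] c by (intro mult_right_mono) (auto simp: \<psi>_def)
  then have "P c * (c * IX (\<lambda>p. g p \<bullet> g p) c) \<le> P c * (\<psi> c * IX (\<lambda>p. g p \<bullet> g p) c)"
    using P_pos[OF ct] by (intro mult_left_mono) auto
  moreover have "A + B \<le> 4 * (K1 * K2) * E + P c * (8 * \<alpha> * H - 2 * c * D)"
    if "A \<le> W" "B \<le> \<Delta>" "F \<le> (K1 * K2) * E" "P c * (c * D) \<le> P c * (\<psi> c * D)"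
      "\<Delta> + W + 2 * P c * \<psi> c * D \<le> 4 * F + 8 * \<alpha> * P c * H" for A B E D F H
    using that by (simp add: algebra_simps)
  ultimately show ?thesis using 1 2 3 main by blast
qed

text \<open>
  The weight \<sigma> is controlled up to a finite time only; beyond the support of w the integrand vanishes whatever
  \<sigma> is.
\<close>

lemma (in slab) space_time_integral_eq:
  assumes "\<And>X t. X \<in> half_space \<Longrightarrow> c \<le> t \<Longrightarrow> t \<le> d \<Longrightarrow> F X t = snd X powr a * h (X, t) * G_kernel a X t"
    and "\<And>X t. X \<in> half_space \<Longrightarrow> d < t \<Longrightarrow> F X t = 0"
  shows "(LINT (X, t) : (half_space :: 'n pt set) \<times> {c..} | lborel. F X t) = IS h"
  unfolding IS_def set_lebesgue_integral_def
proof (rule Bochner_Integration.integral_cong[OF refl])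
  fix p :: "'n pt \<times> real"
  show "indicator (half_space \<times> {c..}) p *\<^sub>R (case p of (X, t) \<Rightarrow> F X t) =
      indicator S p *\<^sub>R (snd (fst p) powr a * h p * G_kernel a (fst p) (snd p))"
    using assms[of "fst p" "snd p"] by (cases p) (auto simp: indicator_def S_def not_le)
qed

theorem theorem3p6:
  fixes s a :: real
  assumes "1/2 \<le> s" "s < 1" and "a = 1 - 2 * s"
  shows "\<exists>\<delta> M :: real. 0 < \<delta> \<and> \<delta> < 1 \<and> 1 \<le> M \<and>
    (\<forall>(V :: (real^'n::finite) \<times> real \<Rightarrow> real) T x0 \<rho> R t0 VR \<alpha> lam w \<sigma> c.
       4 < T \<longrightarrow> Ck_on 2 (UNIV \<times> {0..<T}) V \<longrightarrow> Ck_norm 2 (UNIV \<times> {0..<T}) V \<le> 1 \<longrightarrow>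
       M \<le> norm x0 \<longrightarrow> 0 < \<rho> \<longrightarrow> \<rho> < 1 \<longrightarrow> R = 2 * norm x0 / \<rho> \<longrightarrow>
       0 \<le> t0 \<longrightarrow> t0 < 1/4 \<longrightarrow>
       VR = (\<lambda>x t. V (R *\<^sub>R x + x0, R\<^sup>2 * t + t0)) \<longrightarrow>
       M * R\<^sup>2 \<le> \<alpha> \<longrightarrow> lam = \<alpha> / \<delta>\<^sup>2 \<longrightarrow>
       is_sigma s lam \<sigma> \<longrightarrow>
       test_fun 4 (1 / (exp 1 * lam)) w \<longrightarrow>
       (\<forall>x. \<forall>t\<in>{0..<1 / (exp 1 * lam)}.
          has_weighted_normal_deriv a w x t (R powr (2 * s) * VR x t * w ((x, 0), t))) \<longrightarrow>
       0 < c \<longrightarrow> c \<le> 1 / (5 * lam) \<longrightarrow>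
       \<alpha>\<^sup>2 * (LINT (X, t) : half_space \<times> {c..} | lborel.
               snd X powr a * \<sigma> t powr (- 2 * \<alpha>) * (w (X, t))\<^sup>2 * G_kernel a X t)
       + \<alpha> * (LINT (X, t) : half_space \<times> {c..} | lborel.
               snd X powr a * \<sigma> t powr (1 - 2 * \<alpha>) * (norm (grad_X w X t))\<^sup>2 * G_kernel a X t)
       \<le> M * (LINT (X, t) : half_space \<times> {c..} | lborel.
               \<sigma> t powr (1 - 2 * \<alpha>) * snd X powr (- a) * \<bar>ext_op a w X t\<bar>\<^sup>2 * G_kernel a X t)
         + \<sigma> c powr (- 2 * \<alpha>) *
             (- (c / M) * (LINT X : half_space | lborel.
                 snd X powr a * (norm (grad_X w X c))\<^sup>2 * G_kernel a X c)
              + M * \<alpha> * (LINT X : half_space | lborel.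
                 snd X powr a * \<bar>w (X, c)\<bar>\<^sup>2 * G_kernel a X c)))"
proof -
  define n where "n = real CARD('n)"
  define K1 K2 :: real where "K1 = exp 1024" and "K2 = exp 256"
  \<comment> \<open>K1 and K2 bound t/\<sigma> and k.  On y = 0 the coefficient of w^2 is at most K2 (66 + 2 n) R^2.\<close>
  define M where "M = 100 * K1 * K2 * (66 + 2 * n)"
  have n0: "1 \<le> n" by (simp add: n_def)
  have K: "1 \<le> K1" "1 \<le> K2" by (simp_all add: K1_def K2_def)
  have KK: "1 \<le> K1 * K2" "K2 \<le> K1 * K2" using K mult_mono[of 1 K1 1 K2] mult_right_mono[of 1 K1 K2] by auto
  have M0: "46 * (K2 * (66 + 2 * n)) \<le> M" "128 * K2 \<le> M" "9 * K2 \<le> M" "4 * (K1 * K2) \<le> M" "8 \<le> M"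
  proof -
    have "K2 * (66 + 2 * n) \<le> (K1 * K2) * (66 + 2 * n)" using KK n0 by (intro mult_right_mono) auto
    moreover have "0 \<le> (K1 * K2) * (66 + 2 * n)" using K n0 by (intro mult_nonneg_nonneg) auto
    ultimately show "46 * (K2 * (66 + 2 * n)) \<le> M" unfolding M_def mult.assoc by linarith
    have "(K1 * K2) * 66 \<le> (K1 * K2) * (66 + 2 * n)" using KK n0 by (intro mult_left_mono) auto
    then have M': "6600 * (K1 * K2) \<le> M" unfolding M_def by (simp add: mult.assoc)
    then show "128 * K2 \<le> M" "9 * K2 \<le> M" "4 * (K1 * K2) \<le> M" "8 \<le> M" using KK by linarith+
  qed
  show ?thesis
  \<comment> \<open>Any \<delta> < 1 gives \<lambda> \<ge> \<alpha>, which is all that the argument requires of \<delta>.\<close>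
  proof (rule exI[of _ "1/2"], rule exI[of _ M], intro conjI allI impI)
    show "0 < (1/2::real)" "1/2 < (1::real)" "1 \<le> M" using M0 by auto
    fix V :: "(real^'n) \<times> real \<Rightarrow> real" and T :: real and x0 :: "real^'n" and \<rho> R t0 :: real
      and VR :: "real^'n \<Rightarrow> real \<Rightarrow> real" and \<alpha> lam :: real and w :: "'n pt \<times> real \<Rightarrow> real" and \<sigma> :: "real \<Rightarrow> real" and c :: real
    assume T: "4 < T" and V: "Ck_on 2 (UNIV \<times> {0..<T}) V" "Ck_norm 2 (UNIV \<times> {0..<T}) V \<le> 1"
      and x0: "M \<le> norm x0" and rho: "0 < \<rho>" "\<rho> < 1" and R: "R = 2 * norm x0 / \<rho>"
      and t0: "0 \<le> t0" "t0 < 1/4" and VR: "VR = (\<lambda>x t. V (R *\<^sub>R x + x0, R\<^sup>2 * t + t0))"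
      and al: "M * R\<^sup>2 \<le> \<alpha>" and lam: "lam = \<alpha> / (1/2)\<^sup>2" and sig: "is_sigma s lam \<sigma>"
      and test: "test_fun 4 (1 / (exp 1 * lam)) w"
      and bc: "\<forall>x. \<forall>t\<in>{0..<1 / (exp 1 * lam)}.
          has_weighted_normal_deriv a w x t (R powr (2 * s) * VR x t * w ((x, 0), t))"
      and c: "0 < c" "c \<le> 1 / (5 * lam)"
    have "1 * 1 \<le> norm x0 / \<rho>"
      using x0 M0 rho by (simp add: le_divide_eq)
    then have R1: "1 \<le> R" unfolding R by simp
    have R2: "1 \<le> R\<^sup>2" using power_mono[OF R1, of 2] by simp
    have MR: "M \<le> M * R\<^sup>2" using mult_left_mono[OF R2, of M] M0 by simp
    have al1: "M \<le> \<alpha>" "0 < \<alpha>" "1 \<le> \<alpha>" using MR al M0 by linarith+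
    have lam4: "lam = 4 * \<alpha>" using lam by (simp add: power2_eq_square)
    have lam0: "0 < lam" using lam4 al1 by simp
    \<comment> \<open>The slab is c \<le> t \<le> \<tau>; the support of w lies below \<tau>, and \<tau> is inside the domain of \<sigma>.\<close>
    define \<tau> where "\<tau> = 1 / (exp 1 * lam)"
    have tau0: "0 < \<tau>" using lam0 by (simp add: \<tau>_def)
    have e1: "1 < exp (1::real)" by simp
    have ctau: "c \<le> \<tau>"
    proof -
      have "exp 1 * lam \<le> 5 * lam" using exp_le lam0 by (intro mult_right_mono) auto
      then have "1 / (5 * lam) \<le> \<tau>" unfolding \<tau>_def using lam0 by (intro divide_left_mono) auto
      then show ?thesis using c by linarith
    qed
    have taul: "\<tau> < 1 / lam"
      unfolding \<tau>_def using lam0 e1 by (intro divide_strict_left_mono) auto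
    have rng: "0 < t" "t < 1 / lam" "0 < lam * t" "lam * t \<le> 1 / exp 1" if "t \<in> {c..\<tau>}" for t
    proof -
      show "0 < t" "t < 1/lam" using that c taul by auto
      then show "0 < lam * t" using lam0 by simp
      have "lam * t \<le> lam * \<tau>" using that lam0 by (intro mult_left_mono) auto
      then show "lam * t \<le> 1 / exp 1" using lam0 by (simp add: \<tau>_def)
    qed
    have u1: "lam * t \<le> 1" if "t \<in> {c..\<tau>}" for t
    proof -
      have "1 / exp 1 \<le> (1::real)" by simp
      then show ?thesis using rng(4)[OF that] by linarith
    qed
    have R2tau: "R\<^sup>2 * \<tau> \<le> 1"
    proof -
      have "R\<^sup>2 \<le> M * R\<^sup>2" using mult_right_mono[of 1 M "R\<^sup>2"] M0 by simp
      then have "R\<^sup>2 * \<tau> \<le> lam * \<tau>" using al lam4 al1 tau0 by (intro mult_right_mono) linarith+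
      also have "\<dots> \<le> 1" using u1[of \<tau>] ctau by simp
      finally show ?thesis .
    qed
    obtain k where k: "\<And>t. 0 < t \<Longrightarrow> t < 1/lam \<Longrightarrow> 0 < \<sigma> t \<and> \<sigma> t \<le> t \<and> t \<le> exp 1024 * \<sigma> t"
      "\<And>t. 0 < t \<Longrightarrow> t < 1/lam \<Longrightarrow> 1 \<le> k t \<and> k t \<le> exp 256"
      "\<And>t. 0 < t \<Longrightarrow> t < 1/lam \<Longrightarrow> (\<sigma> has_real_derivative \<sigma> t / (t * k t)) (at t)"
      "\<And>t. 0 < t \<Longrightarrow> t < 1/lam \<Longrightarrow> (k has_real_derivative k t * theta s (lam * t) / t) (at t)"
      by (rule sigma_properties[OF assms(1,2) lam0 sig]) blast
    define P where "P t = \<sigma> t powr (- 2 * \<alpha>)" for t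
    define \<theta> where "\<theta> t = theta s (lam * t)" for t
    have s: "0 < s" "s \<le> 1" using assms by auto
    have th1: "lam * t \<le> \<theta> t" "0 \<le> \<theta> t" "\<theta> t \<le> 64" if "t \<in> {c..\<tau>}" for t
    proof -
      note r = rng[OF that] u1[OF that]
      show "lam * t \<le> \<theta> t" unfolding \<theta>_def by (rule theta_lower(2)[OF s r(3,4)])
      show "0 \<le> \<theta> t" unfolding \<theta>_def by (rule theta_bounds(1)[OF assms(1,2) r(3,5)])
      have "\<theta> t \<le> 64 * (lam * t) powr (1/4)" unfolding \<theta>_def by (rule theta_bounds(2)[OF assms(1,2) r(3,5)])
      also have "\<dots> \<le> 64 * 1" using r by (intro mult_left_mono powr_le1) auto
      finally show "\<theta> t \<le> 64" by simp
    qed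
    have tha: "\<alpha> * t \<le> \<theta> t" "\<alpha> * t \<le> lam * t" if "t \<in> {c..\<tau>}" for t
    proof -
      show "\<alpha> * t \<le> lam * t" using rng(1)[OF that] al1 lam4 by (intro mult_right_mono) auto
      then show "\<alpha> * t \<le> \<theta> t" using th1(1)[OF that] by linarith
    qed
    interpret test_function_slab "TYPE('n)" a c \<tau> w
      by unfold_locales (use assms test c ctau in \<open>auto simp: \<tau>_def\<close>)
    have boundary: "has_weighted_normal_deriv a w x t (R powr (2 * s) * VR x t * w ((x, 0), t))" if "t \<in> {0..<\<tau>}" for x t
      using bc that by (simp add: \<tau>_def)
    define q where "q x t = (if a = 0 then W1 ((0, 1), 0) ((x, 0), t) else 0)" for x t
    have z: "W1 ((0, 1), 0) ((x, 0), t) = 0" if "t \<in> {c..\<tau>}" "a \<noteq> 0" for x t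
    proof (rule normal_zero[of a])
      show "a < 0" using that assms by simp
      show "0 < t" using rng(1)[OF that(1)] .
      show "has_weighted_normal_deriv a w x t (R powr (2 * s) * VR x t * w ((x, 0), t))" if "t < \<tau>"
        using boundary that \<open>0 < t\<close> by simp
    qed
    have ql: "((\<lambda>y. y powr a * W1 ((0, 1), 0) ((x, y), t)) \<longlongrightarrow> q x t) (at_right 0)" if t: "t \<in> {c..\<tau>}" for x t
    proof (cases "a = 0")
      case True
      have "0 \<le> t" using rng(1)[OF t] by simp
      from boundary_limit[OF cont_DD[OF diff_W1[OF eY]] this]
      have "((\<lambda>y. W1 ((0, 1), 0) ((x, y), t)) \<longlongrightarrow> q x t) (at_right 0)" using True by (simp add: q_def)
      then show ?thesis by (rule Lim_transform_eventually) (auto simp: eventually_at_filter True)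
    next
      case False
      then show ?thesis using flux_zero[OF _ t z] assms by (simp add: q_def)
    qed
    let ?w0 = "\<lambda>x t. w ((x, 0), t)" and ?z0 = "\<lambda>x t. gt ((x, 0), t) + ((x, 0) \<bullet> g ((x, 0), t)) / (2 * t)"
    have sc: "continuous_on {c..\<tau>} \<sigma>"
      by (intro continuous_at_imp_continuous_on ballI) (rule DERIV_isCont, rule k(3); use rng in blast)
    have W: "weighted a c \<tau> w gt g gt' g' ?w0 ?z0 q \<alpha> P k \<theta>"
      unfolding weighted_def weighted_axioms_def
    proof (intro conjI allI impI is_jet z ql)
      show "0 < \<alpha>" by (rule al1)
      fix t assume t: "t \<in> {c..\<tau>}"
      note r = rng[OF t]
      have sp: "0 < \<sigma> t" using k(1)[OF r(1,2)] by simp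
      have D: "((\<lambda>t. \<sigma> t powr (- 2 * \<alpha>)) has_real_derivative - 2 * \<alpha> * \<sigma> t powr (- 2 * \<alpha> - 1) * (\<sigma> t / (t * k t))) (at t)"
        by (rule DERIV_cong[OF DERIV_fun_powr[OF k(3)[OF r(1,2)] sp]]) simp
      show "(P has_real_derivative - 2 * \<alpha> * P t / (t * k t)) (at t)"
        unfolding P_def[abs_def] by (rule DERIV_cong[OF D]) (use sp in \<open>simp add: powr_diff\<close>)
      show "(k has_real_derivative k t * \<theta> t / t) (at t)" unfolding \<theta>_def by (rule k(4)[OF r(1,2)])
      show "0 < P t" using sp by (simp add: P_def)
      show "1 \<le> k t" using k(2)[OF r(1,2)] by simp
      show "0 \<le> \<theta> t" by (rule th1[OF t])
    next
      show "continuous_on {c..\<tau>} \<theta>" unfolding \<theta>_def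
        by (rule continuous_on_subset[OF theta_continuous[OF s(1) lam0]]) (use rng in force)
    qed
    interpret weighted "TYPE('n)" a c \<tau> w gt g gt' g' ?w0 ?z0 q \<alpha> P k \<theta> by (rule W)
    have ct: "c \<in> {c..\<tau>}" using ctau by simp
    have kb: "1 \<le> k t" "k t \<le> K2" if "t \<in> {c..\<tau>}" for t
      using k(2)[OF rng(1,2)[OF that]] by (auto simp: K2_def)
    have IX0: "0 \<le> IX (\<lambda>p. g p \<bullet> g p) c" "0 \<le> IX (\<lambda>p. (w p)\<^sup>2) c"
      by (auto intro!: IX_nonneg[OF adm_gg ct] IX_nonneg[OF adm_ww ct])
    have B: "- (\<Delta> + W) / 16 - P c * \<psi> c * IX (\<lambda>p. g p \<bullet> g p) c / 2 - \<alpha> * P c * IX (\<lambda>p. (w p)\<^sup>2) c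
      \<le> - 2 * (LINT t:{c..\<tau>}|lborel. P t * \<psi> t * BZ t) + 2 * \<alpha> * (LINT t:{c..\<tau>}|lborel. P t * BW t) \<and>
      (LINT t:{c..\<tau>}|lborel. P t * k t * \<theta> t * BW t) \<le> (\<Delta> + W) / 16"
    proof (cases "a = 0")
      case False
      then have BZ: "BZ t = 0" and BW: "BW t = 0" for t by (simp_all add: BZ_def BW_def q_def)
      have p1: "0 \<le> P c * \<psi> c * IX (\<lambda>p. g p \<bullet> g p) c" and p2: "0 \<le> \<alpha> * P c * IX (\<lambda>p. (w p)\<^sup>2) c"
        using IX0 P_pos[OF ct] pos(2)[OF ct] al1 by (auto intro!: mult_nonneg_nonneg)
      have "- (\<Delta> + W) / 16 - P c * \<psi> c * IX (\<lambda>p. g p \<bullet> g p) c / 2 - \<alpha> * P c * IX (\<lambda>p. (w p)\<^sup>2) c \<le> 0"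
      proof -
        have "- (x + y) / 16 - u / 2 - v \<le> 0" if "0 \<le> x" "0 \<le> y" "0 \<le> u" "0 \<le> v" for x y u v :: real
          using that by (simp add: field_simps)
        from this[OF Delta_nonneg W_nonneg p1 p2] show ?thesis .
      qed
      then show ?thesis unfolding BZ BW using Delta_nonneg W_nonneg by (simp add: set_lebesgue_integral_def)
    next
      case True
      then have s2: "R powr (2 * s) = R" using assms(3) R1 by simp
      have qW: "q = (\<lambda>x t. W1 ((0, 1), 0) ((x, 0), t))" using True by (auto simp: q_def fun_eq_iff)
      have bd: "has_weighted_normal_deriv a w x t (R * V (R *\<^sub>R x + x0, R\<^sup>2 * t + t0) * w ((x, 0), t))" if "t \<in> {0..<\<tau>}" for x t
        using boundary[OF that, of x] unfolding s2 VR .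
      have "R\<^sup>2 * \<tau> + t0 < T" using R2tau t0 T by linarith
      note Rb = robin_of_potential[OF True W[unfolded qW] V R1 t0(1) this R2tau bd, folded qW]
      define \<Gamma> where "\<Gamma> = K2 * (66 + 2 * n) * R\<^sup>2"
      have RR: "R \<le> R\<^sup>2" using R1 by (simp add: power2_eq_square)
      have G1: "k t * (R * (1/2 + \<theta> t) + (2 * real CARD('n) + 1) * R\<^sup>2) \<le> \<Gamma>" if t: "t \<in> {c..\<tau>}" for t
      proof -
        have "R * (1/2 + \<theta> t) \<le> R\<^sup>2 * 65" using RR th1[OF t] R1 by (intro mult_mono) auto
        then have "R * (1/2 + \<theta> t) + (2 * real CARD('n) + 1) * R\<^sup>2 \<le> (66 + 2 * n) * R\<^sup>2"
          by (simp add: n_def algebra_simps)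
        moreover have "0 \<le> R * (1/2 + \<theta> t) + (2 * real CARD('n) + 1) * R\<^sup>2" using R1 th1[OF t] by simp
        ultimately have "k t * (R * (1/2 + \<theta> t) + (2 * real CARD('n) + 1) * R\<^sup>2) \<le> K2 * ((66 + 2 * n) * R\<^sup>2)"
          using kb[OF t] by (intro mult_mono) auto
        then show ?thesis by (simp add: \<Gamma>_def mult.assoc)
      qed
      have G2: "k t * \<theta> t * R \<le> \<Gamma>" if t: "t \<in> {c..\<tau>}" for t
      proof -
        have "k t * \<theta> t * R \<le> K2 * (66 + 2 * n) * R\<^sup>2"
          using kb[OF t] th1[OF t] RR R1 n0 K by (intro mult_mono mult_nonneg_nonneg) auto
        then show ?thesis by (simp add: \<Gamma>_def)
      qed
      have G0: "0 < \<Gamma>" using K n0 R2 unfolding \<Gamma>_def by (intro mult_pos_pos) auto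
      have thsq: "\<alpha> * t \<le> (\<theta> t)\<^sup>2" if t: "t \<in> {c..\<tau>}" for t
      proof -
        note r = rng[OF t]
        have "(lam * t) powr s \<le> \<theta> t" unfolding \<theta>_def by (rule theta_lower(1)[OF s r(3,4)])
        moreover have half: "s = 1/2" using True assms(3) by simp
        have "(lam * t) powr s = sqrt (lam * t)" unfolding half by (rule powr_half_sqrt) (use r in simp)
        ultimately have "sqrt (lam * t) \<le> \<theta> t" by simp
        then have "(sqrt (lam * t))\<^sup>2 \<le> (\<theta> t)\<^sup>2" using r by (intro power_mono) auto
        then have "lam * t \<le> (\<theta> t)\<^sup>2" using r by simp
        then show ?thesis using tha(2)[OF t] by linarith
      qed
      have "46 * \<Gamma> = (46 * (K2 * (66 + 2 * n))) * R\<^sup>2" by (simp add: \<Gamma>_def)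
      also have "\<dots> \<le> M * R\<^sup>2" using M0(1) by (intro mult_right_mono) auto
      finally have alG: "46 * \<Gamma> \<le> \<alpha>" using al by linarith
      have alc: "k c * (8 * R\<^sup>2 * c + 1/16) \<le> \<alpha>"
      proof -
        have "R\<^sup>2 * c \<le> R\<^sup>2 * \<tau>" using ctau by (intro mult_left_mono) auto
        then have "8 * R\<^sup>2 * c + 1/16 \<le> 9" using R2tau by simp
        moreover have "0 \<le> 8 * R\<^sup>2 * c + 1/16" using c by simp
        ultimately have "k c * (8 * R\<^sup>2 * c + 1/16) \<le> K2 * 9" using kb[OF ct] by (intro mult_mono) auto
        then show ?thesis using M0(3) al1 by linarith
      qed
      show ?thesis
        using robin.boundary_energy_bound[OF Rb G1 G2 G0 thsq alG al1(3) alc]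
          robin.boundary_mass[OF Rb G1 G2 G0 thsq alG al1(3) alc] by blast
    qed
    have small: "2 * k t * \<theta> t \<le> \<alpha>" if t: "t \<in> {c..\<tau>}" for t
    proof -
      have "k t * \<theta> t \<le> K2 * 64" using kb[OF t] th1[OF t] by (intro mult_mono) auto
      then show ?thesis using M0(2) al1 by simp
    qed
    have sg: "0 < \<sigma> t \<and> \<sigma> t \<le> t \<and> t \<le> K1 * \<sigma> t" if "t \<in> {c..\<tau>}" for t
      using k(1)[OF rng(1,2)[OF that]] by (simp add: K1_def)
    have main: "\<alpha>\<^sup>2 * IS (\<lambda>p. P (snd p) * (w p)\<^sup>2) + \<alpha> * IS (\<lambda>p. (P (snd p) * \<sigma> (snd p)) * (g p \<bullet> g p))
      \<le> 4 * (K1 * K2) * IS (\<lambda>p. (P (snd p) * \<sigma> (snd p)) * (L p)\<^sup>2)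
        + P c * (8 * \<alpha> * IX (\<lambda>p. (w p)\<^sup>2) c - 2 * c * IX (\<lambda>p. g p \<bullet> g p) c)"
      by (rule unweighted_conclusion[OF sg sc kb(2) tha(1)
            weighted_absorption[OF small conjunct1[OF B] conjunct2[OF B]]])
    have out: "(X, t) \<in> DD - K" if "X \<in> half_space" "\<tau> < t" for X t
      using that tau0 by (intro outside_K) (auto simp: DD_def half_space_def)
    have inn: "(X, t) \<in> D0" if "X \<in> half_space" "c \<le> t" for X :: "'n pt" and t
      using that c by (simp add: D0_def)
    have tle: "\<tau> < t \<Longrightarrow> c \<le> t" for t using ctau by simp
    have Ps: "\<sigma> t powr (1 - 2 * \<alpha>) = P t * \<sigma> t" if "t \<in> {c..\<tau>}" for t
    proof -
      have "\<sigma> t powr (1 + - 2 * \<alpha>) = \<sigma> t * \<sigma> t powr (- 2 * \<alpha>)" using sg[OF that] unfolding powr_add by simp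
      then show ?thesis by (simp add: P_def)
    qed
    have I1: "(LINT (X, t) : half_space \<times> {c..} | lborel. snd X powr a * \<sigma> t powr (- 2 * \<alpha>) * (w (X, t))\<^sup>2 * G_kernel a X t)
        = IS (\<lambda>p. P (snd p) * (w p)\<^sup>2)"
      by (rule space_time_integral_eq) (use vanishes_w out in \<open>auto simp: P_def vanishes_def\<close>)
    have I2: "(LINT (X, t) : half_space \<times> {c..} | lborel. snd X powr a * \<sigma> t powr (1 - 2 * \<alpha>) * (norm (grad_X w X t))\<^sup>2 * G_kernel a X t)
        = IS (\<lambda>p. (P (snd p) * \<sigma> (snd p)) * (g p \<bullet> g p))"
      by (rule space_time_integral_eq)
         (simp_all add: Ps grad_X_eq[OF inn] tle g_vanishes[OF out] power2_norm_eq_inner)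
    have Lext: "ext_op a w X t = snd X powr a * L (X, t)" if "X \<in> half_space" "c \<le> t" for X t
      unfolding ext_op_eq[OF inn[OF that]] L_def Z_def A_def by simp
    have Lout: "ext_op a w X t = 0" if "X \<in> half_space" "\<tau> < t" for X t
    proof -
      note o = out[OF that]
      have "gt (X, t) = 0" using gt_vanishes o by (auto simp: vanishes_def)
      moreover have "g' (X, t) h = 0" for h
        unfolding g'_def by (rule sum.neutral) (simp add: F_vanishes[OF diff_W1[OF Basis_X] vanishes_W1[OF Basis_X] o])
      ultimately show ?thesis unfolding ext_op_eq[OF inn[OF that(1) tle[OF that(2)]]] using g_vanishes[OF o] by simp
    qed
    have I3: "(LINT (X, t) : half_space \<times> {c..} | lborel. \<sigma> t powr (1 - 2 * \<alpha>) * snd X powr (- a) * \<bar>ext_op a w X t\<bar>\<^sup>2 * G_kernel a X t)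
        = IS (\<lambda>p. (P (snd p) * \<sigma> (snd p)) * (L p)\<^sup>2)"
    proof (rule space_time_integral_eq)
      fix X :: "'n pt" and t assume X: "X \<in> half_space" and t: "c \<le> t" "t \<le> \<tau>"
      have y: "0 < snd X" using X by (simp add: half_space_def)
      have sq: "snd X powr (- a) * (snd X powr a * L (X, t))\<^sup>2 = snd X powr a * (L (X, t))\<^sup>2"
        using y by (simp add: power_mult_distrib powr_minus power2_eq_square)
      have ps: "\<sigma> t powr (1 - 2 * \<alpha>) = P t * \<sigma> t" using t by (simp add: Ps)
      show "\<sigma> t powr (1 - 2 * \<alpha>) * snd X powr (- a) * \<bar>ext_op a w X t\<bar>\<^sup>2 * G_kernel a X t =
          snd X powr a * ((P (snd (X, t)) * \<sigma> (snd (X, t))) * (L (X, t))\<^sup>2) * G_kernel a X t"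
        unfolding Lext[OF X t(1)] power2_abs ps snd_conv
        using arg_cong[OF sq, of "\<lambda>z. P t * \<sigma> t * z * G_kernel a X t"] by (simp only: mult_ac)
    qed (simp add: Lout)
    have I4: "(LINT X : half_space | lborel. snd X powr a * (norm (grad_X w X c))\<^sup>2 * G_kernel a X c) = IX (\<lambda>p. g p \<bullet> g p) c"
      unfolding IX_def by (rule set_lebesgue_integral_cong) (auto simp: grad_X_eq[OF inn] power2_norm_eq_inner)
    have I5: "(LINT X : half_space | lborel. snd X powr a * \<bar>w (X, c)\<bar>\<^sup>2 * G_kernel a X c) = IX (\<lambda>p. (w p)\<^sup>2) c"
      unfolding IX_def by simp
    have E0: "0 \<le> IS (\<lambda>p. (P (snd p) * \<sigma> (snd p)) * (L p)\<^sup>2)"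
    proof (rule IS_nonneg[OF adm_time[OF continuous_on_mult[OF P_cont sc] adm_square[OF adm_L]]])
      fix p assume "p \<in> S"
      then have "snd p \<in> {c..\<tau>}" using S_D by blast
      then show "0 \<le> (P (snd p) * \<sigma> (snd p)) * (L p)\<^sup>2" using P_pos sg by (simp add: less_imp_le)
    qed
    have m1: "4 * (K1 * K2) * IS (\<lambda>p. (P (snd p) * \<sigma> (snd p)) * (L p)\<^sup>2) \<le> M * IS (\<lambda>p. (P (snd p) * \<sigma> (snd p)) * (L p)\<^sup>2)"
      by (rule mult_right_mono[OF M0(4) E0])
    have m2: "P c * (8 * \<alpha> * IX (\<lambda>p. (w p)\<^sup>2) c - 2 * c * IX (\<lambda>p. g p \<bullet> g p) c)
       \<le> P c * (- (c / M) * IX (\<lambda>p. g p \<bullet> g p) c + M * \<alpha> * IX (\<lambda>p. (w p)\<^sup>2) c)"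
    proof (rule mult_left_mono)
      have "8 * \<alpha> * IX (\<lambda>p. (w p)\<^sup>2) c \<le> M * \<alpha> * IX (\<lambda>p. (w p)\<^sup>2) c"
        using M0(5) al1 IX0 by (intro mult_right_mono) auto
      moreover have "c / M \<le> 2 * c" using M0(5) c by (simp add: field_simps)
      then have "c / M * IX (\<lambda>p. g p \<bullet> g p) c \<le> 2 * c * IX (\<lambda>p. g p \<bullet> g p) c" using IX0 by (intro mult_right_mono) auto
      ultimately show "8 * \<alpha> * IX (\<lambda>p. (w p)\<^sup>2) c - 2 * c * IX (\<lambda>p. g p \<bullet> g p) c
        \<le> - (c / M) * IX (\<lambda>p. g p \<bullet> g p) c + M * \<alpha> * IX (\<lambda>p. (w p)\<^sup>2) c" by simp
    qed (use P_pos[OF ct] in simp)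
    show "\<alpha>\<^sup>2 * (LINT (X, t) : half_space \<times> {c..} | lborel.
               snd X powr a * \<sigma> t powr (- 2 * \<alpha>) * (w (X, t))\<^sup>2 * G_kernel a X t)
       + \<alpha> * (LINT (X, t) : half_space \<times> {c..} | lborel.
               snd X powr a * \<sigma> t powr (1 - 2 * \<alpha>) * (norm (grad_X w X t))\<^sup>2 * G_kernel a X t)
       \<le> M * (LINT (X, t) : half_space \<times> {c..} | lborel.
               \<sigma> t powr (1 - 2 * \<alpha>) * snd X powr (- a) * \<bar>ext_op a w X t\<bar>\<^sup>2 * G_kernel a X t)
         + \<sigma> c powr (- 2 * \<alpha>) *
             (- (c / M) * (LINT X : half_space | lborel.
                 snd X powr a * (norm (grad_X w X c))\<^sup>2 * G_kernel a X c)
              + M * \<alpha> * (LINT X : half_space | lborel.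
                 snd X powr a * \<bar>w (X, c)\<bar>\<^sup>2 * G_kernel a X c))"
      unfolding I1 I2 I3 I4 I5 unfolding P_def[symmetric] by (rule order_trans[OF main add_mono[OF m1 m2]])
  qed
qed

end
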